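(* Let $n\ge 1$. For any $k\ge 1$ there is an injective map $\boldsymbol{\mathcal F}_{n,k}\to\boldsymbol{\mathcal F}_{n+1,k+1}$. Moreover, $\boldsymbol F_{n+1}>\boldsymbol F_n$; that is, the total number of standard Frobenius seaweeds strictly increases under the passage from $\mathfrak{sp}_{2n}$ to $\mathfrak{sp}_{2n+2}$.
   Context: The ground field is algebraically closed of characteristic zero. The index $\mathrm{ind}\,\mathfrak q$ of a Lie algebra $\mathfrak q$ is the minimum over $\gamma\in\mathfrak q^*$ of $\dim\mathfrak q_\gamma$, where $\mathfrak q_\gamma=\{x\in\mathfrak q:\gamma([x,y])=0\ \forall y\in\mathfrak q\}$. A Lie algebra is Frobenius if its index is $0$. **Symplectic seaweeds.** Realise $$\mathfrak{sp}_{2n}=\left\{\begin{pmatrix}A&B\\ C&-\hat A\end{pmatrix}: A,B,C\in\mathfrak{gl}_n,\ B=\hat B,\ C=\hat C\right\}\subset\mathfrak{gl}_{2n},$$ where $\hat{\ }$ denotes the transpose with respect to the antidiagonal. A composition is a finite (possibly empty) sequence of positive integers. Given a composition $\underline a=(a_1,\dots,a_s)$ with $\sum a_i\le n$, put $d=n-\sum a_i$ and $\underline{\tilde a}=(a_1,\dots,a_s,2d,a_s,\dots,a_1)$, a symmetric composition of $2n$ (the part $2d$ is omitted if $d=0$). Let $\mathfrak p_1\subset\mathfrak{sp}_{2n}$ be the intersection with $\mathfrak{sp}_{2n}$ of the algebra of block upper-triangular matrices with consecutive diagonal block sizes $\underline{\tilde a}$. Likewise, for $\underline b$ with $\sum b_j\le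 n$, let $\mathfrak p_2^-$ be the intersection with $\mathfrak{sp}_{2n}$ of the block lower-triangular matrices with block sizes $\underline{\tilde b}$. The standard seaweed is $\mathfrak q^{\sf C}_n(\underline a\mid\underline b)=\mathfrak p_1\cap\mathfrak p_2^-$. **Type-C meander graph.** $\Gamma^{\sf C}_n(\underline a\mid\underline b)$ has vertices $1,\dots,2n$ placed consecutively on a horizontal line. Cut $1,\dots,2n$ into consecutive intervals of lengths given by $\underline{\tilde a}$; for each interval $\{p,\dots,q\}$ draw above the line the nested arcs joining $p$ with $q$, $p+1$ with $q-1$, etc. (the middle vertex of an odd interval gets no arc). Draw arcs below the line in the same way using $\underline{\tilde b}$. An arc is central if it crosses the vertical line between vertices $n$ and $n+1$; there are $n-\sum a_i$ central arcs above and $n-\sum b_j$ central arcs below the line. **Frobenius sets.** $\boldsymbol{\mathcal F}_{n,k}$ is the set of Frobenius standard seaweeds $\mathfrak q^{\sf C}_n(\underline a\mid\underline b)\subset\mathfrak{sp}_{2n}$ whose meander graph has exactly $k$ central arcs, and $\boldsymbol{\mathcal F}_n$ is the set of all Frobenius standard seaweeds of $\mathfrak{sp}_{2n}$ (one has $\boldsymbol{\mathcal F}_n=\bigsqcup_{k=1}^n\boldsymbol{\mathcal F}_{n,k}$). Let $\sim$ be the equivalence relation identifying $\mathfrak q^{\sf C}_n(\underline a\mid\underline b)$ with $\mathfrak q^{\sf C}_n(\underline b\mid\underline a)$. Put $\boldsymbol F_n=\#(\boldsymbol{\mathcal F}_n/{\sim})$. *)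

theory Defs
  imports "Jordan_Normal_Form.VS_Connect" "HOL-Library.FuncSet"
begin

text \<open>Rows, columns and graph vertices are numbered from \<open>0\<close>, so the vertices
  \<open>1, \<dots>, 2n\<close> of the meander graph appear here as \<open>0, \<dots>, 2n - 1\<close>.\<close>

section \<open>Index of a Lie algebra of matrices\<close>

definition lie_bracket :: "'k::field mat \<Rightarrow> 'k mat \<Rightarrow> 'k mat" where
  "lie_bracket x y = x * y - y * x"

text \<open>Values of a form outside \<open>q\<close> are unconstrained; they play no role below,
  because \<open>q\<close> is closed under the bracket.\<close>

definition linear_forms :: "'k::field mat set \<Rightarrow> ('k mat \<Rightarrow> 'k) set" where
  "linear_forms q = {\<gamma>. (\<forall>x\<in>q. \<forall>y\<in>q. \<gamma> (x + y) = \<gamma> x + \<gamma> y) \<and>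
                        (\<forall>c. \<forall>x\<in>q. \<gamma> (c \<cdot>\<^sub>m x) = c * \<gamma> x)}"

definition form_stabilizer :: "'k::field mat set \<Rightarrow> ('k mat \<Rightarrow> 'k) \<Rightarrow> 'k mat set" where
  "form_stabilizer q \<gamma> = {x \<in> q. \<forall>y\<in>q. \<gamma> (lie_bracket x y) = 0}"

definition mat_subspace_dim :: "nat \<Rightarrow> 'k::field mat set \<Rightarrow> nat" where
  "mat_subspace_dim N W =
     vectorspace.dim (class_ring :: 'k ring) (module_mat TYPE('k) N N\<lparr>carrier := W\<rparr>)"

definition lie_index :: "nat \<Rightarrow> 'k::field mat set \<Rightarrow> nat" where
  "lie_index N q = (LEAST d. \<exists>\<gamma>\<in>linear_forms q. mat_subspace_dim N (form_stabilizer q \<gamma>) = d)"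

definition frobenius :: "nat \<Rightarrow> 'k::field mat set \<Rightarrow> bool" where
  "frobenius N q \<longleftrightarrow> lie_index N q = 0"


section \<open>Symplectic seaweeds\<close>

definition anti_transpose :: "'k mat \<Rightarrow> 'k mat" where
  "anti_transpose A = mat (dim_col A) (dim_row A)
     (\<lambda>(i, j). A $$ (dim_row A - 1 - j, dim_col A - 1 - i))"

definition sp :: "nat \<Rightarrow> 'k::field mat set" where
  "sp n = {four_block_mat A B C (- anti_transpose A) | A B C.
     A \<in> carrier_mat n n \<and> B \<in> carrier_mat n n \<and> C \<in> carrier_mat n n \<and>
     B = anti_transpose B \<and> C = anti_transpose C}"

definition comp_le :: "nat \<Rightarrow> nat list \<Rightarrow> bool" where
  "comp_le n a \<longleftrightarrow> (\<forall>x\<in>set a. 0 < x) \<and> sum_list a \<le> n"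

definition sym_comp :: "nat \<Rightarrow> nat list \<Rightarrow> nat list" where
  "sym_comp n a =
     a @ (if sum_list a = n then [] else [2 * (n - sum_list a)]) @ rev a"

definition block :: "nat list \<Rightarrow> nat \<Rightarrow> nat set" where
  "block c r = {sum_list (take r c)..<sum_list (take (Suc r) c)}"

definition block_upper :: "nat list \<Rightarrow> 'k::field mat set" where
  "block_upper c = {M \<in> carrier_mat (sum_list c) (sum_list c).
     \<forall>r<length c. \<forall>s<length c. s < r \<longrightarrow> (\<forall>i\<in>block c r. \<forall>j\<in>block c s. M $$ (i, j) = 0)}"

definition block_lower :: "nat list \<Rightarrow> 'k::field mat set" where
  "block_lower c = {M \<in> carrier_mat (sum_list c) (sum_list c).
     \<forall>r<length c. \<forall>s<length c. r < s \<longrightarrow> (\<forall>i\<in>block c r. \<forall>j\<in>block c s. M $$ (i, j) = 0)}"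

definition seaweed :: "nat \<Rightarrow> nat list \<Rightarrow> nat list \<Rightarrow> 'k::field mat set" where
  "seaweed n a b =
     (sp n \<inter> block_upper (sym_comp n a)) \<inter> (sp n \<inter> block_lower (sym_comp n b))"


section \<open>Type-C meander graphs\<close>

text \<open>The arcs over a block \<open>{p..<q}\<close> join \<open>p + t\<close> with \<open>q - 1 - t\<close>, that is, distinct
  vertices of the block whose sum is \<open>p + q - 1\<close>.\<close>

definition nested_arcs :: "nat list \<Rightarrow> (nat \<times> nat) set" where
  "nested_arcs c = {(u, v). u < v \<and> (\<exists>r<length c. u \<in> block c r \<and> v \<in> block c r \<and>
     u + v + 1 = sum_list (take r c) + sum_list (take (Suc r) c))}"

text \<open>The graph may have double edges: an arc above and an arc below with the same endpoints
  are different arcs.\<close>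

datatype side = Above | Below

definition meander_arcs :: "nat \<Rightarrow> nat list \<Rightarrow> nat list \<Rightarrow> (side \<times> nat \<times> nat) set" where
  "meander_arcs n a b =
     {Above} \<times> nested_arcs (sym_comp n a) \<union> {Below} \<times> nested_arcs (sym_comp n b)"

definition central_arcs :: "nat \<Rightarrow> nat list \<Rightarrow> nat list \<Rightarrow> (side \<times> nat \<times> nat) set" where
  "central_arcs n a b = {(s, u, v) \<in> meander_arcs n a b. u < n \<and> n \<le> v}"


section \<open>Frobenius seaweeds\<close>

definition frobenius_seaweeds :: "nat \<Rightarrow> 'k::field mat set set" where
  "frobenius_seaweeds n = {seaweed n a b | a b.
     comp_le n a \<and> comp_le n b \<and> frobenius (2 * n) (seaweed n a b :: 'k mat set)}"

definition frobenius_seaweeds_central :: "nat \<Rightarrow> nat \<Rightarrow> 'k::field mat set set" where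
  "frobenius_seaweeds_central n k = {seaweed n a b | a b.
     comp_le n a \<and> comp_le n b \<and> frobenius (2 * n) (seaweed n a b :: 'k mat set) \<and>
     card (central_arcs n a b) = k}"

text \<open>That this relation is transitive depends on the fact that a standard seaweed determines
  the pair of compositions it comes from.\<close>

definition swap_rel :: "nat \<Rightarrow> ('k::field mat set \<times> 'k mat set) set" where
  "swap_rel n = {(q, q'). q \<in> frobenius_seaweeds n \<and> q' \<in> frobenius_seaweeds n \<and>
     (\<exists>a b. comp_le n a \<and> comp_le n b \<and> q = seaweed n a b \<and>
            (q' = seaweed n a b \<or> q' = seaweed n b a))}"

definition num_frobenius :: "'k::field itself \<Rightarrow> nat \<Rightarrow> nat" where
  "num_frobenius _ n = card ((frobenius_seaweeds n :: 'k mat set set) // swap_rel n)"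

end

theory Submission
  imports Defs
begin

text \<open>A composition amounts to the set of its partial sums, so a standard seaweed is given by two
  sets \<open>P\<close> and \<open>Q\<close> of cuts in \<open>{1..n}\<close> (\<open>seaweed_eq_cut_seaweed\<close>), and it determines them. The central
  arcs above and below the line are counted by the distances from \<open>n\<close> to the last cut in \<open>P\<close> and in
  \<open>Q\<close> (\<open>card_central_arcs\<close>). A seaweed is Frobenius if and only if some linear form on it has
  stabiliser zero.

  The injection adds the cut \<open>n + 1\<close> to that set which contains \<open>n\<close>; then there is one more
  central arc on the side of the other set. It rests on two facts.

  First, for a Frobenius seaweed exactly one of the two sets contains \<open>n\<close>. If both do, the seaweed
  has a nonzero centre (\<open>not_frobenius_if_both_full\<close>). If neither does, a unipotent conjugation
  turns any Frobenius form into one that, against elements of a middle symplectic subalgebra, is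
  the trace form of an element \<open>X\<close> of this subalgebra; but then \<open>X\<close> stabilises the form, or all of
  the subalgebra does if \<open>X\<close> is zero (\<open>not_frobenius_if_neither_full\<close>).

  Second, the new seaweed is again Frobenius (\<open>frobenius_add_vertex\<close>). It is larger than the old one
  by a torus element, a long root vector that pairs with it, and two rows that are paired with each
  other by the values of the old form on a block of symmetric matrices. That pairing is
  nondegenerate because a vector \<open>v\<close> in its kernel would make \<open>v v\<^sup>T\<close> stabilise the old form
  (\<open>sym_block_nondegenerate\<close>).

  The extension commutes with exchanging \<open>P\<close> and \<open>Q\<close>, so it induces an injection on classes. All its
  values have a set of cuts that contains \<open>n\<close> and \<open>n + 1\<close>, whereas the Frobenius seaweed of rank
  \<open>N = n + 1\<close> with \<open>P = {1..N div 2}\<close> and \<open>Q = {N}\<close> has none (\<open>frobenius_staircase\<close>); hence the number of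
  classes grows strictly.\<close>

section \<open>Frobenius forms\<close>

definition mat_lie_algebra :: "nat \<Rightarrow> 'k::field mat set \<Rightarrow> bool" where
  "mat_lie_algebra N q \<longleftrightarrow> q \<subseteq> carrier_mat N N \<and> 0\<^sub>m N N \<in> q \<and>
     (\<forall>x\<in>q. \<forall>y\<in>q. x + y \<in> q) \<and> (\<forall>c. \<forall>x\<in>q. c \<cdot>\<^sub>m x \<in> q) \<and>
     (\<forall>x\<in>q. \<forall>y\<in>q. lie_bracket x y \<in> q)"

definition frobenius_form :: "nat \<Rightarrow> 'k::field mat set \<Rightarrow> ('k mat \<Rightarrow> 'k) \<Rightarrow> bool" where
  "frobenius_form N q \<gamma> \<longleftrightarrow> \<gamma> \<in> linear_forms q \<and> form_stabilizer q \<gamma> = {0\<^sub>m N N}"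

lemma submodule_matI:
  assumes "W \<subseteq> carrier_mat N N" "0\<^sub>m N N \<in> W"
    "\<And>x y. x \<in> W \<Longrightarrow> y \<in> W \<Longrightarrow> x + y \<in> W" "\<And>c x. x \<in> W \<Longrightarrow> c \<cdot>\<^sub>m x \<in> W"
  shows "submodule (class_ring :: 'k::field ring) W (module_mat TYPE('k) N N)"
proof -
  interpret matrix_vs N N "TYPE('k)" .
  show ?thesis
    using assms by (unfold_locales) (auto simp: matrix_vs_simps)
qed

text \<open>The dimension of a space is specified only if the space has a finite spanning set, so one has
to be produced for every subspace. Induction on the positions where its elements may be nonzero:
an element \<open>w\<close> with a nonzero entry at the new position reduces all the others, by subtracting
multiples of \<open>w\<close>, to elements that vanish there.\<close>

lemma finite_spanning_set:
  fixes W :: "'k::field mat set"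
  assumes "finite K"
    and "W \<subseteq> carrier_mat N N" "0\<^sub>m N N \<in> W"
    and "\<And>x y. x \<in> W \<Longrightarrow> y \<in> W \<Longrightarrow> x + y \<in> W" "\<And>c x. x \<in> W \<Longrightarrow> c \<cdot>\<^sub>m x \<in> W"
    and "\<And>x i j. x \<in> W \<Longrightarrow> i < N \<Longrightarrow> j < N \<Longrightarrow> (i, j) \<notin> K \<Longrightarrow> x $$ (i, j) = 0"
  shows "\<exists>A. finite A \<and> A \<subseteq> W \<and> W \<subseteq> LinearCombinations.module.span (class_ring :: 'k ring) (module_mat TYPE('k) N N) A"
  using assms
proof (induction K arbitrary: W rule: finite_induct)
  case empty
  interpret matrix_vs N N "TYPE('k)" .
  have "W \<subseteq> {0\<^sub>m N N}"
    using empty.prems by (auto intro!: eq_matI)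
  then show ?case
    by (intro exI[of _ "{}"]) (auto simp: span_empty)
next
  case (insert k K)
  interpret matrix_vs N N "TYPE('k)" .
  obtain i j where k: "k = (i, j)" by force
  show ?case
  proof (cases "\<forall>x\<in>W. i < N \<longrightarrow> j < N \<longrightarrow> x $$ (i, j) = 0")
    case True
    have zero: "x $$ (i', j') = 0" if "x \<in> W" "i' < N" "j' < N" "(i', j') \<notin> K" for x i' j'
      using that insert.prems(5)[of x i' j'] True k by (cases "(i', j') = k") auto
    show ?thesis
      by (rule insert.IH) (use insert.prems(1-4) zero in auto)
  next
    case False
    then obtain w where w: "w \<in> W" "i < N" "j < N" "w $$ (i, j) \<noteq> 0" by blast
    define W0 where "W0 = {x \<in> W. x $$ (i, j) = 0}"
    have "\<exists>A. finite A \<and> A \<subseteq> W0 \<and> W0 \<subseteq> span A"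
    proof (rule insert.IH)
      show "0\<^sub>m N N \<in> W0" using insert.prems w by (auto simp: W0_def)
      show "x + y \<in> W0" if "x \<in> W0" "y \<in> W0" for x y
      proof -
        from that insert.prems(1) have "x \<in> carrier_mat N N" "y \<in> carrier_mat N N"
          by (auto simp: W0_def)
        then show ?thesis using that insert.prems w by (auto simp: W0_def)
      qed
      show "c \<cdot>\<^sub>m x \<in> W0" if "x \<in> W0" for c x
      proof -
        from that insert.prems(1) have "x \<in> carrier_mat N N"
          by (auto simp: W0_def)
        then show ?thesis using that insert.prems w by (auto simp: W0_def)
      qed
      show "x $$ (i', j') = 0" if "x \<in> W0" "i' < N" "j' < N" "(i', j') \<notin> K" for x i' j'
        using that insert.prems(5)[of x i' j'] k by (auto simp: W0_def)
    qed (use insert.prems in \<open>auto simp: W0_def\<close>)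
    then obtain A where A: "finite A" "A \<subseteq> W0" "W0 \<subseteq> span A" by blast
    have AW: "insert w A \<subseteq> W" using A w by (auto simp: W0_def)
    have Ac: "insert w A \<subseteq> carrier_mat N N" using AW insert.prems(1) by blast
    have sm: "submodule class_ring (span (insert w A)) V"
      by (rule span_is_submodule) (use Ac in simp)
    have "W \<subseteq> span (insert w A)"
    proof
      fix x assume x: "x \<in> W"
      define c where "c = x $$ (i, j) / w $$ (i, j)"
      define x0 where "x0 = x + (- c) \<cdot>\<^sub>m w"
      have xc: "x \<in> carrier_mat N N" "w \<in> carrier_mat N N" using x w insert.prems(1) by auto
      have "x0 \<in> W0" using x w insert.prems(3,4) xc
        by (auto simp: W0_def x0_def c_def)
      then have "x0 \<in> span A" using A by blast
      then have x0: "x0 \<in> span (insert w A)"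
        using span_is_monotone[of A "insert w A"] by blast
      have ws: "w \<in> span (insert w A)"
        using in_own_span[of "insert w A"] Ac by simp
      have "x = x0 + c \<cdot>\<^sub>m w" using xc by (auto simp: x0_def intro!: eq_matI)
      also have "\<dots> \<in> span (insert w A)"
        using submodule.m_closed[OF sm x0] submodule.smult_closed[OF sm _ ws]
        by (auto simp: matrix_vs_simps)
      finally show "x \<in> span (insert w A)" .
    qed
    then show ?thesis using A AW by (intro exI[of _ "insert w A"]) auto
  qed
qed

lemma mat_subspace_dim_eq_0_iff:
  fixes W :: "'k::field mat set"
  assumes "W \<subseteq> carrier_mat N N" "0\<^sub>m N N \<in> W"
    "\<And>x y. x \<in> W \<Longrightarrow> y \<in> W \<Longrightarrow> x + y \<in> W" "\<And>c x. x \<in> W \<Longrightarrow> c \<cdot>\<^sub>m x \<in> W"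
  shows "mat_subspace_dim N W = 0 \<longleftrightarrow> W = {0\<^sub>m N N}"
proof -
  interpret matrix_vs N N "TYPE('k)" .
  have sm: "submodule class_ring W V" by (rule submodule_matI) (use assms in auto)
  then have sub: "subspace class_ring W V"
    using matrix_vs[where 'a='k] by (simp add: subspace_def)
  interpret W: vectorspace class_ring "vs W"
    by (rule subspace_is_vs[OF sub])
  obtain A where A: "finite A" "A \<subseteq> W" "W \<subseteq> span A"
    using finite_spanning_set[of "{..<N} \<times> {..<N}" W N] assms by auto
  have gen: "W.span A = W"
    using span_li_not_depend(1)[OF A(2) sm] A(3) span_is_subset[of A W] sm A(2) by auto
  then have fd: "W.fin_dim"
    using A by (auto simp: W.fin_dim_def)
  have z: "zero (vs W) = 0\<^sub>m N N" by (simp add: matrix_vs_simps)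
  have e: "W.span {} = {0\<^sub>m N N}" using W.span_empty unfolding z .
  show ?thesis
  proof
    assume "mat_subspace_dim N W = 0"
    then have "W.dim = 0" by (simp add: mat_subspace_dim_def)
    moreover obtain B where B: "finite B" "W.basis B" using W.finite_basis_exists[OF fd] by blast
    ultimately have "card B = 0" using W.dim_basis[OF B] by simp
    then have "B = {}" using B by simp
    then have "W.span {} = W" using B by (auto simp: W.basis_def)
    then show "W = {0\<^sub>m N N}" unfolding e by simp
  next
    assume "W = {0\<^sub>m N N}"
    then have "W.span {} = carrier (vs W)" unfolding e by simp
    then have "W.dim \<le> card ({} :: 'k mat set)" by (intro W.gen_ge_dim) auto
    then have "W.dim = 0" by simp
    then show "mat_subspace_dim N W = 0" by (simp add: mat_subspace_dim_def)
  qed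
qed

lemma linear_formsD:
  assumes "\<gamma> \<in> linear_forms q"
  shows "x \<in> q \<Longrightarrow> y \<in> q \<Longrightarrow> \<gamma> (x + y) = \<gamma> x + \<gamma> y" "x \<in> q \<Longrightarrow> \<gamma> (c \<cdot>\<^sub>m x) = c * \<gamma> x"
  using assms by (auto simp: linear_forms_def)

lemma linear_form_zero:
  assumes "\<gamma> \<in> linear_forms q" "mat_lie_algebra N q"
  shows "\<gamma> (0\<^sub>m N N) = 0"
proof -
  have "\<gamma> (0 \<cdot>\<^sub>m 0\<^sub>m N N) = 0 * \<gamma> (0\<^sub>m N N)"
    using assms by (intro linear_formsD(2)) (auto simp: mat_lie_algebra_def)
  then show ?thesis by simp
qed

lemma lie_bracket_carrier:
  "x \<in> carrier_mat N N \<Longrightarrow> y \<in> carrier_mat N N \<Longrightarrow> lie_bracket x y \<in> carrier_mat N N"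
  unfolding lie_bracket_def by (intro minus_carrier_mat mult_carrier_mat)

lemma lie_bracket_add_left:
  fixes x y z :: "'k::field mat"
  assumes "x \<in> carrier_mat N N" "y \<in> carrier_mat N N" "z \<in> carrier_mat N N"
  shows "lie_bracket (x + y) z = lie_bracket x z + lie_bracket y z"
proof -
  have "(x + y) * z = x * z + y * z" "z * (x + y) = z * x + z * y"
    using add_mult_distrib_mat[OF assms] mult_add_distrib_mat[OF assms(3,1,2)] by auto
  then show ?thesis using assms unfolding lie_bracket_def
    by (intro eq_matI) auto
qed

lemma lie_bracket_smult_left:
  fixes x z :: "'k::field mat"
  assumes "x \<in> carrier_mat N N" "z \<in> carrier_mat N N"
  shows "lie_bracket (c \<cdot>\<^sub>m x) z = c \<cdot>\<^sub>m lie_bracket x z"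
proof -
  have "(c \<cdot>\<^sub>m x) * z = c \<cdot>\<^sub>m (x * z)" "z * (c \<cdot>\<^sub>m x) = c \<cdot>\<^sub>m (z * x)"
    using assms by auto
  then show ?thesis using assms unfolding lie_bracket_def
    by (intro eq_matI) (auto simp: algebra_simps)
qed

lemma lie_bracket_zero_left:
  "x \<in> carrier_mat N N \<Longrightarrow> lie_bracket (0\<^sub>m N N) x = 0\<^sub>m N N"
  by (simp add: lie_bracket_def)

lemma zero_in_stabilizer:
  assumes "\<gamma> \<in> linear_forms q" "mat_lie_algebra N q"
  shows "0\<^sub>m N N \<in> form_stabilizer q \<gamma>"
  using assms linear_form_zero[OF assms]
  by (auto simp: form_stabilizer_def mat_lie_algebra_def lie_bracket_zero_left subset_iff)

lemma mat_subspace_dim_stabilizer: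
  fixes q :: "'k::field mat set"
  assumes q: "mat_lie_algebra N q" and \<gamma>: "\<gamma> \<in> linear_forms q"
  shows "mat_subspace_dim N (form_stabilizer q \<gamma>) = 0 \<longleftrightarrow> form_stabilizer q \<gamma> = {0\<^sub>m N N}"
proof (rule mat_subspace_dim_eq_0_iff)
  have c: "x \<in> carrier_mat N N" if "x \<in> q" for x using q that by (auto simp: mat_lie_algebra_def)
  have br: "lie_bracket x y \<in> q" if "x \<in> q" "y \<in> q" for x y
    using q that by (auto simp: mat_lie_algebra_def)
  show "form_stabilizer q \<gamma> \<subseteq> carrier_mat N N" using c by (auto simp: form_stabilizer_def)
  show "0\<^sub>m N N \<in> form_stabilizer q \<gamma>" by (rule zero_in_stabilizer[OF \<gamma> q])
  show "x + y \<in> form_stabilizer q \<gamma>" if "x \<in> form_stabilizer q \<gamma>" "y \<in> form_stabilizer q \<gamma>" for x y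
  proof -
    from that have xy: "x \<in> q" "y \<in> q" by (auto simp: form_stabilizer_def)
    have "\<gamma> (lie_bracket (x + y) z) = 0" if z: "z \<in> q" for z
    proof -
      have "\<gamma> (lie_bracket (x + y) z) = \<gamma> (lie_bracket x z) + \<gamma> (lie_bracket y z)"
        using xy z c br by (subst lie_bracket_add_left) (auto intro: linear_formsD[OF \<gamma>])
      then show ?thesis using that \<open>x \<in> form_stabilizer q \<gamma>\<close> \<open>y \<in> form_stabilizer q \<gamma>\<close>
        by (auto simp: form_stabilizer_def)
    qed
    then show ?thesis using q xy by (auto simp: form_stabilizer_def mat_lie_algebra_def)
  qed
  show "a \<cdot>\<^sub>m x \<in> form_stabilizer q \<gamma>" if x: "x \<in> form_stabilizer q \<gamma>" for a x
  proof -
    from that have xy: "x \<in> q" by (auto simp: form_stabilizer_def)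
    have "\<gamma> (lie_bracket (a \<cdot>\<^sub>m x) z) = 0" if z: "z \<in> q" for z
    proof -
      have "\<gamma> (lie_bracket (a \<cdot>\<^sub>m x) z) = a * \<gamma> (lie_bracket x z)"
        using xy z c br by (subst lie_bracket_smult_left) (auto intro: linear_formsD[OF \<gamma>])
      then show ?thesis using that x by (auto simp: form_stabilizer_def)
    qed
    then show ?thesis using q xy by (auto simp: form_stabilizer_def mat_lie_algebra_def)
  qed
qed

lemma frobenius_iff_frobenius_form:
  fixes q :: "'k::field mat set"
  assumes q: "mat_lie_algebra N q"
  shows "frobenius N q \<longleftrightarrow> (\<exists>\<gamma>. frobenius_form N q \<gamma>)"
proof -
  let ?P = "\<lambda>d. \<exists>\<gamma>\<in>linear_forms q. mat_subspace_dim N (form_stabilizer q \<gamma>) = d"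
  have ex: "\<exists>d. ?P d"
    by (rule exI, rule bexI[of _ "\<lambda>_. 0"]) (auto simp: linear_forms_def)
  have "frobenius N q \<longleftrightarrow> ?P 0"
    unfolding frobenius_def lie_index_def
    using LeastI_ex[OF ex] Least_eq_0[of ?P] by (metis (no_types, lifting))
  also have "\<dots> \<longleftrightarrow> (\<exists>\<gamma>. frobenius_form N q \<gamma>)"
    using mat_subspace_dim_stabilizer[OF q] by (auto simp: frobenius_form_def)
  finally show ?thesis .
qed

lemma frobenius_formI:
  assumes "mat_lie_algebra N q" "\<gamma> \<in> linear_forms q"
    and "\<And>x. x \<in> q \<Longrightarrow> (\<And>y. y \<in> q \<Longrightarrow> \<gamma> (lie_bracket x y) = 0) \<Longrightarrow> x = 0\<^sub>m N N"
  shows "frobenius_form N q \<gamma>"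
  using assms zero_in_stabilizer[OF assms(2,1)]
  by (auto simp: frobenius_form_def form_stabilizer_def)

lemma frobenius_formD:
  assumes "frobenius_form N q \<gamma>" "x \<in> q" "\<And>y. y \<in> q \<Longrightarrow> \<gamma> (lie_bracket x y) = 0"
  shows "x = 0\<^sub>m N N"
  using assms by (auto simp: frobenius_form_def form_stabilizer_def)

text \<open>The isomorphisms that matter below are \<open>x \<mapsto> - x\<^sup>T\<close>, which exchanges upper and lower cuts, and
conjugation by a unipotent symplectic matrix, which normalises a form.\<close>

lemma frobenius_form_pullback:
  fixes \<phi> :: "'k::field mat \<Rightarrow> 'k mat"
  assumes \<gamma>: "frobenius_form N q' \<gamma>" and q: "mat_lie_algebra N q"
    and img: "\<phi> ` q = q'"
    and add: "\<And>x y. x \<in> q \<Longrightarrow> y \<in> q \<Longrightarrow> \<phi> (x + y) = \<phi> x + \<phi> y"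
    and smult: "\<And>c x. x \<in> q \<Longrightarrow> \<phi> (c \<cdot>\<^sub>m x) = c \<cdot>\<^sub>m \<phi> x"
    and bracket: "\<And>x y. x \<in> q \<Longrightarrow> y \<in> q \<Longrightarrow> \<phi> (lie_bracket x y) = lie_bracket (\<phi> x) (\<phi> y)"
    and inj: "\<And>x. x \<in> q \<Longrightarrow> \<phi> x = 0\<^sub>m N N \<Longrightarrow> x = 0\<^sub>m N N"
  shows "frobenius_form N q (\<gamma> \<circ> \<phi>)"
proof (rule frobenius_formI[OF q])
  have mem: "\<phi> x \<in> q'" if "x \<in> q" for x using that img by auto
  have lf: "\<gamma> \<in> linear_forms q'" using \<gamma> by (simp add: frobenius_form_def)
  show "\<gamma> \<circ> \<phi> \<in> linear_forms q"
    using add smult mem by (auto simp: linear_forms_def linear_formsD[OF lf])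
  fix x assume x: "x \<in> q" and st: "\<And>y. y \<in> q \<Longrightarrow> (\<gamma> \<circ> \<phi>) (lie_bracket x y) = 0"
  have "\<phi> x = 0\<^sub>m N N"
  proof (rule frobenius_formD[OF \<gamma> mem[OF x]])
    fix z assume "z \<in> q'"
    then obtain y where "y \<in> q" "z = \<phi> y" using img by auto
    then show "\<gamma> (lie_bracket (\<phi> x) z) = 0" using st[of y] bracket[OF x] by simp
  qed
  then show "x = 0\<^sub>m N N" using inj x by blast
qed

section \<open>Coordinates on the symplectic Lie algebra\<close>

text \<open>Ring laws for scalars only, so that index bounds such as \<open>2 * n\<close> keep their form.\<close>

lemmas scalar_simps =
  mult.assoc[where 'a = "'k::field"] mult.commute[where 'a = "'k::field"]
  mult.left_commute[where 'a = "'k::field"] distrib_left[where 'a = "'k::field"]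
  distrib_right[where 'a = "'k::field"] left_diff_distrib[where 'a = "'k::field"]
  right_diff_distrib[where 'a = "'k::field"] add.assoc[where 'a = "'k::field"]
  add.commute[where 'a = "'k::field"] add.left_commute[where 'a = "'k::field"]

definition mir :: "nat \<Rightarrow> nat \<Rightarrow> nat" where
  "mir n i = 2 * n - 1 - i"

text \<open>With these signs a matrix lies in the symplectic Lie algebra exactly if reflecting it in the antidiagonal and
multiplying each entry by the product of the signs of its row and column turns it into its
negative.\<close>

definition half_sign :: "nat \<Rightarrow> nat \<Rightarrow> 'k::field" where
  "half_sign n i = (if i < n then 1 else - 1)"

lemma mir_less [simp]: "i < 2 * n \<Longrightarrow> mir n i < 2 * n"
  by (simp add: mir_def)

lemma mir_mir [simp]: "i < 2 * n \<Longrightarrow> mir n (mir n i) = i"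
  by (simp add: mir_def)

lemma mir_eq_iff [simp]: "i < 2 * n \<Longrightarrow> j < 2 * n \<Longrightarrow> mir n i = mir n j \<longleftrightarrow> i = j"
  by (auto simp: mir_def)

lemma mir_swap: "i < 2 * n \<Longrightarrow> j < 2 * n \<Longrightarrow> mir n i = j \<longleftrightarrow> i = mir n j"
  by (auto simp: mir_def)

lemma mir_less_half_iff: "i < 2 * n \<Longrightarrow> mir n i < n \<longleftrightarrow> \<not> i < n"
  by (auto simp: mir_def)

lemma half_sign_mir [simp]: "i < 2 * n \<Longrightarrow> half_sign n (mir n i) = - half_sign n i"
  by (auto simp: half_sign_def mir_less_half_iff)

lemma half_sign_square [simp]:
  "half_sign n i * half_sign n i = 1" "half_sign n i * (half_sign n i * c) = c"
  by (auto simp: half_sign_def)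

lemma half_sign_nonzero [simp]: "half_sign n i \<noteq> 0"
  by (auto simp: half_sign_def)

lemma sum_mir: "(\<Sum>k<2 * n. f (mir n k)) = (\<Sum>k<2 * n. f k)"
proof -
  have "(\<Sum>k<2 * n. f (mir n k)) = (\<Sum>k<2 * n. f (2 * n - Suc k))"
    by (rule sum.cong) (auto simp: mir_def)
  then show ?thesis by (simp only: sum.nat_diff_reindex)
qed

lemma mult_mat_entry:
  assumes "A \<in> carrier_mat N N" "B \<in> carrier_mat N N" "i < N" "j < N"
  shows "(A * B) $$ (i, j) = (\<Sum>k<N. A $$ (i, k) * B $$ (k, j))"
  using assms by (auto simp: scalar_prod_def atLeast0LessThan intro!: sum.cong)

lemma lie_bracket_entry:
  assumes "x \<in> carrier_mat N N" "y \<in> carrier_mat N N" "i < N" "j < N"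
  shows "lie_bracket x y $$ (i, j) = (\<Sum>k<N. x $$ (i, k) * y $$ (k, j)) - (\<Sum>k<N. y $$ (i, k) * x $$ (k, j))"
  using assms by (simp add: lie_bracket_def mult_mat_entry[symmetric])


section \<open>Seaweeds described by cuts\<close>

text \<open>The positions \<open>(i, j)\<close> at which a matrix of the seaweed may be nonzero: no cut in \<open>P\<close> and no mirror
image \<open>2 * n - p\<close> of one separates a row from a smaller column, and no cut in \<open>Q\<close> or mirror image of
one a row from a larger column. This is a preorder on the indices, which is why the matrices supported on it are
closed under multiplication.\<close>

definition cut_order :: "nat \<Rightarrow> nat set \<Rightarrow> nat set \<Rightarrow> nat \<Rightarrow> nat \<Rightarrow> bool" where
  "cut_order n P Q i j \<longleftrightarrow>
     (\<forall>p\<in>P. (p \<le> i \<longrightarrow> p \<le> j) \<and> (2 * n - p \<le> i \<longrightarrow> 2 * n - p \<le> j)) \<and>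
     (\<forall>p\<in>Q. (p \<le> j \<longrightarrow> p \<le> i) \<and> (2 * n - p \<le> j \<longrightarrow> 2 * n - p \<le> i))"

text \<open>A composition amounts to the set of its partial sums, and \<open>P\<close> and \<open>Q\<close> stand for these sets.\<close>

definition cut_seaweed :: "nat \<Rightarrow> nat set \<Rightarrow> nat set \<Rightarrow> 'k::field mat set" where
  "cut_seaweed n P Q = {M \<in> carrier_mat (2 * n) (2 * n). \<forall>i<2 * n. \<forall>j<2 * n.
     M $$ (mir n j, mir n i) = - (half_sign n i * half_sign n j * M $$ (i, j)) \<and>
     (M $$ (i, j) \<noteq> 0 \<longrightarrow> cut_order n P Q i j)}"

lemma cut_order_refl [simp]: "cut_order n P Q i i"
  by (simp add: cut_order_def)

lemma cut_order_trans: "cut_order n P Q i j \<Longrightarrow> cut_order n P Q j k \<Longrightarrow> cut_order n P Q i k"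
  unfolding cut_order_def by (intro conjI ballI impI) simp_all

lemma cut_order_mir:
  assumes "i < 2 * n" "j < 2 * n" "cut_order n P Q i j" "P \<subseteq> {..n}" "Q \<subseteq> {..n}"
  shows "cut_order n P Q (mir n j) (mir n i)"
proof -
  have *: "p \<le> mir n k \<longleftrightarrow> \<not> 2 * n - p \<le> k" "2 * n - p \<le> mir n k \<longleftrightarrow> \<not> p \<le> k"
    if "p \<le> n" "k < 2 * n" for p k
    using that by (auto simp: mir_def)
  show ?thesis unfolding cut_order_def
  proof (intro conjI ballI)
    fix p assume "p \<in> P"
    moreover from this have "p \<le> n" using assms by auto
    ultimately show "p \<le> mir n j \<longrightarrow> p \<le> mir n i" "2 * n - p \<le> mir n j \<longrightarrow> 2 * n - p \<le> mir n i"
      using assms unfolding cut_order_def by (auto simp: *)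
  next
    fix p assume "p \<in> Q"
    moreover from this have "p \<le> n" using assms by auto
    ultimately show "p \<le> mir n i \<longrightarrow> p \<le> mir n j" "2 * n - p \<le> mir n i \<longrightarrow> 2 * n - p \<le> mir n j"
      using assms unfolding cut_order_def by (auto simp: *)
  qed
qed

lemma cut_seaweedI:
  assumes "M \<in> carrier_mat (2 * n) (2 * n)"
    "\<And>i j. i < 2 * n \<Longrightarrow> j < 2 * n \<Longrightarrow> M $$ (mir n j, mir n i) = - (half_sign n i * half_sign n j * M $$ (i, j))"
    "\<And>i j. i < 2 * n \<Longrightarrow> j < 2 * n \<Longrightarrow> M $$ (i, j) \<noteq> 0 \<Longrightarrow> cut_order n P Q i j"
  shows "M \<in> cut_seaweed n P Q"
  using assms by (auto simp: cut_seaweed_def)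

lemma cut_seaweedD:
  assumes "M \<in> cut_seaweed n P Q"
  shows "M \<in> carrier_mat (2 * n) (2 * n)"
    "i < 2 * n \<Longrightarrow> j < 2 * n \<Longrightarrow> M $$ (mir n j, mir n i) = - (half_sign n i * half_sign n j * M $$ (i, j))"
    "i < 2 * n \<Longrightarrow> j < 2 * n \<Longrightarrow> \<not> cut_order n P Q i j \<Longrightarrow> M $$ (i, j) = 0"
  using assms by (auto simp: cut_seaweed_def)

lemma cut_seaweed_lie_algebra: "mat_lie_algebra (2 * n) (cut_seaweed n P Q :: 'k::field mat set)"
  unfolding mat_lie_algebra_def
proof (intro conjI ballI allI)
  show "cut_seaweed n P Q \<subseteq> carrier_mat (2 * n) (2 * n)" by (auto simp: cut_seaweed_def)
  show "0\<^sub>m (2 * n) (2 * n) \<in> cut_seaweed n P Q" by (auto intro!: cut_seaweedI)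
  fix x y :: "'k mat" and c :: 'k assume x: "x \<in> cut_seaweed n P Q"
  note xD = cut_seaweedD[OF x]
  show "c \<cdot>\<^sub>m x \<in> cut_seaweed n P Q"
  proof (rule cut_seaweedI)
    show "cut_order n P Q i j" if "i < 2 * n" "j < 2 * n" "(c \<cdot>\<^sub>m x) $$ (i, j) \<noteq> 0" for i j
      using that xD(1) xD(3)[of i j] by (cases "cut_order n P Q i j") auto
  qed (use xD(1) in \<open>auto simp: xD(2) scalar_simps\<close>)
  assume y: "y \<in> cut_seaweed n P Q"
  note yD = cut_seaweedD[OF y]
  show "x + y \<in> cut_seaweed n P Q"
  proof (rule cut_seaweedI)
    show "cut_order n P Q i j" if "i < 2 * n" "j < 2 * n" "(x + y) $$ (i, j) \<noteq> 0" for i j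
      using that xD(1) yD(1) xD(3)[of i j] yD(3)[of i j] by (cases "cut_order n P Q i j") auto
  qed (use xD(1) yD(1) in \<open>auto simp: xD(2) yD(2) scalar_simps\<close>)
  show "lie_bracket x y \<in> cut_seaweed n P Q"
  proof (rule cut_seaweedI)
    show "lie_bracket x y \<in> carrier_mat (2 * n) (2 * n)"
      using xD(1) yD(1) by (rule lie_bracket_carrier)
    have prod: "(\<Sum>k<2 * n. u $$ (mir n j, k) * v $$ (k, mir n i))
        = half_sign n i * half_sign n j * (\<Sum>k<2 * n. v $$ (i, k) * u $$ (k, j))"
      if ij: "i < 2 * n" "j < 2 * n" and u: "u \<in> cut_seaweed n P Q" and v: "v \<in> cut_seaweed n P Q"
      for u v :: "'k mat" and i j
    proof -
      have "(\<Sum>k<2 * n. u $$ (mir n j, k) * v $$ (k, mir n i))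
          = (\<Sum>k<2 * n. u $$ (mir n j, mir n k) * v $$ (mir n k, mir n i))"
        by (rule sum_mir[symmetric])
      also have "\<dots> = (\<Sum>k<2 * n. half_sign n i * half_sign n j * (v $$ (i, k) * u $$ (k, j)))"
        using ij by (intro sum.cong) (auto simp: cut_seaweedD(2)[OF u] cut_seaweedD(2)[OF v] scalar_simps)
      finally show ?thesis by (simp add: sum_distrib_left)
    qed
    show "lie_bracket x y $$ (mir n j, mir n i) = - (half_sign n i * half_sign n j * lie_bracket x y $$ (i, j))"
      if "i < 2 * n" "j < 2 * n" for i j
    proof -
      have "lie_bracket x y $$ (mir n j, mir n i) = half_sign n i * half_sign n j *
          ((\<Sum>k<2 * n. y $$ (i, k) * x $$ (k, j)) - (\<Sum>k<2 * n. x $$ (i, k) * y $$ (k, j)))"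
        using that xD(1) yD(1)
        by (simp only: lie_bracket_entry mir_less prod[OF that x y] prod[OF that y x] right_diff_distrib)
      also have "\<dots> = - (half_sign n i * half_sign n j * lie_bracket x y $$ (i, j))"
        using that xD(1) yD(1) by (simp only: lie_bracket_entry right_diff_distrib minus_diff_eq)
      finally show ?thesis .
    qed
    show "cut_order n P Q i j" if ij: "i < 2 * n" "j < 2 * n" and nz: "lie_bracket x y $$ (i, j) \<noteq> 0" for i j
    proof (rule ccontr)
      assume no: "\<not> cut_order n P Q i j"
      have "u $$ (i, k) * v $$ (k, j) = 0" if "k < 2 * n" "u \<in> cut_seaweed n P Q" "v \<in> cut_seaweed n P Q"
        for k and u v :: "'k mat"
        using no cut_order_trans[of n P Q i k j] cut_seaweedD(3)[OF that(2), of i k]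
          cut_seaweedD(3)[OF that(3), of k j] ij that(1) by auto
      then have "(\<Sum>k<2 * n. x $$ (i, k) * y $$ (k, j)) = 0" "(\<Sum>k<2 * n. y $$ (i, k) * x $$ (k, j)) = 0"
        using x y by (auto intro!: sum.neutral)
      then have "lie_bracket x y $$ (i, j) = 0"
        using xD(1) yD(1) ij by (simp add: lie_bracket_entry)
      then show False using nz by simp
    qed
  qed
qed

lemmas frobenius_cut_seaweed_iff = frobenius_iff_frobenius_form[OF cut_seaweed_lie_algebra]

text \<open>These span the symplectic Lie algebra. If \<open>q\<close> is the mirror image of \<open>p\<close>, the two terms fall on the
same position and the entry there is \<open>2\<close>.\<close>

definition sp_unit :: "nat \<Rightarrow> nat \<Rightarrow> nat \<Rightarrow> 'k::field mat" where
  "sp_unit n p q = mat (2 * n) (2 * n) (\<lambda>(i, j). (if i = p \<and> j = q then 1 else 0) -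
     (if i = mir n q \<and> j = mir n p then half_sign n p * half_sign n q else 0))"

lemma sp_unit_carrier [simp]: "sp_unit n p q \<in> carrier_mat (2 * n) (2 * n)"
  by (simp add: sp_unit_def)

lemma sp_unit_dim [simp]: "dim_row (sp_unit n p q) = 2 * n" "dim_col (sp_unit n p q) = 2 * n"
  by (simp_all add: sp_unit_def)

lemma sp_unit_entry [simp]:
  "i < 2 * n \<Longrightarrow> j < 2 * n \<Longrightarrow> sp_unit n p q $$ (i, j) = (if i = p \<and> j = q then 1 else 0) -
     (if i = mir n q \<and> j = mir n p then half_sign n p * half_sign n q else 0)"
  by (simp add: sp_unit_def)

text \<open>The sign identity behind the skew symmetry of \<open>sp_unit\<close>; \<open>A\<close> and \<open>B\<close> stand for the two positions
where that matrix has an entry.\<close>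

lemma sign_exchange:
  fixes c d :: "'k::field"
  assumes "c * c = 1" "A \<or> B \<Longrightarrow> d = c"
  shows "(if B then 1 else 0) - (if A then c else 0) = - (d * ((if A then 1 else 0) - (if B then c else 0)))"
  using assms by (cases A; cases B) (auto simp: right_diff_distrib)

lemma half_sign_pair_square: "half_sign n p * half_sign n q * (half_sign n p * half_sign n q) = 1"
  by (auto simp: half_sign_def)

lemma sp_unit_mem:
  assumes "p < 2 * n" "q < 2 * n" "cut_order n P Q p q" "P \<subseteq> {..n}" "Q \<subseteq> {..n}"
  shows "(sp_unit n p q :: 'k::field mat) \<in> cut_seaweed n P Q"
proof (rule cut_seaweedI)
  fix i j assume ij: "i < 2 * n" "j < 2 * n"
  have sign: "half_sign n i * half_sign n j = (half_sign n p * half_sign n q :: 'k)"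
    if "i = p \<and> j = q \<or> i = mir n q \<and> j = mir n p"
    using that assms(1,2) by (elim disjE) (simp_all add: mult.commute)
  have "(sp_unit n p q :: 'k mat) $$ (mir n j, mir n i) =
      (if i = mir n q \<and> j = mir n p then 1 else 0) - (if i = p \<and> j = q then half_sign n p * half_sign n q else 0)"
    using ij assms(1,2) by (simp add: mir_swap[of j n p] mir_swap[of i n q] conj_commute)
  also have "\<dots> = - (half_sign n i * half_sign n j * sp_unit n p q $$ (i, j))"
    unfolding sp_unit_entry[OF ij] by (rule sign_exchange[OF half_sign_pair_square sign])
  finally show "(sp_unit n p q :: 'k mat) $$ (mir n j, mir n i) = - (half_sign n i * half_sign n j * sp_unit n p q $$ (i, j))" .
  show "cut_order n P Q i j" if "(sp_unit n p q :: 'k mat) $$ (i, j) \<noteq> 0"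
  proof -
    have "A \<or> B" if "(if A then 1 else 0) - (if B then c else 0) \<noteq> (0 :: 'k)" for A B c
      using that by (cases A; cases B) auto
    then have "i = p \<and> j = q \<or> i = mir n q \<and> j = mir n p"
      using that unfolding sp_unit_entry[OF ij] .
    then show ?thesis using assms(3) cut_order_mir[OF assms] by blast
  qed
qed simp

lemma sp_unit_mir:
  assumes "p < 2 * n" "q < 2 * n"
  shows "(sp_unit n (mir n q) (mir n p) :: 'k::field mat) = - (half_sign n p * half_sign n q) \<cdot>\<^sub>m sp_unit n p q"
proof (rule eq_matI)
  fix i j assume "i < dim_row (- (half_sign n p * half_sign n q) \<cdot>\<^sub>m (sp_unit n p q :: 'k mat))"
    "j < dim_col (- (half_sign n p * half_sign n q) \<cdot>\<^sub>m (sp_unit n p q :: 'k mat))"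
  then have ij: "i < 2 * n" "j < 2 * n" by (simp_all add: sp_unit_def)
  have "(sp_unit n (mir n q) (mir n p) :: 'k mat) $$ (i, j) = (if i = mir n q \<and> j = mir n p then 1 else 0) -
      (if i = p \<and> j = q then half_sign n p * half_sign n q else 0)"
    using assms ij by (simp add: mult.commute)
  also have "\<dots> = - (half_sign n p * half_sign n q * sp_unit n p q $$ (i, j))"
    unfolding sp_unit_entry[OF ij] by (rule sign_exchange[OF half_sign_pair_square refl])
  also have "\<dots> = (- (half_sign n p * half_sign n q) \<cdot>\<^sub>m sp_unit n p q) $$ (i, j)"
    using ij by (simp add: sp_unit_def)
  finally show "(sp_unit n (mir n q) (mir n p) :: 'k mat) $$ (i, j) = (- (half_sign n p * half_sign n q) \<cdot>\<^sub>m sp_unit n p q) $$ (i, j)" .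
qed (simp_all add: sp_unit_def)

text \<open>The factor \<open>1 / 2\<close> compensates that mirror images of a position contribute equally to the sum over
all positions.\<close>

definition form_coeff :: "nat \<Rightarrow> ('k::field_char_0 mat \<Rightarrow> 'k) \<Rightarrow> nat \<Rightarrow> nat \<Rightarrow> 'k" where
  "form_coeff n \<gamma> i j = \<gamma> (sp_unit n i j) / 2"

lemma form_coeff_mir:
  fixes \<gamma> :: "'k::field_char_0 mat \<Rightarrow> 'k"
  assumes "\<gamma> \<in> linear_forms (cut_seaweed n P Q)" "i < 2 * n" "j < 2 * n" "cut_order n P Q i j"
    "P \<subseteq> {..n}" "Q \<subseteq> {..n}"
  shows "form_coeff n \<gamma> (mir n j) (mir n i) = - (half_sign n i * half_sign n j * form_coeff n \<gamma> i j)"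
  using assms by (simp add: form_coeff_def sp_unit_mir linear_formsD(2)[OF assms(1) sp_unit_mem])

text \<open>Induction on the number of nonzero entries: subtracting a multiple of \<open>sp_unit n p q\<close> removes the
entry at \<open>(p, q)\<close> together with its mirror image and creates no new ones.\<close>

lemma form_expansion:
  fixes \<gamma> :: "'k::field_char_0 mat \<Rightarrow> 'k"
  assumes \<gamma>: "\<gamma> \<in> linear_forms (cut_seaweed n P Q)" and PQ: "P \<subseteq> {..n}" "Q \<subseteq> {..n}"
    and x: "x \<in> cut_seaweed n P Q"
  shows "\<gamma> x = (\<Sum>i<2 * n. \<Sum>j<2 * n. form_coeff n \<gamma> i j * x $$ (i, j))"
proof -
  define S where "S = (\<lambda>x :: 'k mat. {(i, j). i < 2 * n \<and> j < 2 * n \<and> x $$ (i, j) \<noteq> 0})"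
  define F where "F = (\<lambda>x :: 'k mat. \<Sum>i<2 * n. \<Sum>j<2 * n. form_coeff n \<gamma> i j * x $$ (i, j))"
  have lie: "mat_lie_algebra (2 * n) (cut_seaweed n P Q :: 'k mat set)" by (rule cut_seaweed_lie_algebra)
  have fin: "finite (S x)" for x
    by (rule finite_subset[of _ "{..<2 * n} \<times> {..<2 * n}"]) (auto simp: S_def)
  from x have "\<gamma> x = F x"
  proof (induction "card (S x)" arbitrary: x rule: less_induct)
    case less
    note xD = cut_seaweedD[OF less.prems]
    show ?case
    proof (cases "S x = {}")
      case True
      then have z: "x $$ (i, j) = 0" if "i < 2 * n" "j < 2 * n" for i j using that by (auto simp: S_def)
      then have "x = 0\<^sub>m (2 * n) (2 * n)" using xD(1) by (intro eq_matI) auto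
      then have "\<gamma> x = 0" using linear_form_zero[OF \<gamma> lie] by simp
      then show ?thesis using z by (simp add: F_def)
    next
      case False
      then obtain p q where pq: "p < 2 * n" "q < 2 * n" "x $$ (p, q) \<noteq> 0" by (auto simp: S_def)
      have ord: "cut_order n P Q p q" using xD(3) pq by blast
      define u where "u = (sp_unit n p q :: 'k mat)"
      define c where "c = (if q = mir n p then x $$ (p, q) / 2 else x $$ (p, q))"
      define x' where "x' = x + (- c) \<cdot>\<^sub>m u"
      have u: "u \<in> cut_seaweed n P Q" unfolding u_def by (rule sp_unit_mem[OF pq(1,2) ord PQ])
      have uc: "u \<in> carrier_mat (2 * n) (2 * n)" using cut_seaweedD(1)[OF u] .
      have x': "x' \<in> cut_seaweed n P Q" using less.prems u lie by (auto simp: x'_def mat_lie_algebra_def)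
      have x'e: "x' $$ (i, j) = x $$ (i, j) - c * u $$ (i, j)" if "i < 2 * n" "j < 2 * n" for i j
        using that xD(1) uc by (simp add: x'_def)
      have "S x' \<subset> S x"
      proof
        have "half_sign n p * half_sign n (mir n p) = (-1 :: 'k)" using pq by simp
        then have "x' $$ (p, q) = 0" using pq mir_swap[of p n q]
          by (cases "q = mir n p") (simp_all add: x'e c_def u_def)
        then show "S x' \<noteq> S x" using pq by (auto simp: S_def)
        have "x' $$ (i, j) = 0" if "i < 2 * n" "j < 2 * n" "x $$ (i, j) = 0" for i j
        proof -
          have "\<not> (i = p \<and> j = q)" using that pq by auto
          moreover have "\<not> (i = mir n q \<and> j = mir n p)" using that pq xD(2)[of p q] by auto
          ultimately have "u $$ (i, j) = 0" using that unfolding u_def by (simp only: sp_unit_entry if_False) simp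
          then show ?thesis using that by (simp add: x'e)
        qed
        then show "S x' \<subseteq> S x" by (auto simp: S_def)
      qed
      then have "card (S x') < card (S x)" by (intro psubset_card_mono fin)
      then have IH: "\<gamma> x' = F x'" using less.hyps x' by blast
      have xeq: "x = x' + c \<cdot>\<^sub>m u" using xD(1) uc by (auto simp: x'_def intro!: eq_matI)
      have "F u = (\<Sum>i<2 * n. \<Sum>j<2 * n. (if i = p then if j = q then form_coeff n \<gamma> i j else 0 else 0)
          - (if i = mir n q then if j = mir n p then form_coeff n \<gamma> i j * (half_sign n p * half_sign n q) else 0 else 0))"
      proof -
        have split: "f * ((if A \<and> B then 1 else 0) - (if C \<and> D then s else 0)) =
            (if A then if B then f else 0 else 0) - (if C then if D then f * s else 0 else 0)"
          for A B C D and f s :: 'k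
          by (cases A; cases B; cases C; cases D) (auto simp: right_diff_distrib)
        have e: "form_coeff n \<gamma> i j * u $$ (i, j) =
            (if i = p then if j = q then form_coeff n \<gamma> i j else 0 else 0)
          - (if i = mir n q then if j = mir n p then form_coeff n \<gamma> i j * (half_sign n p * half_sign n q) else 0 else 0)"
          if "i < 2 * n" "j < 2 * n" for i j
          unfolding u_def sp_unit_entry[OF that] by (rule split)
        show ?thesis unfolding F_def by (intro sum.cong refl e) simp_all
      qed
      also have "\<dots> = form_coeff n \<gamma> p q - form_coeff n \<gamma> (mir n q) (mir n p) * (half_sign n p * half_sign n q)"
      proof -
        have double: "(\<Sum>i<2 * n. \<Sum>j<2 * n. if i = a then if j = b then h i j else 0 else 0) = h a b"
          if "a < 2 * n" "b < 2 * n" for a b and h :: "nat \<Rightarrow> nat \<Rightarrow> 'k"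
        proof -
          have "(\<Sum>i<2 * n. \<Sum>j<2 * n. if i = a then if j = b then h i j else 0 else 0)
              = (\<Sum>i<2 * n. if i = a then h i b else 0)"
            using that by (intro sum.cong refl) simp
          then show ?thesis using that by simp
        qed
        show ?thesis using pq by (simp add: sum_subtractf double)
      qed
      also have "\<dots> = \<gamma> u"
        unfolding form_coeff_mir[OF \<gamma> pq(1,2) ord PQ] u_def
        by (simp add: scalar_simps form_coeff_def)
      finally have Fu: "F u = \<gamma> u" .
      have "F x = F x' + c * F u"
        using cut_seaweedD(1)[OF x'] uc unfolding F_def
        by (subst (1) xeq) (auto simp: sum.distrib sum_distrib_left scalar_simps)
      moreover have "\<gamma> x = \<gamma> x' + c * \<gamma> u"
      proof -
        have "c \<cdot>\<^sub>m u \<in> cut_seaweed n P Q" using u lie by (auto simp: mat_lie_algebra_def)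
        then show ?thesis by (subst xeq) (simp add: linear_formsD[OF \<gamma>] x' u)
      qed
      ultimately show ?thesis using IH Fu by simp
    qed
  qed
  then show ?thesis by (simp add: F_def)
qed

lemma cut_seaweed_transpose:
  fixes x :: "'k::field mat"
  assumes "x \<in> cut_seaweed n P Q"
  shows "transpose_mat x \<in> cut_seaweed n Q P"
proof (rule cut_seaweedI)
  note xD = cut_seaweedD[OF assms]
  show "transpose_mat x \<in> carrier_mat (2 * n) (2 * n)" using xD(1) by simp
  fix i j assume ij: "i < 2 * n" "j < 2 * n"
  then show "transpose_mat x $$ (mir n j, mir n i) = - (half_sign n i * half_sign n j * transpose_mat x $$ (i, j))"
    using xD(1) xD(2)[of j i] by (auto simp: scalar_simps)
  assume "transpose_mat x $$ (i, j) \<noteq> 0"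
  then have "cut_order n P Q j i" using xD ij by auto
  then show "cut_order n Q P i j" by (auto simp: cut_order_def)
qed

text \<open>The map \<open>x \<mapsto> - x\<^sup>T\<close> is an isomorphism from one seaweed to the other.\<close>

lemma frobenius_cut_seaweed_swap:
  fixes P Q :: "nat set"
  assumes "frobenius (2 * n) (cut_seaweed n P Q :: 'k::field mat set)"
  shows "frobenius (2 * n) (cut_seaweed n Q P :: 'k::field mat set)"
proof -
  obtain \<gamma> :: "'k mat \<Rightarrow> 'k" where \<gamma>: "frobenius_form (2 * n) (cut_seaweed n P Q) \<gamma>"
    using assms by (auto simp: frobenius_cut_seaweed_iff)
  define \<phi> :: "'k mat \<Rightarrow> 'k mat" where "\<phi> x = (- 1) \<cdot>\<^sub>m transpose_mat x" for x
  have mem: "\<phi> x \<in> cut_seaweed n A B" if "x \<in> cut_seaweed n B A" for x A B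
    using cut_seaweed_transpose[OF that] cut_seaweed_lie_algebra[of n A B, where 'k='k]
    by (auto simp: mat_lie_algebra_def \<phi>_def)
  have inv: "\<phi> (\<phi> x) = x" for x by (auto simp: \<phi>_def intro!: eq_matI)
  have c: "x \<in> carrier_mat (2 * n) (2 * n)" if "x \<in> cut_seaweed n Q P" for x :: "'k mat"
    by (rule cut_seaweedD(1)[OF that])
  have "frobenius_form (2 * n) (cut_seaweed n Q P) (\<gamma> \<circ> \<phi>)"
  proof (rule frobenius_form_pullback[OF \<gamma> cut_seaweed_lie_algebra])
    show "\<phi> ` cut_seaweed n Q P = cut_seaweed n P Q"
      using mem inv by (auto intro!: image_eqI[of _ _ "\<phi> _"])
    fix x y :: "'k mat" and d :: 'k
    assume x: "x \<in> cut_seaweed n Q P"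
    show "\<phi> (d \<cdot>\<^sub>m x) = d \<cdot>\<^sub>m \<phi> x" using c[OF x] by (auto simp: \<phi>_def intro!: eq_matI)
    show "\<phi> x = 0\<^sub>m (2 * n) (2 * n) \<Longrightarrow> x = 0\<^sub>m (2 * n) (2 * n)"
      using inv[of x] by (auto simp: \<phi>_def intro!: eq_matI)
    assume y: "y \<in> cut_seaweed n Q P"
    show "\<phi> (x + y) = \<phi> x + \<phi> y" using c[OF x] c[OF y] by (auto simp: \<phi>_def intro!: eq_matI)
    show "\<phi> (lie_bracket x y) = lie_bracket (\<phi> x) (\<phi> y)"
    proof (rule eq_matI)
      have \<phi>c: "\<phi> x \<in> carrier_mat (2 * n) (2 * n)" "\<phi> y \<in> carrier_mat (2 * n) (2 * n)"
        using c[OF x] c[OF y] by (auto simp: \<phi>_def)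
      have b: "lie_bracket x y \<in> carrier_mat (2 * n) (2 * n)" using c[OF x] c[OF y] by (rule lie_bracket_carrier)
      have b': "lie_bracket (\<phi> x) (\<phi> y) \<in> carrier_mat (2 * n) (2 * n)" using \<phi>c by (rule lie_bracket_carrier)
      show "dim_row (\<phi> (lie_bracket x y)) = dim_row (lie_bracket (\<phi> x) (\<phi> y))"
        "dim_col (\<phi> (lie_bracket x y)) = dim_col (lie_bracket (\<phi> x) (\<phi> y))"
        using b b' by (auto simp: \<phi>_def)
      fix i j assume "i < dim_row (lie_bracket (\<phi> x) (\<phi> y))" "j < dim_col (lie_bracket (\<phi> x) (\<phi> y))"
      then have ij: "i < 2 * n" "j < 2 * n" using b' by auto
      have "\<phi> (lie_bracket x y) $$ (i, j) = - lie_bracket x y $$ (j, i)" using b ij by (auto simp: \<phi>_def)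
      also have "\<dots> = lie_bracket (\<phi> x) (\<phi> y) $$ (i, j)"
        unfolding lie_bracket_entry[OF c[OF x] c[OF y] ij(2,1)] lie_bracket_entry[OF \<phi>c ij]
        using ij c[OF x] c[OF y] by (auto simp: \<phi>_def scalar_simps intro!: sum.cong)
      finally show "\<phi> (lie_bracket x y) $$ (i, j) = lie_bracket (\<phi> x) (\<phi> y) $$ (i, j)" .
    qed
  qed
  then show ?thesis by (auto simp: frobenius_cut_seaweed_iff)
qed

section \<open>An abelian ideal of symmetric blocks\<close>

text \<open>The indices beyond all cuts in \<open>P\<close> but before the last cut in \<open>Q\<close>. If \<open>i\<close> and \<open>j\<close> are such indices,
then \<open>(mir n i, j)\<close> is an admissible position, so that the seaweed contains a full space of
symmetric matrices in its lower left corner.\<close>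

definition extremal_indices :: "nat \<Rightarrow> nat set \<Rightarrow> nat set \<Rightarrow> nat set" where
  "extremal_indices n P Q = {i. i < n \<and> (\<forall>p\<in>P. p \<le> i) \<and> (\<exists>p\<in>Q. i < p)}"

text \<open>The symmetric matrix \<open>v w\<^sup>T + w v\<^sup>T\<close> in the lower left corner, its rows being listed in reverse
order. It is nonzero only in that corner if \<open>v\<close> and \<open>w\<close> are supported on indices below \<open>n\<close>.\<close>

definition sym_block :: "nat \<Rightarrow> (nat \<Rightarrow> 'k::field) \<Rightarrow> (nat \<Rightarrow> 'k) \<Rightarrow> 'k mat" where
  "sym_block n v w = mat (2 * n) (2 * n) (\<lambda>(i, j). v (mir n i) * w j + w (mir n i) * v j)"

lemma sym_block_dim [simp]: "dim_row (sym_block n v w) = 2 * n" "dim_col (sym_block n v w) = 2 * n"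
  by (simp_all add: sym_block_def)

lemma sym_block_carrier [simp]: "sym_block n v w \<in> carrier_mat (2 * n) (2 * n)"
  by (simp add: sym_block_def)

lemma sym_block_entry [simp]:
  "i < 2 * n \<Longrightarrow> j < 2 * n \<Longrightarrow> sym_block n v w $$ (i, j) = v (mir n i) * w j + w (mir n i) * v j"
  by (simp add: sym_block_def)

lemma sym_block_mem:
  fixes v w :: "nat \<Rightarrow> 'k::field"
  assumes v: "\<And>i. i \<notin> extremal_indices n P Q \<Longrightarrow> v i = 0"
    and w: "\<And>i. i \<notin> extremal_indices n P Q \<Longrightarrow> w i = 0"
    and PQ: "P \<subseteq> {..n}" "Q \<subseteq> {..n}"
  shows "sym_block n v w \<in> cut_seaweed n P Q"
proof (rule cut_seaweedI)
  fix i j assume ij: "i < 2 * n" "j < 2 * n"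
  have supp: "u k = 0" if "n \<le> k" "u = v \<or> u = w" for u k
    using that v[of k] w[of k] by (auto simp: extremal_indices_def)
  show "sym_block n v w $$ (mir n j, mir n i) = - (half_sign n i * half_sign n j * sym_block n v w $$ (i, j))"
  proof (cases "n \<le> i \<and> j < n")
    case True
    then show ?thesis using ij by (auto simp: half_sign_def scalar_simps)
  next
    case False
    then consider "n \<le> mir n i" | "n \<le> j" using ij mir_less_half_iff[of i n] by linarith
    then have "v (mir n i) * w j + w (mir n i) * v j = 0" by cases (simp_all add: supp)
    then have "v j * w (mir n i) + w j * v (mir n i) = 0" by (simp add: scalar_simps)
    with \<open>v (mir n i) * w j + w (mir n i) * v j = 0\<close> show ?thesis using ij by simp
  qed
  assume "sym_block n v w $$ (i, j) \<noteq> 0"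
  then have nz: "v (mir n i) * w j + w (mir n i) * v j \<noteq> 0" using ij by simp
  have "mir n i \<in> extremal_indices n P Q" "j \<in> extremal_indices n P Q"
    by (rule ccontr, use nz in \<open>simp add: v w\<close>)+
  then have "i \<ge> n" "j < n" and P: "\<forall>p\<in>P. p \<le> mir n i" "\<forall>p\<in>P. p \<le> j"
    using ij mir_less_half_iff[of i n] by (auto simp: extremal_indices_def)
  moreover have "\<not> 2 * n - p \<le> i" if "p \<in> P" for p
  proof -
    have "p \<le> mir n i" "p \<le> n" using P(1) PQ that by auto
    then show ?thesis using ij by (simp add: mir_def)
  qed
  ultimately show "cut_order n P Q i j" using PQ by (auto simp: cut_order_def)
qed simp

text \<open>An element \<open>y\<close> acts on the symmetric blocks through \<open>v \<mapsto> y\<^sup>T v\<close>. This keeps the support within the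
extremal indices: if the row of an admissible position is extremal, its column lies beyond all
cuts in \<open>P\<close> and before the last cut in \<open>Q\<close> because the row does. Here \<open>u = 2 y\<^sup>T v\<close>.\<close>

lemma bracket_sym_block:
  fixes y :: "'k::field mat"
  assumes v: "\<And>i. i \<notin> extremal_indices n P Q \<Longrightarrow> v i = 0"
    and y: "y \<in> cut_seaweed n P Q" and PQ: "P \<subseteq> {..n}" "Q \<subseteq> {..n}"
  obtains u where "\<And>i. i \<notin> extremal_indices n P Q \<Longrightarrow> u i = 0"
    "lie_bracket (sym_block n v v) y = sym_block n v u"
proof -
  define u where "u l = (if l < 2 * n then 2 * (\<Sum>k<2 * n. v k * y $$ (k, l)) else 0)" for l
  note yD = cut_seaweedD[OF y]
  have u: "u l = 0" if out: "l \<notin> extremal_indices n P Q" for l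
  proof (cases "l < 2 * n")
    case l: True
    have "v k * y $$ (k, l) = 0" if k: "k < 2 * n" for k
    proof (rule ccontr)
      assume "v k * y $$ (k, l) \<noteq> 0"
      then have "k \<in> extremal_indices n P Q" "cut_order n P Q k l"
        using v[of k] yD(3)[of k l] k l by auto
      moreover from this obtain p where p: "p \<in> Q" "k < p" by (auto simp: extremal_indices_def)
      moreover have "p \<le> n" using p PQ by auto
      moreover have "l < p" using p \<open>cut_order n P Q k l\<close> by (auto simp: cut_order_def not_le[symmetric])
      ultimately have "l \<in> extremal_indices n P Q"
        by (auto simp: extremal_indices_def cut_order_def)
      then show False using out by simp
    qed
    then have "(\<Sum>k<2 * n. v k * y $$ (k, l)) = 0" by (intro sum.neutral) auto
    then show ?thesis by (simp add: u_def)
  qed (simp add: u_def)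
  have "lie_bracket (sym_block n v v) y = sym_block n v u"
  proof (rule eq_matI)
    have carr: "lie_bracket (sym_block n v v) y \<in> carrier_mat (2 * n) (2 * n)"
      using yD(1) by (intro lie_bracket_carrier) simp_all
    then show "dim_row (lie_bracket (sym_block n v v) y) = dim_row (sym_block n v u)"
      "dim_col (lie_bracket (sym_block n v v) y) = dim_col (sym_block n v u)" by auto
    fix i l assume "i < dim_row (sym_block n v u)" "l < dim_col (sym_block n v u)"
    then have il: "i < 2 * n" "l < 2 * n" by auto
    have sq: "sym_block n v v $$ (a, b) = 2 * (v (mir n a) * v b)" if "a < 2 * n" "b < 2 * n" for a b
      unfolding sym_block_entry[OF that] by (simp only: mult_2)
    have Dy: "(\<Sum>k<2 * n. sym_block n v v $$ (i, k) * y $$ (k, l)) = v (mir n i) * u l"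
    proof -
      have "(\<Sum>k<2 * n. sym_block n v v $$ (i, k) * y $$ (k, l)) = (\<Sum>k<2 * n. v (mir n i) * (2 * (v k * y $$ (k, l))))"
        using il by (intro sum.cong refl) (simp add: sq scalar_simps del: sym_block_entry)
      then show ?thesis using il by (simp add: u_def sum_distrib_left)
    qed
    have "(\<Sum>k<2 * n. y $$ (i, k) * sym_block n v v $$ (k, l))
        = (\<Sum>k<2 * n. y $$ (mir n (mir n i), mir n k) * sym_block n v v $$ (mir n k, l))"
    proof -
      have "(\<Sum>k<2 * n. y $$ (i, k) * sym_block n v v $$ (k, l))
          = (\<Sum>k<2 * n. y $$ (i, mir n k) * sym_block n v v $$ (mir n k, l))"
        by (rule sum_mir[symmetric])
      then show ?thesis using il by (simp only: mir_mir)
    qed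
    also have "\<dots> = (\<Sum>k<2 * n. half_sign n i * (2 * (v k * y $$ (k, mir n i))) * v l)"
    proof (intro sum.cong refl)
      fix k assume "k \<in> {..<2 * n}"
      then have k: "k < 2 * n" by simp
      have hv: "half_sign n k * v k = v k"
        using v[of k] by (cases "k < n") (auto simp: half_sign_def extremal_indices_def)
      have "y $$ (mir n (mir n i), mir n k) * sym_block n v v $$ (mir n k, l)
          = half_sign n i * y $$ (k, mir n i) * (2 * (half_sign n k * v k) * v l)"
        using k il yD(2)[of k "mir n i"] by (simp add: sq scalar_simps del: sym_block_entry)
      then show "y $$ (mir n (mir n i), mir n k) * sym_block n v v $$ (mir n k, l)
          = half_sign n i * (2 * (v k * y $$ (k, mir n i))) * v l"
        unfolding hv by (simp add: scalar_simps)
    qed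
    also have "\<dots> = half_sign n i * u (mir n i) * v l"
      using il by (simp add: u_def sum_distrib_left sum_distrib_right)
    also have "\<dots> = - (u (mir n i) * v l)"
      using u[of "mir n i"] il mir_less_half_iff[of i n]
      by (cases "i < n") (auto simp: half_sign_def extremal_indices_def)
    finally show "lie_bracket (sym_block n v v) y $$ (i, l) = sym_block n v u $$ (i, l)"
      unfolding lie_bracket_entry[OF sym_block_carrier yD(1) il] Dy sym_block_entry[OF il] by simp
  qed
  then show thesis using u that by blast
qed

text \<open>For a Frobenius form the symmetric bilinear form \<open>(v, w) \<mapsto> \<gamma> (sym_block n v w)\<close> is
nondegenerate: if \<open>v\<close> is in its kernel, then \<open>\<gamma>\<close> vanishes on all brackets of \<open>sym_block n v v\<close>, which
are again blocks of the shape \<open>sym_block n v u\<close>, so this matrix stabilises \<open>\<gamma>\<close> and must be zero.\<close>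

lemma sym_block_nondegenerate:
  fixes v :: "nat \<Rightarrow> 'k::field_char_0" and \<gamma> :: "'k mat \<Rightarrow> 'k"
  assumes \<gamma>: "frobenius_form (2 * n) (cut_seaweed n P Q) \<gamma>" and PQ: "P \<subseteq> {..n}" "Q \<subseteq> {..n}"
    and v: "\<And>i. i \<notin> extremal_indices n P Q \<Longrightarrow> v i = 0"
    and orth: "\<And>w. (\<And>i. i \<notin> extremal_indices n P Q \<Longrightarrow> w i = 0) \<Longrightarrow> \<gamma> (sym_block n v w) = 0"
  shows "v i = 0"
proof -
  have "sym_block n v v = 0\<^sub>m (2 * n) (2 * n)"
  proof (rule frobenius_formD[OF \<gamma> sym_block_mem[OF v v PQ]])
    fix y :: "'k mat" assume y: "y \<in> cut_seaweed n P Q"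
    obtain u where u: "\<And>i. i \<notin> extremal_indices n P Q \<Longrightarrow> u i = 0"
      "lie_bracket (sym_block n v v) y = sym_block n v u"
      by (rule bracket_sym_block[of n P Q v y]) (use v y PQ in auto)
    then show "\<gamma> (lie_bracket (sym_block n v v) y) = 0" using orth[of u] by simp
  qed
  then have "sym_block n v v $$ (mir n i, i) = 0" if "i < n" using that by simp
  then show "v i = 0" using v[of i] by (cases "i < n") (auto simp: extremal_indices_def)
qed


section \<open>Adding a vertex to the meander graph\<close>

text \<open>The \<open>2 * n\<close> old positions become the positions of the larger matrix other than the two
  middle ones, \<open>n\<close> and \<open>Suc n\<close>.\<close>

context
  fixes n :: nat
begin

definition skip :: "nat \<Rightarrow> nat" where
  "skip i = (if i < n then i else i + 2)"

definition unskip :: "nat \<Rightarrow> nat" where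
  "unskip i = (if i < n then i else i - 2)"

lemma skip_less [simp]: "i < 2 * n \<Longrightarrow> skip i < 2 * Suc n"
  by (simp add: skip_def)

lemma skip_less_Suc [simp]: "i < 2 * n \<Longrightarrow> skip i < Suc (Suc (2 * n))"
  by (simp add: skip_def)

lemma skip_neq [simp]: "skip i \<noteq> n" "skip i \<noteq> Suc n" "n \<noteq> skip i" "Suc n \<noteq> skip i"
  by (auto simp: skip_def)

lemma unskip_skip [simp]: "unskip (skip i) = i"
  by (simp add: skip_def unskip_def)

lemma mir_skip [simp]: "i < 2 * n \<Longrightarrow> mir (Suc n) (skip i) = skip (mir n i)"
  by (auto simp: mir_def skip_def)

lemma mir_mid [simp]: "mir (Suc n) n = Suc n" "mir (Suc n) (Suc n) = n"
  by (auto simp: mir_def)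

lemma half_sign_skip [simp]: "half_sign (Suc n) (skip i) = half_sign n i"
  by (auto simp: half_sign_def skip_def)

lemma half_sign_mid [simp]: "half_sign (Suc n) n = 1" "half_sign (Suc n) (Suc n) = - 1"
  by (auto simp: half_sign_def)

lemma index_cases:
  assumes "i < 2 * Suc n"
  obtains i' where "i' < 2 * n" "i = skip i'" | "i = n" | "i = Suc n"
proof -
  consider "i < n" | "i = n" | "i = Suc n" | "i > Suc n" by linarith
  then show thesis
  proof cases
    case 1 then show thesis using that(1)[of i] by (simp add: skip_def)
  next
    case 4
    then have "skip (i - 2) = i" by (auto simp: skip_def)
    then show thesis using that(1)[of "i - 2"] assms 4 by simp
  qed (use that in auto)
qed

lemma sum_skip: "(\<Sum>k<2 * Suc n. f k) = (\<Sum>k<2 * n. f (skip k)) + f n + (f (Suc n) :: 'a::comm_monoid_add)"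
proof -
  have "bij_betw skip {..<2 * n} ({..<2 * Suc n} - {n, Suc n})"
    by (rule bij_betwI[of _ _ _ unskip]) (auto simp: skip_def unskip_def split: if_splits)
  then have "(\<Sum>k<2 * n. f (skip k)) = sum f ({..<2 * Suc n} - {n, Suc n})"
    by (rule sum.reindex_bij_betw)
  moreover have "sum f {..<2 * Suc n} = sum f ({..<2 * Suc n} - {n, Suc n}) + sum f {n, Suc n}"
    by (rule sum.subset_diff) auto
  ultimately show ?thesis by (simp add: add.assoc)
qed

lemma skip_eq_iff [simp]: "skip i = skip j \<longleftrightarrow> i = j"
  by (auto simp: skip_def split: if_splits)

definition restrict_mat :: "'k::field mat \<Rightarrow> 'k mat" where
  "restrict_mat x = mat (2 * n) (2 * n) (\<lambda>(i, j). x $$ (skip i, skip j))"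

definition row_part :: "'k::field mat \<Rightarrow> nat \<Rightarrow> nat \<Rightarrow> 'k" where
  "row_part x r j = (if j < 2 * n then x $$ (r, skip j) else 0)"

text \<open>An element of the larger seaweed is determined by its old part \<open>y\<close>, the old columns \<open>v\<close> and \<open>w\<close> of
its two middle rows, the torus entry \<open>t\<close> and the corner entry \<open>c\<close>; the remaining entries are
mirror images.\<close>

definition glue :: "'k::field mat \<Rightarrow> (nat \<Rightarrow> 'k) \<Rightarrow> (nat \<Rightarrow> 'k) \<Rightarrow> 'k \<Rightarrow> 'k \<Rightarrow> 'k mat" where
  "glue y v w t c = mat (2 * Suc n) (2 * Suc n) (\<lambda>(i, j).
     if i = n then (if j = n then t else if j = Suc n then 0 else v (unskip j))
     else if i = Suc n then (if j = n then c else if j = Suc n then - t else w (unskip j))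
     else if j = n then w (mir n (unskip i))
     else if j = Suc n then - v (mir n (unskip i))
     else y $$ (unskip i, unskip j))"

lemma restrict_mat_carrier [simp]: "restrict_mat x \<in> carrier_mat (2 * n) (2 * n)"
  by (simp add: restrict_mat_def)

lemma restrict_mat_entry [simp]:
  "i < 2 * n \<Longrightarrow> j < 2 * n \<Longrightarrow> restrict_mat x $$ (i, j) = x $$ (skip i, skip j)"
  by (simp add: restrict_mat_def)

context
  fixes P Q :: "nat set"
  assumes PQ: "P \<subseteq> {..n}" "Q \<subseteq> {..n}" and nQ: "n \<in> Q"
begin

lemma cut_order_skip:
  assumes "i < 2 * n" "j < 2 * n"
  shows "cut_order (Suc n) P (insert (Suc n) Q) (skip i) (skip j) \<longleftrightarrow> cut_order n P Q i j"
proof -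
  have *: "p \<le> skip k \<longleftrightarrow> p \<le> k" "2 * Suc n - p \<le> skip k \<longleftrightarrow> 2 * n - p \<le> k" if "p \<le> n" for p k
    using that by (auto simp: skip_def)
  have m: "Suc n \<le> skip k \<longleftrightarrow> n \<le> k" "2 * Suc n - Suc n \<le> skip k \<longleftrightarrow> n \<le> k" for k
    by (auto simp: skip_def)
  have P: "(\<forall>p\<in>P. (p \<le> skip i \<longrightarrow> p \<le> skip j) \<and> (2 * Suc n - p \<le> skip i \<longrightarrow> 2 * Suc n - p \<le> skip j))
      \<longleftrightarrow> (\<forall>p\<in>P. (p \<le> i \<longrightarrow> p \<le> j) \<and> (2 * n - p \<le> i \<longrightarrow> 2 * n - p \<le> j))"
    using PQ(1) * by (intro ball_cong refl) auto
  have Q: "(\<forall>p\<in>Q. (p \<le> skip j \<longrightarrow> p \<le> skip i) \<and> (2 * Suc n - p \<le> skip j \<longrightarrow> 2 * Suc n - p \<le> skip i))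
      \<longleftrightarrow> (\<forall>p\<in>Q. (p \<le> j \<longrightarrow> p \<le> i) \<and> (2 * n - p \<le> j \<longrightarrow> 2 * n - p \<le> i))"
    using PQ(2) * by (intro ball_cong refl) auto
  show ?thesis unfolding cut_order_def ball_simps(7) P Q m using nQ by auto
qed

text \<open>Outside the two middle columns, a middle row of the larger seaweed has entries exactly over the
extremal indices of the smaller one; such rows can therefore be inserted into \<open>sym_block\<close>.\<close>

lemma cut_order_mid_row:
  assumes "j < 2 * n" "r = n \<or> r = Suc n"
  shows "cut_order (Suc n) P (insert (Suc n) Q) r (skip j) \<longleftrightarrow> j \<in> extremal_indices n P Q"
proof
  assume o: "cut_order (Suc n) P (insert (Suc n) Q) r (skip j)"
  have "n \<le> skip j \<longrightarrow> n \<le> r" "2 * Suc n - n \<le> skip j \<longrightarrow> 2 * Suc n - n \<le> r"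
    "\<forall>p\<in>P. p \<le> r \<longrightarrow> p \<le> skip j"
    using o nQ by (auto simp: cut_order_def)
  moreover have "p \<le> r" if "p \<in> P" for p using that PQ assms(2) by fastforce
  ultimately show "j \<in> extremal_indices n P Q"
    using assms nQ by (auto simp: extremal_indices_def skip_def split: if_splits)
next
  assume "j \<in> extremal_indices n P Q"
  then have "j < n" "\<forall>p\<in>P. p \<le> j" by (auto simp: extremal_indices_def)
  moreover have "\<not> 2 * Suc n - p \<le> r" if "p \<in> P" for p using that PQ assms(2) by fastforce
  ultimately show "cut_order (Suc n) P (insert (Suc n) Q) r (skip j)"
    using PQ assms(2) by (fastforce simp: cut_order_def skip_def)
qed

lemma restrict_mat_mem:
  assumes "x \<in> cut_seaweed (Suc n) P (insert (Suc n) Q)"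
  shows "restrict_mat x \<in> cut_seaweed n P Q"
proof (rule cut_seaweedI)
  fix i j assume ij: "i < 2 * n" "j < 2 * n"
  show "restrict_mat x $$ (mir n j, mir n i) = - (half_sign n i * half_sign n j * restrict_mat x $$ (i, j))"
    using ij cut_seaweedD(2)[OF assms, of "skip i" "skip j"] by simp
  show "restrict_mat x $$ (i, j) \<noteq> 0 \<Longrightarrow> cut_order n P Q i j"
    using ij cut_seaweedD(3)[OF assms, of "skip i" "skip j"] cut_order_skip[OF ij] by auto
qed simp

lemma row_part_support:
  assumes "x \<in> cut_seaweed (Suc n) P (insert (Suc n) Q)" "r = n \<or> r = Suc n" "i \<notin> extremal_indices n P Q"
  shows "row_part x r i = 0"
  using assms cut_order_mid_row[of i r] cut_seaweedD(3)[OF assms(1), of r "skip i"]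
  by (auto simp: row_part_def)

lemma column_parts:
  assumes x: "x \<in> cut_seaweed (Suc n) P (insert (Suc n) Q)" and i: "i < 2 * n"
  shows "x $$ (skip i, n) = row_part x (Suc n) (mir n i)" "x $$ (skip i, Suc n) = - row_part x n (mir n i)"
proof -
  have h: "half_sign n i * row_part x r (mir n i) = - row_part x r (mir n i)" if "r = n \<or> r = Suc n" for r
    using row_part_support[OF x that, of "mir n i"] i mir_less_half_iff[of i n]
    by (cases "i < n") (auto simp: half_sign_def extremal_indices_def)
  have s: "skip i = mir (Suc n) (skip (mir n i))" using i by simp
  have "x $$ (skip i, n) = x $$ (mir (Suc n) (skip (mir n i)), mir (Suc n) (Suc n))"
    using i by simp
  also have "\<dots> = - (half_sign n i * row_part x (Suc n) (mir n i))"
    using i by (subst cut_seaweedD(2)[OF x]) (auto simp: row_part_def)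
  finally show "x $$ (skip i, n) = row_part x (Suc n) (mir n i)" using h[of "Suc n"] by simp
  have "x $$ (skip i, Suc n) = x $$ (mir (Suc n) (skip (mir n i)), mir (Suc n) n)"
    using i by simp
  also have "\<dots> = half_sign n i * row_part x n (mir n i)"
    using i by (subst cut_seaweedD(2)[OF x]) (auto simp: row_part_def)
  finally show "x $$ (skip i, Suc n) = - row_part x n (mir n i)" using h[of n] by simp
qed

lemma mid_entries:
  assumes x: "x \<in> cut_seaweed (Suc n) P (insert (Suc n) Q)"
  shows "x $$ (n, Suc n) = 0" "x $$ (Suc n, Suc n) = - x $$ (n, n)"
proof -
  have "\<not> cut_order (Suc n) P (insert (Suc n) Q) n (Suc n)"
    by (auto simp: cut_order_def)
  then show "x $$ (n, Suc n) = 0" using cut_seaweedD(3)[OF x, of n "Suc n"] by simp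
  show "x $$ (Suc n, Suc n) = - x $$ (n, n)"
    using cut_seaweedD(2)[OF x, of n n] by simp
qed

lemma glue_mem:
  assumes y: "y \<in> cut_seaweed n P Q"
    and v: "\<And>i. i \<notin> extremal_indices n P Q \<Longrightarrow> v i = 0"
    and w: "\<And>i. i \<notin> extremal_indices n P Q \<Longrightarrow> w i = 0"
  shows "glue y v w t c \<in> cut_seaweed (Suc n) P (insert (Suc n) Q)"
proof (rule cut_seaweedI)
  show "glue y v w t c \<in> carrier_mat (2 * Suc n) (2 * Suc n)" by (simp add: glue_def)
  have PQ': "P \<subseteq> {..Suc n}" "insert (Suc n) Q \<subseteq> {..Suc n}" using PQ by auto
  have supp: "u k = 0" if "n \<le> k" "u = v \<or> u = w" for u k
    using that v[of k] w[of k] by (auto simp: extremal_indices_def)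
  have hs: "half_sign n k * u k = u k" "half_sign n k * u (mir n k) = - u (mir n k)"
    if "u = v \<or> u = w" "k < 2 * n" for u k
    using that supp[of k u] supp[of "mir n k" u] mir_less_half_iff[of k n]
    by (cases "k < n"; force simp: half_sign_def)+
  fix i j assume ij: "i < 2 * Suc n" "j < 2 * Suc n"
  from ij show "glue y v w t c $$ (mir (Suc n) j, mir (Suc n) i)
      = - (half_sign (Suc n) i * half_sign (Suc n) j * glue y v w t c $$ (i, j))"
    by (elim index_cases)
      (simp_all add: glue_def cut_seaweedD(2)[OF y] hs)
  have ord: "cut_order (Suc n) P (insert (Suc n) Q) (skip k) r"
    if "k < 2 * n" "mir n k \<in> extremal_indices n P Q" "r = n \<or> r = Suc n" for k r
  proof -
    have "cut_order (Suc n) P (insert (Suc n) Q) (mir (Suc n) r) (skip (mir n k))"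
      using that by (subst cut_order_mid_row) auto
    then have "cut_order (Suc n) P (insert (Suc n) Q) (mir (Suc n) (skip (mir n k))) (mir (Suc n) (mir (Suc n) r))"
      using that by (intro cut_order_mir PQ') auto
    then show ?thesis using that by auto
  qed
  have mid: "cut_order (Suc n) P (insert (Suc n) Q) (Suc n) n"
    using PQ by (fastforce simp: cut_order_def)
  from ij show "glue y v w t c $$ (i, j) \<noteq> 0 \<Longrightarrow> cut_order (Suc n) P (insert (Suc n) Q) i j"
    by (elim index_cases)
      (use v w cut_seaweedD(3)[OF y] in \<open>auto simp: glue_def cut_order_skip cut_order_mid_row mid intro: ord\<close>)
qed

lemma glue_parts:
  assumes y: "y \<in> cut_seaweed n P Q"
    and v: "\<And>i. i \<notin> extremal_indices n P Q \<Longrightarrow> v i = 0"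
    and w: "\<And>i. i \<notin> extremal_indices n P Q \<Longrightarrow> w i = 0"
  shows "restrict_mat (glue y v w t c) = y" "row_part (glue y v w t c) n = v"
    "row_part (glue y v w t c) (Suc n) = w" "glue y v w t c $$ (n, n) = t" "glue y v w t c $$ (Suc n, n) = c"
proof -
  show "restrict_mat (glue y v w t c) = y"
    using cut_seaweedD(1)[OF y] by (intro eq_matI) (auto simp: restrict_mat_def glue_def)
  have "v i = 0" "w i = 0" if "\<not> i < 2 * n" for i using that v[of i] w[of i] by (auto simp: extremal_indices_def)
  then show "row_part (glue y v w t c) n = v" "row_part (glue y v w t c) (Suc n) = w"
    by (auto simp: row_part_def glue_def fun_eq_iff)
qed (simp_all add: glue_def)

text \<open>The middle rows and columns enter the old part of a product only through the intermediate indices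
\<open>n\<close> and \<open>Suc n\<close>. As the columns are mirror images of the rows, what they contribute to the
commutator is a difference of symmetric blocks, each pairing a row of \<open>x\<close> with the other row of \<open>y\<close>.\<close>

lemma restrict_bracket:
  fixes x y :: "'k::field mat"
  assumes x: "x \<in> cut_seaweed (Suc n) P (insert (Suc n) Q)" and y: "y \<in> cut_seaweed (Suc n) P (insert (Suc n) Q)"
  shows "restrict_mat (lie_bracket x y) = lie_bracket (restrict_mat x) (restrict_mat y)
     + (sym_block n (row_part x (Suc n)) (row_part y n) + (- 1) \<cdot>\<^sub>m sym_block n (row_part x n) (row_part y (Suc n)))"
proof (rule eq_matI)
  let ?r = "lie_bracket (restrict_mat x) (restrict_mat y)
     + (sym_block n (row_part x (Suc n)) (row_part y n) + (- 1) \<cdot>\<^sub>m sym_block n (row_part x n) (row_part y (Suc n)))"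
  have b: "lie_bracket (restrict_mat x) (restrict_mat y) \<in> carrier_mat (2 * n) (2 * n)"
    by (intro lie_bracket_carrier) simp_all
  show "dim_row (restrict_mat (lie_bracket x y)) = dim_row ?r" "dim_col (restrict_mat (lie_bracket x y)) = dim_col ?r"
    using b by (simp_all add: restrict_mat_def)
  fix i j assume "i < dim_row ?r" "j < dim_col ?r"
  then have ij: "i < 2 * n" "j < 2 * n" by auto
  have row: "z $$ (n, skip j) = row_part z n j" "z $$ (Suc n, skip j) = row_part z (Suc n) j" for z :: "'k mat"
    using ij by (simp_all add: row_part_def)
  show "restrict_mat (lie_bracket x y) $$ (i, j) = ?r $$ (i, j)"
  proof -
    have "restrict_mat (lie_bracket x y) $$ (i, j)
        = (\<Sum>k<2 * Suc n. x $$ (skip i, k) * y $$ (k, skip j)) - (\<Sum>k<2 * Suc n. y $$ (skip i, k) * x $$ (k, skip j))"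
      unfolding restrict_mat_entry[OF ij]
      by (rule lie_bracket_entry[OF cut_seaweedD(1)[OF x] cut_seaweedD(1)[OF y]]) (use ij in simp_all)
    also have "\<dots> = (\<Sum>k<2 * n. x $$ (skip i, skip k) * y $$ (skip k, skip j)) -
        (\<Sum>k<2 * n. y $$ (skip i, skip k) * x $$ (skip k, skip j))
      + (sym_block n (row_part x (Suc n)) (row_part y n) $$ (i, j) - sym_block n (row_part x n) (row_part y (Suc n)) $$ (i, j))"
      unfolding sum_skip row column_parts[OF x ij(1)] column_parts[OF y ij(1)] sym_block_entry[OF ij]
      by (simp add: scalar_simps)
    also have "\<dots> = ?r $$ (i, j)"
      using ij b by (simp add: lie_bracket_entry[where N = "2 * n"])
    finally show ?thesis .
  qed
qed

lemma corner_bracket: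
  fixes x y :: "'k::field mat"
  assumes x: "x \<in> cut_seaweed (Suc n) P (insert (Suc n) Q)" and y: "y \<in> cut_seaweed (Suc n) P (insert (Suc n) Q)"
  shows "lie_bracket x y $$ (Suc n, n) = 2 * (x $$ (Suc n, n) * y $$ (n, n) - x $$ (n, n) * y $$ (Suc n, n))"
proof -
  have zero: "(\<Sum>k<2 * n. a $$ (Suc n, skip k) * b $$ (skip k, n)) = 0"
    if a: "a \<in> cut_seaweed (Suc n) P (insert (Suc n) Q)" and b: "b \<in> cut_seaweed (Suc n) P (insert (Suc n) Q)"
    for a b :: "'k mat"
  proof (intro sum.neutral ballI)
    fix k assume "k \<in> {..<2 * n}"
    then have k: "k < 2 * n" by simp
    have "row_part a (Suc n) k = 0 \<or> row_part b (Suc n) (mir n k) = 0"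
      using row_part_support[OF a, of "Suc n" k] row_part_support[OF b, of "Suc n" "mir n k"]
        mir_less_half_iff[OF k] by (auto simp: extremal_indices_def)
    then show "a $$ (Suc n, skip k) * b $$ (skip k, n) = 0"
      using k column_parts(1)[OF b k] by (auto simp: row_part_def)
  qed
  have "lie_bracket x y $$ (Suc n, n) = (\<Sum>k<2 * Suc n. x $$ (Suc n, k) * y $$ (k, n))
      - (\<Sum>k<2 * Suc n. y $$ (Suc n, k) * x $$ (k, n))"
    by (rule lie_bracket_entry[OF cut_seaweedD(1)[OF x] cut_seaweedD(1)[OF y]]) simp_all
  also have "\<dots> = 2 * (x $$ (Suc n, n) * y $$ (n, n) - x $$ (n, n) * y $$ (Suc n, n))"
    unfolding sum_skip zero[OF x y] zero[OF y x] mid_entries[OF x] mid_entries[OF y]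
    by (simp add: scalar_simps flip: mult_2)
  finally show ?thesis .
qed

text \<open>If \<open>\<gamma>\<close> is a Frobenius form, then so is the form that adds the corner entry to \<open>\<gamma>\<close> of the old part.
By the two preceding lemmas its commutator form splits into three orthogonal pieces: the one
of \<open>\<gamma>\<close>, the pairing of the two middle rows through \<open>sym_block\<close>, and the pairing of the torus
entry with the corner entry. All three are nondegenerate, the second one by
\<open>sym_block_nondegenerate\<close>.\<close>

lemma frobenius_add_vertex:
  assumes "frobenius (2 * n) (cut_seaweed n P Q :: 'k::field_char_0 mat set)"
  shows "frobenius (2 * Suc n) (cut_seaweed (Suc n) P (insert (Suc n) Q) :: 'k mat set)"
proof -
  let ?q = "cut_seaweed n P Q :: 'k mat set"
  let ?q' = "cut_seaweed (Suc n) P (insert (Suc n) Q) :: 'k mat set"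
  let ?I = "extremal_indices n P Q"
  obtain \<gamma> :: "'k mat \<Rightarrow> 'k" where \<gamma>: "frobenius_form (2 * n) ?q \<gamma>"
    using assms by (auto simp: frobenius_cut_seaweed_iff)
  then have lf: "\<gamma> \<in> linear_forms ?q" by (simp add: frobenius_form_def)
  have lie: "mat_lie_algebra (2 * n) ?q" and lie': "mat_lie_algebra (2 * Suc n) ?q'"
    by (rule cut_seaweed_lie_algebra)+
  have \<gamma>0: "\<gamma> (0\<^sub>m (2 * n) (2 * n)) = 0" by (rule linear_form_zero[OF lf lie])
  define \<gamma>' where "\<gamma>' x = \<gamma> (restrict_mat x) + x $$ (Suc n, n)" for x
  have lf': "\<gamma>' \<in> linear_forms ?q'"
    unfolding linear_forms_def
  proof (intro CollectI conjI ballI allI)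
    fix x y :: "'k mat" and c :: 'k assume x: "x \<in> ?q'"
    note xc = cut_seaweedD(1)[OF x]
    have "restrict_mat (c \<cdot>\<^sub>m x) = c \<cdot>\<^sub>m restrict_mat x"
      using xc by (intro eq_matI) (auto simp: restrict_mat_def)
    then show "\<gamma>' (c \<cdot>\<^sub>m x) = c * \<gamma>' x"
      using xc linear_formsD(2)[OF lf restrict_mat_mem[OF x]] by (simp add: \<gamma>'_def scalar_simps)
    assume y: "y \<in> ?q'"
    note yc = cut_seaweedD(1)[OF y]
    have "restrict_mat (x + y) = restrict_mat x + restrict_mat y"
      using xc yc by (intro eq_matI) (auto simp: restrict_mat_def)
    then show "\<gamma>' (x + y) = \<gamma>' x + \<gamma>' y"
      using xc yc linear_formsD(1)[OF lf restrict_mat_mem[OF x] restrict_mat_mem[OF y]]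
      by (simp add: \<gamma>'_def scalar_simps)
  qed
  have "frobenius_form (2 * Suc n) ?q' \<gamma>'"
  proof (rule frobenius_formI[OF lie' lf'])
    fix x assume x: "x \<in> ?q'" and st: "\<And>y. y \<in> ?q' \<Longrightarrow> \<gamma>' (lie_bracket x y) = 0"
    note supp = row_part_support[OF x]
    have rx: "restrict_mat x \<in> ?q" by (rule restrict_mat_mem[OF x])
    \<comment> \<open>The three pieces of the commutator form; each is then tested separately.\<close>
    have key: "\<gamma> (lie_bracket (restrict_mat x) y) + (\<gamma> (sym_block n (row_part x (Suc n)) v)
        - \<gamma> (sym_block n (row_part x n) w)) + 2 * (x $$ (Suc n, n) * t - x $$ (n, n) * c) = 0"
      if y: "y \<in> ?q" and v: "\<And>i. i \<notin> ?I \<Longrightarrow> v i = 0" and w: "\<And>i. i \<notin> ?I \<Longrightarrow> w i = 0" for y v w t c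
    proof -
      define g where "g = glue y v w t c"
      have gm: "g \<in> ?q'" unfolding g_def by (rule glue_mem; use y v w in blast)
      have gp: "restrict_mat g = y" "row_part g n = v" "row_part g (Suc n) = w" "g $$ (n, n) = t" "g $$ (Suc n, n) = c"
        unfolding g_def by (rule glue_parts; use y v w in blast)+
      have m: "sym_block n (row_part x (Suc n)) v \<in> ?q" "sym_block n (row_part x n) w \<in> ?q"
        by (rule sym_block_mem[OF _ _ PQ]; use supp v w in blast)+
      have m': "(- 1) \<cdot>\<^sub>m sym_block n (row_part x n) w \<in> ?q" "lie_bracket (restrict_mat x) y \<in> ?q"
        using m(2) rx y lie unfolding mat_lie_algebra_def by blast+
      then have m'': "sym_block n (row_part x (Suc n)) v + (- 1) \<cdot>\<^sub>m sym_block n (row_part x n) w \<in> ?q"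
        using m lie unfolding mat_lie_algebra_def by blast
      have "\<gamma> (restrict_mat (lie_bracket x g)) = \<gamma> (lie_bracket (restrict_mat x) y)
          + (\<gamma> (sym_block n (row_part x (Suc n)) v) - \<gamma> (sym_block n (row_part x n) w))"
        using restrict_bracket[OF x gm] linear_formsD(1)[OF lf m'(2) m''] linear_formsD(1)[OF lf m(1) m'(1)]
          linear_formsD(2)[OF lf m(2), of "- 1"]
        unfolding gp by simp
      moreover have "lie_bracket x g $$ (Suc n, n) = 2 * (x $$ (Suc n, n) * t - x $$ (n, n) * c)"
        unfolding corner_bracket[OF x gm] gp ..
      ultimately show ?thesis using st[OF gm] by (simp add: \<gamma>'_def)
    qed
    have z: "0\<^sub>m (2 * n) (2 * n) \<in> ?q" using lie by (simp add: mat_lie_algebra_def)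
    have br0: "lie_bracket (restrict_mat x) (0\<^sub>m (2 * n) (2 * n)) = 0\<^sub>m (2 * n) (2 * n)"
      by (simp add: lie_bracket_def right_mult_zero_mat[OF restrict_mat_carrier] left_mult_zero_mat[OF restrict_mat_carrier])
    have sb0: "sym_block n u (\<lambda>_. 0) = 0\<^sub>m (2 * n) (2 * n)" for u :: "nat \<Rightarrow> 'k"
      by (intro eq_matI) auto
    have c0: "x $$ (Suc n, n) = 0"
      using key[of "0\<^sub>m (2 * n) (2 * n)" "\<lambda>_. 0" "\<lambda>_. 0" 1 0] z by (simp add: br0 sb0 \<gamma>0)
    have t0: "x $$ (n, n) = 0"
      using key[of "0\<^sub>m (2 * n) (2 * n)" "\<lambda>_. 0" "\<lambda>_. 0" 0 1] z by (simp add: br0 sb0 \<gamma>0)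
    have r0: "restrict_mat x = 0\<^sub>m (2 * n) (2 * n)"
    proof (rule frobenius_formD[OF \<gamma> rx])
      show "\<gamma> (lie_bracket (restrict_mat x) y) = 0" if "y \<in> ?q" for y
        using key[of y "\<lambda>_. 0" "\<lambda>_. 0" 0 0] that by (simp add: sb0 \<gamma>0)
    qed
    have w0: "row_part x (Suc n) i = 0" for i
    proof (rule sym_block_nondegenerate[OF \<gamma> PQ])
      show "row_part x (Suc n) i = 0" if "i \<notin> ?I" for i using supp that by blast
      show "\<gamma> (sym_block n (row_part x (Suc n)) v) = 0" if "\<And>i. i \<notin> ?I \<Longrightarrow> v i = 0" for v
        using key[of "0\<^sub>m (2 * n) (2 * n)" v "\<lambda>_. 0" 0 0] z that by (simp add: br0 sb0 \<gamma>0)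
    qed
    have v0: "row_part x n i = 0" for i
    proof (rule sym_block_nondegenerate[OF \<gamma> PQ])
      show "row_part x n i = 0" if "i \<notin> ?I" for i using supp that by blast
      show "\<gamma> (sym_block n (row_part x n) w) = 0" if "\<And>i. i \<notin> ?I \<Longrightarrow> w i = 0" for w
        using key[of "0\<^sub>m (2 * n) (2 * n)" "\<lambda>_. 0" w 0 0] z that by (simp add: br0 sb0 \<gamma>0)
    qed
    show "x = 0\<^sub>m (2 * Suc n) (2 * Suc n)"
    proof (rule eq_matI)
      fix i j assume "i < dim_row (0\<^sub>m (2 * Suc n) (2 * Suc n) :: 'k mat)" "j < dim_col (0\<^sub>m (2 * Suc n) (2 * Suc n) :: 'k mat)"
      then have ij: "i < 2 * Suc n" "j < 2 * Suc n" by auto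
      have rows: "x $$ (r, skip j) = 0" if "j < 2 * n" "r = n \<or> r = Suc n" for r j
        using that v0[of j] w0[of j] by (auto simp: row_part_def)
      have res: "x $$ (skip i, skip j) = 0" if "i < 2 * n" "j < 2 * n" for i j
      proof -
        have "restrict_mat x $$ (i, j) = 0" using that unfolding r0 by simp
        then show ?thesis using that by simp
      qed
      from ij have "x $$ (i, j) = 0"
        by (elim index_cases) (simp_all add: rows res column_parts[OF x] v0 w0 c0 t0 mid_entries[OF x])
      then show "x $$ (i, j) = 0\<^sub>m (2 * Suc n) (2 * Suc n) $$ (i, j)" using ij by simp
    qed (use cut_seaweedD(1)[OF x] in auto)
  qed
  then show ?thesis unfolding frobenius_cut_seaweed_iff by blast
qed

end

end

section \<open>Seaweeds that are not Frobenius\<close>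

text \<open>With a cut at \<open>n\<close> on both sides every element is block diagonal, so the matrix
\<open>diag (1, \<dots>, 1, - 1, \<dots>, - 1)\<close> is central and stabilises every form.\<close>

lemma not_frobenius_if_both_full:
  assumes n: "n \<ge> 1" and nP: "n \<in> P" and nQ: "n \<in> Q"
  shows "\<not> frobenius (2 * n) (cut_seaweed n P Q :: 'k::field_char_0 mat set)"
proof
  let ?q = "cut_seaweed n P Q :: 'k mat set"
  assume "frobenius (2 * n) ?q"
  then obtain \<gamma> where \<gamma>: "frobenius_form (2 * n) ?q \<gamma>"
    unfolding frobenius_cut_seaweed_iff by blast
  then have lf: "\<gamma> \<in> linear_forms ?q" by (simp add: frobenius_form_def)
  define x :: "'k mat" where "x = mat (2 * n) (2 * n) (\<lambda>(i, j). if i = j then half_sign n i else 0)"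
  have xe: "x $$ (i, j) = (if i = j then half_sign n i else 0)" if "i < 2 * n" "j < 2 * n" for i j
    using that by (simp add: x_def)
  have xc: "x \<in> carrier_mat (2 * n) (2 * n)" by (simp add: x_def)
  have x: "x \<in> ?q"
  proof (rule cut_seaweedI[OF xc])
    fix i j assume ij: "i < 2 * n" "j < 2 * n"
    show "x $$ (mir n j, mir n i) = - (half_sign n i * half_sign n j * x $$ (i, j))"
      using ij by (cases "i = j") (auto simp: xe)
    show "x $$ (i, j) \<noteq> 0 \<Longrightarrow> cut_order n P Q i j"
      using ij by (cases "i = j") (auto simp: xe)
  qed
  have "lie_bracket x y = 0\<^sub>m (2 * n) (2 * n)" if y: "y \<in> ?q" for y
  proof (rule eq_matI)
    note yc = cut_seaweedD(1)[OF y]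
    have c: "lie_bracket x y \<in> carrier_mat (2 * n) (2 * n)" using xc yc by (rule lie_bracket_carrier)
    show "dim_row (lie_bracket x y) = dim_row (0\<^sub>m (2 * n) (2 * n) :: 'k mat)"
      "dim_col (lie_bracket x y) = dim_col (0\<^sub>m (2 * n) (2 * n) :: 'k mat)" using c by auto
    fix i j assume "i < dim_row (0\<^sub>m (2 * n) (2 * n) :: 'k mat)" "j < dim_col (0\<^sub>m (2 * n) (2 * n) :: 'k mat)"
    then have ij: "i < 2 * n" "j < 2 * n" by auto
    have "(\<Sum>k<2 * n. x $$ (i, k) * y $$ (k, j)) = (\<Sum>k<2 * n. if k = i then half_sign n i * y $$ (i, j) else 0)"
      using ij by (intro sum.cong refl) (auto simp: xe)
    moreover have "(\<Sum>k<2 * n. y $$ (i, k) * x $$ (k, j)) = (\<Sum>k<2 * n. if k = j then y $$ (i, j) * half_sign n j else 0)"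
      using ij by (intro sum.cong refl) (auto simp: xe)
    ultimately have "lie_bracket x y $$ (i, j) = (half_sign n i - half_sign n j) * y $$ (i, j)"
      unfolding lie_bracket_entry[OF xc yc ij] using ij by (simp add: scalar_simps)
    also have "\<dots> = 0"
    proof (cases "y $$ (i, j) = 0")
      case False
      then have "cut_order n P Q i j" using cut_seaweedD(3)[OF y ij] by blast
      then have "n \<le> i \<longleftrightarrow> n \<le> j" using nP nQ by (auto simp: cut_order_def)
      then show ?thesis by (auto simp: half_sign_def)
    qed simp
    finally show "lie_bracket x y $$ (i, j) = 0\<^sub>m (2 * n) (2 * n) $$ (i, j)" using ij by simp
  qed
  then have "x = 0\<^sub>m (2 * n) (2 * n)"
    using linear_form_zero[OF lf cut_seaweed_lie_algebra] by (intro frobenius_formD[OF \<gamma> x]) auto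
  then have "x $$ (0, 0) = 0" using n by simp
  then show False using n by (simp add: xe half_sign_def)
qed

lemma smult_smult_mat: "a \<cdot>\<^sub>m (b \<cdot>\<^sub>m A) = (a * b) \<cdot>\<^sub>m (A :: 'k::field mat)"
  by (intro eq_matI) (simp_all add: mult.assoc)

lemma one_smult_mat: "1 \<cdot>\<^sub>m A = (A :: 'k::field mat)"
  by (intro eq_matI) simp_all

text \<open>The adjoint with respect to the symplectic form. It reverses products, and the symplectic Lie
algebra consists of the matrices whose adjoint is their negative.\<close>

definition symp_adjoint :: "nat \<Rightarrow> 'k::field mat \<Rightarrow> 'k mat" where
  "symp_adjoint n x = mat (2 * n) (2 * n) (\<lambda>(i, j). half_sign n i * half_sign n j * x $$ (mir n j, mir n i))"

definition cut_algebra :: "nat \<Rightarrow> nat set \<Rightarrow> nat set \<Rightarrow> 'k::field mat set" where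
  "cut_algebra n P Q = {M \<in> carrier_mat (2 * n) (2 * n).
     \<forall>i<2 * n. \<forall>j<2 * n. M $$ (i, j) \<noteq> 0 \<longrightarrow> cut_order n P Q i j}"

lemma symp_adjoint_carrier [simp]: "symp_adjoint n x \<in> carrier_mat (2 * n) (2 * n)"
  by (simp add: symp_adjoint_def)

lemma symp_adjoint_entry [simp]:
  "i < 2 * n \<Longrightarrow> j < 2 * n \<Longrightarrow>
    symp_adjoint n x $$ (i, j) = half_sign n i * half_sign n j * x $$ (mir n j, mir n i)"
  by (simp add: symp_adjoint_def)

lemma cut_seaweed_eq:
  "cut_seaweed n P Q = {x \<in> cut_algebra n P Q. symp_adjoint n x = (- 1) \<cdot>\<^sub>m (x :: 'k::field mat)}"
proof -
  have "symp_adjoint n x = (- 1) \<cdot>\<^sub>m x \<longleftrightarrow>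
      (\<forall>i<2 * n. \<forall>j<2 * n. x $$ (mir n j, mir n i) = - (half_sign n i * half_sign n j * x $$ (i, j)))"
    (is "?l \<longleftrightarrow> ?r") if x: "x \<in> carrier_mat (2 * n) (2 * n)" for x :: "'k mat"
  proof
    assume l: ?l
    show ?r
    proof (intro allI impI)
      fix i j assume ij: "i < 2 * n" "j < 2 * n"
      have "symp_adjoint n x $$ (i, j) = - x $$ (i, j)" unfolding l using ij x by simp
      then have "half_sign n i * half_sign n j * (half_sign n i * half_sign n j * x $$ (mir n j, mir n i))
          = - (half_sign n i * half_sign n j * x $$ (i, j))"
        using ij by simp
      then show "x $$ (mir n j, mir n i) = - (half_sign n i * half_sign n j * x $$ (i, j))"
        by (simp add: scalar_simps)
    qed
  next
    assume ?r
    then show ?l using x by (intro eq_matI) (auto simp: scalar_simps symp_adjoint_def)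
  qed
  then show ?thesis unfolding cut_seaweed_def cut_algebra_def by auto
qed

lemma symp_adjoint_mult:
  assumes "x \<in> carrier_mat (2 * n) (2 * n)" "y \<in> carrier_mat (2 * n) (2 * n)"
  shows "symp_adjoint n (x * y) = symp_adjoint n y * symp_adjoint n (x :: 'k::field mat)"
proof (rule eq_matI)
  fix i j assume "i < dim_row (symp_adjoint n y * symp_adjoint n x)" "j < dim_col (symp_adjoint n y * symp_adjoint n x)"
  then have ij: "i < 2 * n" "j < 2 * n" by (auto simp: symp_adjoint_def)
  have "symp_adjoint n (x * y) $$ (i, j) = half_sign n i * half_sign n j * (\<Sum>k<2 * n. x $$ (mir n j, k) * y $$ (k, mir n i))"
    using ij by (simp add: mult_mat_entry[OF assms])
  also have "\<dots> = half_sign n i * half_sign n j * (\<Sum>k<2 * n. x $$ (mir n j, mir n k) * y $$ (mir n k, mir n i))"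
    by (simp add: sum_mir[of "\<lambda>k. x $$ (mir n j, k) * y $$ (k, mir n i)"])
  also have "\<dots> = (\<Sum>k<2 * n. symp_adjoint n y $$ (i, k) * symp_adjoint n x $$ (k, j))"
    unfolding sum_distrib_left using ij by (intro sum.cong refl) (simp add: scalar_simps)
  also have "\<dots> = (symp_adjoint n y * symp_adjoint n x) $$ (i, j)"
    using ij by (simp add: mult_mat_entry[OF symp_adjoint_carrier symp_adjoint_carrier])
  finally show "symp_adjoint n (x * y) $$ (i, j) = (symp_adjoint n y * symp_adjoint n x) $$ (i, j)" .
qed (simp_all add: symp_adjoint_def)

lemma cut_algebra_mult:
  assumes x: "x \<in> cut_algebra n P Q" and y: "y \<in> cut_algebra n P Q"
  shows "x * y \<in> cut_algebra n P (Q :: nat set)"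
proof -
  have c: "x \<in> carrier_mat (2 * n) (2 * n)" "y \<in> carrier_mat (2 * n) (2 * n)"
    using assms by (auto simp: cut_algebra_def)
  have "cut_order n P Q i j" if ij: "i < 2 * n" "j < 2 * n" and nz: "(x * y) $$ (i, j) \<noteq> 0" for i j
  proof (rule ccontr)
    assume no: "\<not> cut_order n P Q i j"
    have "x $$ (i, k) * y $$ (k, j) = 0" if "k < 2 * n" for k
      using no cut_order_trans[of n P Q i k j] x y ij that by (auto simp: cut_algebra_def)
    then have "(\<Sum>k<2 * n. x $$ (i, k) * y $$ (k, j)) = 0" by (intro sum.neutral) auto
    then show False using nz by (simp only: mult_mat_entry[OF c ij] simp_thms)
  qed
  then show ?thesis using c by (auto simp: cut_algebra_def)
qed

lemma cut_algebra_linear: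
  assumes "x \<in> cut_algebra n P Q" "y \<in> cut_algebra n P Q"
  shows "x + y \<in> cut_algebra n P Q" "c \<cdot>\<^sub>m x \<in> cut_algebra n P Q" "1\<^sub>m (2 * n) \<in> cut_algebra n P Q"
proof -
  have "(x + y) $$ (i, j) = 0" if "\<not> cut_order n P Q i j" "i < 2 * n" "j < 2 * n" for i j
  proof -
    have "x $$ (i, j) = 0" "y $$ (i, j) = 0" using assms that by (auto simp: cut_algebra_def)
    then show ?thesis using assms that by (auto simp: cut_algebra_def)
  qed
  then show "x + y \<in> cut_algebra n P Q" using assms by (auto simp: cut_algebra_def)
qed (use assms in \<open>auto simp: cut_algebra_def\<close>)

lemma mult_zero_of_support:
  fixes x y :: "'k::field mat"
  assumes "x \<in> carrier_mat N N" "y \<in> carrier_mat N N"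
    and "\<And>i k j. i < N \<Longrightarrow> k < N \<Longrightarrow> j < N \<Longrightarrow> x $$ (i, k) \<noteq> 0 \<Longrightarrow> y $$ (k, j) \<noteq> 0 \<Longrightarrow> False"
  shows "x * y = 0\<^sub>m N N"
proof (rule eq_matI)
  fix i j assume "i < dim_row (0\<^sub>m N N :: 'k mat)" "j < dim_col (0\<^sub>m N N :: 'k mat)"
  then have ij: "i < N" "j < N" by auto
  have "(x * y) $$ (i, j) = (\<Sum>k<N. x $$ (i, k) * y $$ (k, j))" by (rule mult_mat_entry[OF assms(1,2) ij])
  also have "\<dots> = 0" using assms(3)[OF ij(1) _ ij(2)] by (intro sum.neutral) auto
  finally show "(x * y) $$ (i, j) = 0\<^sub>m N N $$ (i, j)" using ij by simp
qed (use assms in auto)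

lemma frobenius_form_conjugate:
  fixes g h :: "'k::field mat"
  assumes \<gamma>: "frobenius_form (2 * n) (cut_seaweed n P Q) \<gamma>"
    and g: "g \<in> cut_algebra n P Q" and h: "h \<in> cut_algebra n P Q"
    and gh: "g * h = 1\<^sub>m (2 * n)" "h * g = 1\<^sub>m (2 * n)"
    and adj: "symp_adjoint n g = h" "symp_adjoint n h = g"
  shows "frobenius_form (2 * n) (cut_seaweed n P Q) (\<gamma> \<circ> (\<lambda>y. g * y * h))"
proof -
  let ?q = "cut_seaweed n P Q :: 'k mat set"
  let ?C = "carrier_mat (2 * n) (2 * n) :: 'k mat set"
  have gc: "g \<in> ?C" and hc: "h \<in> ?C" using g h by (auto simp: cut_algebra_def)
  have conj_mem: "a * y * b \<in> ?q"
    if y: "y \<in> ?q" and ab: "a \<in> cut_algebra n P Q" "b \<in> cut_algebra n P Q" "symp_adjoint n a = b" "symp_adjoint n b = a"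
    for y a b
  proof -
    have c: "y \<in> ?C" "a \<in> ?C" "b \<in> ?C" using y ab by (auto simp: cut_algebra_def cut_seaweed_eq)
    have "symp_adjoint n (a * y * b) = a * ((- 1) \<cdot>\<^sub>m y * b)"
      using c y ab assoc_mult_mat[of a "2 * n" "2 * n" "(- 1) \<cdot>\<^sub>m y" "2 * n" b "2 * n"]
      by (simp add: symp_adjoint_mult[of _ n] cut_seaweed_eq)
    also have "\<dots> = (- 1) \<cdot>\<^sub>m (a * y * b)"
      using c by (simp add: assoc_mult_mat[of a "2 * n" "2 * n" y "2 * n" b] mult_smult_distrib[of a "2 * n" "2 * n" "y * b" "2 * n"]
          mult_smult_assoc_mat[of y "2 * n" "2 * n" b "2 * n"])
    finally have "symp_adjoint n (a * y * b) = (- 1) \<cdot>\<^sub>m (a * y * b)" .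
    moreover have "a * y * b \<in> cut_algebra n P Q"
      using y ab(1,2) by (intro cut_algebra_mult) (auto simp: cut_seaweed_eq)
    ultimately show ?thesis by (simp add: cut_seaweed_eq)
  qed
  have cancel: "a * (b * y * a) * b = y" if "y \<in> ?C" "a \<in> ?C" "b \<in> ?C" "a * b = 1\<^sub>m (2 * n)" for y a b
  proof -
    have "a * (b * y) = y" using that assoc_mult_mat[of a "2 * n" "2 * n" b "2 * n" y "2 * n"] by simp
    then show ?thesis
      using that by (simp add: assoc_mult_mat[of _ "2 * n" "2 * n" _ "2 * n" _ "2 * n"])
  qed
  show ?thesis
  proof (rule frobenius_form_pullback[OF \<gamma> cut_seaweed_lie_algebra])
    show "(\<lambda>y. g * y * h) ` ?q = ?q"
    proof
      show "(\<lambda>y. g * y * h) ` ?q \<subseteq> ?q" using conj_mem g h adj by auto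
      show "?q \<subseteq> (\<lambda>y. g * y * h) ` ?q"
      proof
        fix y assume y: "y \<in> ?q"
        have "y = g * (h * y * g) * h" using cancel[OF cut_seaweedD(1)[OF y] gc hc gh(1)] by simp
        moreover have "h * y * g \<in> ?q" by (rule conj_mem[OF y h g adj(2,1)])
        ultimately show "y \<in> (\<lambda>y. g * y * h) ` ?q" by blast
      qed
    qed
    fix x y :: "'k mat" and c :: 'k assume x: "x \<in> ?q"
    note xc = cut_seaweedD(1)[OF x]
    show "g * (c \<cdot>\<^sub>m x) * h = c \<cdot>\<^sub>m (g * x * h)"
      using xc gc hc by (simp add: mult_smult_distrib[of g "2 * n" "2 * n" x "2 * n"]
          mult_smult_assoc_mat[of "g * x" "2 * n" "2 * n" h "2 * n"])
    show "g * x * h = 0\<^sub>m (2 * n) (2 * n) \<Longrightarrow> x = 0\<^sub>m (2 * n) (2 * n)"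
      using cancel[OF xc hc gc gh(2)] gc hc by simp
    assume y: "y \<in> ?q"
    note yc = cut_seaweedD(1)[OF y]
    show "g * (x + y) * h = g * x * h + g * y * h"
      using xc yc gc hc by (simp add: mult_add_distrib_mat[of g "2 * n" "2 * n" x "2 * n" y]
          add_mult_distrib_mat[of "g * x" "2 * n" "2 * n" "g * y" h "2 * n"])
    have prod: "(g * a * h) * (g * b * h) = g * (a * b) * h" if "a \<in> ?C" "b \<in> ?C" for a b
    proof -
      have "(g * a * h) * (g * b * h) = g * (a * ((h * g) * b)) * h"
        using that gc hc by (simp add: assoc_mult_mat[of _ "2 * n" "2 * n" _ "2 * n" _ "2 * n"])
      then show ?thesis using that gh by simp
    qed
    show "g * lie_bracket x y * h = lie_bracket (g * x * h) (g * y * h)"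
      unfolding lie_bracket_def prod[OF xc yc] prod[OF yc xc] using xc yc gc hc
      by (simp add: mult_minus_distrib_mat[of g "2 * n" "2 * n" "x * y" "2 * n" "y * x"]
          minus_mult_distrib_mat[of "g * (x * y)" "2 * n" "2 * n" "g * (y * x)" h "2 * n"])
  qed
qed

text \<open>A trivial kernel makes the determinant nonzero and hence the matrix invertible, once the index set
is numbered.\<close>

lemma linear_system_solvable:
  fixes A :: "nat \<Rightarrow> nat \<Rightarrow> 'k::field"
  assumes fin: "finite I"
    and inj: "\<And>v a. (\<And>j. j \<in> I \<Longrightarrow> (\<Sum>a\<in>I. A a j * v a) = 0) \<Longrightarrow> a \<in> I \<Longrightarrow> v a = 0"
  shows "\<exists>v. (\<forall>a. a \<notin> I \<longrightarrow> v a = 0) \<and> (\<forall>j\<in>I. (\<Sum>a\<in>I. A a j * v a) = r j)"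
proof -
  define l where "l = card I"
  obtain h where h: "bij_betw h {..<l} I"
    using ex_bij_betw_nat_finite[OF fin] by (auto simp: l_def atLeast0LessThan)
  define h' where "h' = inv_into {..<l} h"
  have hh: "h' (h i) = i" if "i < l" for i
    using h that by (auto simp: h'_def bij_betw_def inv_into_f_f)
  have hI: "h i \<in> I" if "i < l" for i using h that by (auto simp: bij_betw_def)
  define B where "B = mat l l (\<lambda>(i, j). A (h j) (h i))"
  have B: "B \<in> carrier_mat l l" by (simp add: B_def)
  define lift where "lift v a = (if a \<in> I then v $ h' a else 0)" for v :: "'k vec" and a
  have Bv: "(B *\<^sub>v v) $ i = (\<Sum>a\<in>I. A a (h i) * lift v a)" if "v \<in> carrier_vec l" "i < l" for v i
  proof -
    have "(B *\<^sub>v v) $ i = (\<Sum>j<l. A (h j) (h i) * v $ j)"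
      using that by (auto simp: B_def scalar_prod_def atLeast0LessThan intro!: sum.cong)
    also have "\<dots> = (\<Sum>j<l. A (h j) (h i) * lift v (h j))"
      using hh hI by (intro sum.cong) (auto simp: lift_def)
    also have "\<dots> = (\<Sum>a\<in>I. A a (h i) * lift v a)" by (rule sum.reindex_bij_betw[OF h])
    finally show ?thesis .
  qed
  have surj: "\<exists>i<l. h i = a" if "a \<in> I" for a using h that by (auto simp: bij_betw_def)
  have "det B \<noteq> 0"
  proof
    assume "det B = 0"
    then obtain v where v: "v \<in> carrier_vec l" "v \<noteq> 0\<^sub>v l" "B *\<^sub>v v = 0\<^sub>v l"
      using det_0_iff_vec_prod_zero[OF B] by blast
    have "(\<Sum>a\<in>I. A a j * lift v a) = 0" if jI: "j \<in> I" for j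
    proof -
      obtain i where "i < l" "h i = j" using surj[OF jI] by blast
      then show ?thesis using Bv[OF v(1), of i] v(3) by simp
    qed
    then have "lift v a = 0" if "a \<in> I" for a using inj that by blast
    then have "v $ i = 0" if "i < l" for i using that hI[OF that] hh[OF that] unfolding lift_def by (metis)
    then have "v = 0\<^sub>v l" using v(1) by (intro eq_vecI) auto
    then show False using v(2) by simp
  qed
  from det_non_zero_imp_unit[OF B this, of "()"] obtain C where C: "C \<in> carrier_mat l l" "B * C = 1\<^sub>m l"
    by (auto simp: Units_def ring_mat_def)
  define s where "s = C *\<^sub>v vec l (\<lambda>i. r (h i))"
  have s: "s \<in> carrier_vec l" using C by (simp add: s_def)
  have "B *\<^sub>v s = vec l (\<lambda>i. r (h i))"
    using B C by (simp add: s_def assoc_mult_mat_vec[of B l l C l, symmetric])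
  then have "(\<Sum>a\<in>I. A a (h i) * lift s a) = r (h i)" if "i < l" for i
    using Bv[OF s that] that by simp
  then show ?thesis using surj by (intro exI[of _ "lift s"]) (auto simp: lift_def)
qed


lemma form_sym_block:
  fixes \<gamma> :: "'k::field_char_0 mat \<Rightarrow> 'k"
  assumes \<gamma>: "\<gamma> \<in> linear_forms (cut_seaweed n P Q)" and PQ: "P \<subseteq> {..n}" "Q \<subseteq> {..n}"
    and v: "\<And>i. i \<notin> extremal_indices n P Q \<Longrightarrow> v i = 0"
    and w: "\<And>i. i \<notin> extremal_indices n P Q \<Longrightarrow> w i = 0"
  shows "\<gamma> (sym_block n v w) = 2 * (\<Sum>j\<in>extremal_indices n P Q.
    (\<Sum>a\<in>extremal_indices n P Q. form_coeff n \<gamma> (mir n a) j * v a) * w j)"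
proof -
  let ?I = "extremal_indices n P Q"
  let ?\<xi> = "form_coeff n \<gamma>"
  have I: "?I \<subseteq> {..<2 * n}" by (auto simp: extremal_indices_def)
  have sym: "?\<xi> (mir n a) j = ?\<xi> (mir n j) a" if a: "a \<in> ?I" and j: "j \<in> ?I" for a j
  proof -
    have aj: "a < n" "j < n" using a j by (auto simp: extremal_indices_def)
    have "cut_order n P Q (mir n a) j"
    proof -
      have "\<not> 2 * n - p \<le> mir n a" if "p \<in> P" for p
        using that a PQ by (auto simp: extremal_indices_def mir_def)
      moreover have "n \<le> mir n a" using aj by (simp add: mir_def)
      ultimately show ?thesis using PQ j aj by (fastforce simp: cut_order_def extremal_indices_def)
    qed
    then have "?\<xi> (mir n j) (mir n (mir n a)) = - (half_sign n (mir n a) * half_sign n j * ?\<xi> (mir n a) j)"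
      using aj by (intro form_coeff_mir[OF \<gamma>] PQ) auto
    then show ?thesis using aj by (simp add: half_sign_def mir_def)
  qed
  have "\<gamma> (sym_block n v w) = (\<Sum>i<2 * n. \<Sum>j<2 * n. ?\<xi> i j * (v (mir n i) * w j + w (mir n i) * v j))"
    using form_expansion[OF \<gamma> PQ sym_block_mem[OF v w PQ]] by simp
  also have "\<dots> = (\<Sum>a<2 * n. \<Sum>j<2 * n. ?\<xi> (mir n a) j * (v a * w j + w a * v j))"
    by (subst sum_mir[symmetric]) simp
  also have "\<dots> = (\<Sum>a\<in>?I. \<Sum>j<2 * n. ?\<xi> (mir n a) j * (v a * w j + w a * v j))"
    using I v w by (intro sum.mono_neutral_right) auto
  also have "\<dots> = (\<Sum>a\<in>?I. \<Sum>j\<in>?I. ?\<xi> (mir n a) j * (v a * w j + w a * v j))"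
    using I v w by (intro sum.cong sum.mono_neutral_right) auto
  also have "\<dots> = (\<Sum>a\<in>?I. \<Sum>j\<in>?I. ?\<xi> (mir n a) j * v a * w j) + (\<Sum>a\<in>?I. \<Sum>j\<in>?I. ?\<xi> (mir n j) a * v j * w a)"
    unfolding sum.distrib[symmetric] by (intro sum.cong refl) (simp add: sym distrib_left mult.assoc)
  also have "(\<Sum>a\<in>?I. \<Sum>j\<in>?I. ?\<xi> (mir n a) j * v a * w j) = (\<Sum>a\<in>?I. \<Sum>j\<in>?I. ?\<xi> (mir n j) a * v j * w a)"
    by (rule sum.swap)
  also have "\<dots> + (\<Sum>a\<in>?I. \<Sum>j\<in>?I. ?\<xi> (mir n j) a * v j * w a)
      = 2 * (\<Sum>j\<in>?I. (\<Sum>a\<in>?I. ?\<xi> (mir n a) j * v a) * w j)"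
    by (simp only: sum_distrib_right mult_2)
  finally show ?thesis .
qed

lemma mult_sp_unit_right:
  fixes A :: "'k::field mat"
  assumes A: "A \<in> carrier_mat (2 * n) (2 * n)" and pq: "p < 2 * n" "q < 2 * n" and ij: "i < 2 * n" "j < 2 * n"
  shows "(A * sp_unit n p q) $$ (i, j) = (if j = q then A $$ (i, p) else 0)
    - (if j = mir n p then half_sign n p * half_sign n q * A $$ (i, mir n q) else 0)"
proof -
  have split: "a * ((if A1 \<and> B then 1 else 0) - (if C \<and> D then s else 0)) =
      (if A1 then if B then a else 0 else 0) - (if C then if D then s * a else 0 else 0)"
    for A1 B C D and a s :: 'k
    by (cases A1; cases B; cases C; cases D) (auto simp: right_diff_distrib)
  have "(A * sp_unit n p q) $$ (i, j) = (\<Sum>k<2 * n. A $$ (i, k) * sp_unit n p q $$ (k, j))"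
    by (rule mult_mat_entry[OF A sp_unit_carrier ij])
  also have "\<dots> = (\<Sum>k<2 * n. (if k = p then if j = q then A $$ (i, k) else 0 else 0)
      - (if k = mir n q then if j = mir n p then half_sign n p * half_sign n q * A $$ (i, k) else 0 else 0))"
    using ij(2) by (intro sum.cong refl) (simp only: sp_unit_entry lessThan_iff split)
  also have "\<dots> = (if j = q then A $$ (i, p) else 0)
      - (if j = mir n p then half_sign n p * half_sign n q * A $$ (i, mir n q) else 0)"
    using pq by (simp add: sum_subtractf)
  finally show ?thesis .
qed

lemma mult_sp_unit_left:
  fixes A :: "'k::field mat"
  assumes A: "A \<in> carrier_mat (2 * n) (2 * n)" and pq: "p < 2 * n" "q < 2 * n" and ij: "i < 2 * n" "j < 2 * n"
  shows "(sp_unit n p q * A) $$ (i, j) = (if i = p then A $$ (q, j) else 0)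
    - (if i = mir n q then half_sign n p * half_sign n q * A $$ (mir n p, j) else 0)"
proof -
  have split: "((if A1 \<and> B then 1 else 0) - (if C \<and> D then s else 0)) * a =
      (if B then if A1 then a else 0 else 0) - (if D then if C then s * a else 0 else 0)"
    for A1 B C D and a s :: 'k
    by (cases A1; cases B; cases C; cases D) (auto simp: left_diff_distrib)
  have "(sp_unit n p q * A) $$ (i, j) = (\<Sum>k<2 * n. sp_unit n p q $$ (i, k) * A $$ (k, j))"
    by (rule mult_mat_entry[OF sp_unit_carrier A ij])
  also have "\<dots> = (\<Sum>k<2 * n. (if k = q then if i = p then A $$ (k, j) else 0 else 0)
      - (if k = mir n p then if i = mir n q then half_sign n p * half_sign n q * A $$ (k, j) else 0 else 0))"
    using ij(1) by (intro sum.cong refl) (simp only: sp_unit_entry lessThan_iff split)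
  also have "\<dots> = (if i = p then A $$ (q, j) else 0)
      - (if i = mir n q then half_sign n p * half_sign n q * A $$ (mir n p, j) else 0)"
    using pq by (simp add: sum_subtractf)
  finally show ?thesis .
qed

lemma conjugate_sp_unit:
  fixes A B :: "'k::field mat"
  assumes A: "A \<in> carrier_mat (2 * n) (2 * n)" and B: "B \<in> carrier_mat (2 * n) (2 * n)"
    and pq: "p < 2 * n" "q < 2 * n" and ij: "i < 2 * n" "j < 2 * n"
  shows "(A * sp_unit n p q * B) $$ (i, j) = A $$ (i, p) * B $$ (q, j)
    - half_sign n p * half_sign n q * A $$ (i, mir n q) * B $$ (mir n p, j)"
proof -
  have split: "((if C then a else 0) - (if D then b else 0)) * c = (if C then a * c else 0) - (if D then b * c else 0)"
    for C D and a b c :: 'k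
    by (cases C; cases D) (auto simp: left_diff_distrib)
  have "(A * sp_unit n p q * B) $$ (i, j) = (\<Sum>k<2 * n. (A * sp_unit n p q) $$ (i, k) * B $$ (k, j))"
    by (rule mult_mat_entry[OF mult_carrier_mat[OF A sp_unit_carrier] B ij])
  also have "\<dots> = (\<Sum>k<2 * n. (if k = q then A $$ (i, p) * B $$ (k, j) else 0)
      - (if k = mir n p then half_sign n p * half_sign n q * A $$ (i, mir n q) * B $$ (k, j) else 0))"
    by (intro sum.cong refl) (simp only: mult_sp_unit_right[OF A pq ij(1)] lessThan_iff split)
  also have "\<dots> = A $$ (i, p) * B $$ (q, j)
      - half_sign n p * half_sign n q * A $$ (i, mir n q) * B $$ (mir n p, j)"
    using pq by (simp add: sum_subtractf)
  finally show ?thesis .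
qed

text \<open>The exponential of a matrix with \<open>u\<^sup>3 = 0\<close>.\<close>

definition exp_mat :: "nat \<Rightarrow> 'k::field mat \<Rightarrow> 'k mat" where
  "exp_mat N u = 1\<^sub>m N + (u + (1 / 2) \<cdot>\<^sub>m (u * u))"

lemma exp_mat_inverse:
  fixes u :: "'k::field_char_0 mat"
  assumes u: "u \<in> carrier_mat N N" and cube: "u * u * u = 0\<^sub>m N N"
  shows "exp_mat N u * exp_mat N ((- 1) \<cdot>\<^sub>m u) = 1\<^sub>m N"
proof -
  define w where "w = (1 / 2) \<cdot>\<^sub>m (u * u)"
  have w: "w \<in> carrier_mat N N" using u by (simp add: w_def)
  have uu: "u * u \<in> carrier_mat N N" using u by simp
  have cube': "u * (u * u) = 0\<^sub>m N N" using cube assoc_mult_mat[OF u u u] by simp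
  have uw: "u * w = 0\<^sub>m N N" using mult_smult_distrib[OF u uu] cube' by (simp add: w_def)
  have wu: "w * u = 0\<^sub>m N N" using mult_smult_assoc_mat[OF uu u] cube by (simp add: w_def)
  have "w * w = (1 / 2) \<cdot>\<^sub>m (w * (u * u))" using mult_smult_distrib[OF w uu] by (simp add: w_def)
  also have "w * (u * u) = 0\<^sub>m N N" using assoc_mult_mat[OF w u u] wu u by simp
  finally have ww: "w * w = 0\<^sub>m N N" by simp
  define u' where "u' = (- 1) \<cdot>\<^sub>m u"
  have u': "u' \<in> carrier_mat N N" using u by (simp add: u'_def)
  have "u' * u' = u * u"
    unfolding u'_def using u
    by (simp add: mult_smult_distrib[of _ N N u N] mult_smult_assoc_mat[of u N N _ N] smult_smult_mat one_smult_mat)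
  then have e': "exp_mat N u' = 1\<^sub>m N + (u' + w)" by (simp add: exp_mat_def w_def)
  have e: "exp_mat N u = 1\<^sub>m N + (u + w)" by (simp add: exp_mat_def w_def)
  have prod: "(u + w) * (u' + w) = (- 1) \<cdot>\<^sub>m (u * u)"
  proof -
    have "(u + w) * (u' + w) = (u + w) * u' + (u + w) * w"
      using u w u' by (intro mult_add_distrib_mat[of _ N N]) auto
    moreover have "(u + w) * u' = u * u' + w * u'" "(u + w) * w = u * w + w * w"
      using u w u' by (auto intro!: add_mult_distrib_mat[of _ N N])
    moreover have "u * u' = (- 1) \<cdot>\<^sub>m (u * u)" "w * u' = (- 1) \<cdot>\<^sub>m (w * u)"
      unfolding u'_def using u w by (simp_all add: mult_smult_distrib[of _ N N u N])
    ultimately show ?thesis using uw wu ww uu by simp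
  qed
  have uw': "u + w \<in> carrier_mat N N" "u' + w \<in> carrier_mat N N" using u u' w by auto
  have "(1\<^sub>m N + (u + w)) * (1\<^sub>m N + (u' + w)) = (1\<^sub>m N + (u + w)) + ((u' + w) + (u + w) * (u' + w))"
  proof -
    have "(1\<^sub>m N + (u + w)) * (1\<^sub>m N + (u' + w))
        = (1\<^sub>m N + (u + w)) * 1\<^sub>m N + (1\<^sub>m N + (u + w)) * (u' + w)"
      using uw' by (intro mult_add_distrib_mat[of _ N N]) auto
    also have "(1\<^sub>m N + (u + w)) * (u' + w) = 1\<^sub>m N * (u' + w) + (u + w) * (u' + w)"
      using uw' by (intro add_mult_distrib_mat[of _ N N]) auto
    also have "1\<^sub>m N * (u' + w) = u' + w" using uw'(2) by (rule left_mult_one_mat)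
    also have "(1\<^sub>m N + (u + w)) * 1\<^sub>m N = 1\<^sub>m N + (u + w)"
      using uw' by (intro right_mult_one_mat[of _ N N]) auto
    finally show ?thesis .
  qed
  also have "\<dots> = 1\<^sub>m N"
    unfolding prod
  proof (rule eq_matI)
    fix i j assume "i < dim_row (1\<^sub>m N :: 'k mat)" "j < dim_col (1\<^sub>m N :: 'k mat)"
    then have ij: "i < N" "j < N" by auto
    have "w $$ (i, j) = (u * u) $$ (i, j) / 2"
      using ij u by (simp add: w_def del: index_mult_mat(1))
    then have "(u * u) $$ (i, j) = w $$ (i, j) + w $$ (i, j)"
      by (simp add: mult.commute flip: mult_2 del: index_mult_mat(1))
    then show "(1\<^sub>m N + (u + w) + (u' + w + - 1 \<cdot>\<^sub>m (u * u))) $$ (i, j) = 1\<^sub>m N $$ (i, j)"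
      using ij u w u' by (simp add: u'_def del: index_mult_mat(1))
  qed (use u w u' in auto)
  finally show ?thesis unfolding e e'[unfolded u'_def] u'_def .
qed

lemma symp_adjoint_exp_mat:
  fixes u :: "'k::field mat"
  assumes u: "u \<in> carrier_mat (2 * n) (2 * n)"
  shows "symp_adjoint n (exp_mat (2 * n) u) = exp_mat (2 * n) (symp_adjoint n u)"
proof -
  have uu: "u * u \<in> carrier_mat (2 * n) (2 * n)" using u by simp
  have "symp_adjoint n (exp_mat (2 * n) u) = 1\<^sub>m (2 * n) + (symp_adjoint n u + (1 / 2) \<cdot>\<^sub>m symp_adjoint n (u * u))"
    using u uu by (intro eq_matI) (auto simp: exp_mat_def symp_adjoint_def scalar_simps simp del: index_mult_mat(1))
  then show ?thesis by (simp add: exp_mat_def symp_adjoint_mult[OF u u])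
qed

text \<open>If no cut in \<open>P\<close> lies beyond the last cut in \<open>Q\<close>, the positions between the last cut in \<open>Q\<close>
  and its mirror image carry a full symplectic Lie algebra. Besides it, an element of the seaweed has
  entries in the middle rows only over the extremal indices. These mixed entries, together with their
  mirror images and the symmetric blocks, form a Heisenberg-like ideal on which the middle algebra
  acts.\<close>

context
  fixes n :: nat and P Q :: "nat set"
  assumes PQ: "P \<subseteq> {..n}" "Q \<subseteq> {..n}"
    and below: "\<And>p. p \<in> P \<Longrightarrow> p = 0 \<or> (\<exists>r\<in>Q. p \<le> r)"
begin

definition middle :: "nat set" where
  "middle = {i. i < 2 * n \<and> (\<forall>p\<in>Q. p \<le> i \<and> i < 2 * n - p)}"

abbreviation outer :: "nat set" where "outer \<equiv> extremal_indices n P Q"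

lemma middle_less: "i \<in> middle \<Longrightarrow> i < 2 * n"
  by (simp add: middle_def)

lemma outer_less: "i \<in> outer \<Longrightarrow> i < n"
  by (simp add: extremal_indices_def)

lemma mir_middle: "i \<in> middle \<Longrightarrow> mir n i \<in> middle"
  by (fastforce simp: middle_def mir_def)

lemma outer_not_middle: "i \<in> outer \<Longrightarrow> i \<notin> middle"
  by (force simp: middle_def extremal_indices_def)

lemma mir_outer_not_middle: "mir n i \<in> outer \<Longrightarrow> i < 2 * n \<Longrightarrow> i \<notin> middle"
  using mir_middle outer_not_middle by blast

lemma middle_above_cuts:
  assumes "i \<in> middle" "p \<in> P"
  shows "p \<le> i" "i < 2 * n - p"
  using below[OF assms(2)] assms(1) PQ by (fastforce simp: middle_def)+

lemma middle_cut_orderD: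
  assumes "i \<in> middle" "j < 2 * n" "cut_order n P Q i j"
  shows "j \<in> middle \<or> j \<in> outer"
proof (cases "j \<in> middle")
  case False
  have up: "\<forall>p\<in>P. p \<le> j" "\<forall>p\<in>Q. j < 2 * n - p"
    using assms middle_above_cuts(1)[OF assms(1)] by (auto simp: cut_order_def middle_def not_le[symmetric])
  then obtain p where "p \<in> Q" "j < p" using False assms(2) by (auto simp: middle_def not_le)
  then have "j \<in> outer" using up(1) PQ by (fastforce simp: extremal_indices_def)
  then show ?thesis by simp
qed simp

lemma cut_order_middleD:
  assumes "j \<in> middle" "i < 2 * n" "cut_order n P Q i j"
  shows "i \<in> middle \<or> mir n i \<in> outer"
proof -
  have "cut_order n P Q (mir n j) (mir n i)"
    using assms middle_less by (intro cut_order_mir PQ) auto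
  then have "mir n i \<in> middle \<or> mir n i \<in> outer"
    using middle_cut_orderD[OF mir_middle[OF assms(1)]] assms(2) by simp
  then show ?thesis using mir_middle[of "mir n i"] assms(2) by auto
qed

lemma cut_order_middleI:
  assumes i: "i \<in> middle" and j: "j \<in> middle \<or> j \<in> outer"
  shows "cut_order n P Q i j"
proof -
  have P: "p \<le> j" "\<not> 2 * n - p \<le> i" if "p \<in> P" for p
    using j that middle_above_cuts[of _ p] i by (auto simp: extremal_indices_def not_le)
  have Q: "p \<le> i" "\<not> 2 * n - p \<le> j" if "p \<in> Q" for p
  proof -
    show "p \<le> i" using i that by (auto simp: middle_def)
    show "\<not> 2 * n - p \<le> j"
      using j that PQ outer_less[of j] by (fastforce simp: middle_def)
  qed
  show ?thesis using P Q by (auto simp: cut_order_def)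
qed

text \<open>If \<open>\<gamma>\<close> vanishes on the mixed entries, then \<open>\<gamma> [Y, y]\<close> depends, for \<open>Y\<close> in the middle algebra, only on
the middle part of \<open>y\<close>. There \<open>\<gamma>\<close> is the trace form \<open>y \<mapsto> tr (X y)\<close> of the transposed coefficient
matrix \<open>X\<close>, and \<open>tr (X [X, y]) = 0\<close>; so \<open>X\<close> stabilises \<open>\<gamma>\<close>. If \<open>X\<close> is zero, every element of the middle
algebra does, and this algebra is nonzero because \<open>(n, n)\<close> is one of its positions.\<close>

lemma no_frobenius_form_if_reduced:
  fixes \<gamma> :: "'k::field_char_0 mat \<Rightarrow> 'k"
  assumes \<gamma>: "frobenius_form (2 * n) (cut_seaweed n P Q) \<gamma>"
    and reduced: "\<And>i j. i \<in> middle \<Longrightarrow> j \<in> outer \<Longrightarrow> form_coeff n \<gamma> i j = 0"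
    and nm: "n \<in> middle"
  shows False
proof -
  let ?q = "cut_seaweed n P Q :: 'k mat set"
  let ?\<xi> = "form_coeff n \<gamma>"
  have lf: "\<gamma> \<in> linear_forms ?q" using \<gamma> by (simp add: frobenius_form_def)
  have reduced': "?\<xi> i j = 0" if "i < 2 * n" "mir n i \<in> outer" "j \<in> middle" for i j
  proof -
    have j: "j < 2 * n" by (rule middle_less[OF that(3)])
    have "?\<xi> (mir n (mir n i)) (mir n (mir n j))
        = - (half_sign n (mir n j) * half_sign n (mir n i) * ?\<xi> (mir n j) (mir n i))"
      using that j by (intro form_coeff_mir[OF lf] PQ cut_order_middleI mir_middle) auto
    then show ?thesis using reduced[of "mir n j" "mir n i"] that j mir_middle by simp
  qed
  have fm: "finite middle" by (rule finite_subset[of _ "{..<2 * n}"]) (auto simp: middle_def)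
  have ms: "middle \<subseteq> {..<2 * n}" by (auto simp: middle_def)
  have no_stab: "Y = 0\<^sub>m (2 * n) (2 * n)"
    if Y: "Y \<in> ?q" and supp: "\<And>i j. i < 2 * n \<Longrightarrow> j < 2 * n \<Longrightarrow> Y $$ (i, j) \<noteq> 0 \<Longrightarrow> i \<in> middle \<and> j \<in> middle"
      and van: "\<And>y. y \<in> ?q \<Longrightarrow> (\<Sum>i\<in>middle. \<Sum>j\<in>middle. ?\<xi> i j *
        ((\<Sum>k\<in>middle. Y $$ (i, k) * y $$ (k, j)) - (\<Sum>k\<in>middle. y $$ (i, k) * Y $$ (k, j)))) = 0" for Y
  proof (rule frobenius_formD[OF \<gamma> Y])
    fix y assume y: "y \<in> ?q"
    define z where "z = lie_bracket Y y"
    have z: "z \<in> ?q" using cut_seaweed_lie_algebra[of n P Q, where 'k='k] Y y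
      by (simp add: mat_lie_algebra_def z_def)
    have ze: "z $$ (i, j) = (\<Sum>k\<in>middle. Y $$ (i, k) * y $$ (k, j)) - (\<Sum>k\<in>middle. y $$ (i, k) * Y $$ (k, j))"
      if ij: "i < 2 * n" "j < 2 * n" for i j
    proof -
      have "(\<Sum>k<2 * n. Y $$ (i, k) * y $$ (k, j)) = (\<Sum>k\<in>middle. Y $$ (i, k) * y $$ (k, j))"
        using ms supp[OF ij(1)] by (intro sum.mono_neutral_right) auto
      moreover have "(\<Sum>k<2 * n. y $$ (i, k) * Y $$ (k, j)) = (\<Sum>k\<in>middle. y $$ (i, k) * Y $$ (k, j))"
        using ms supp[OF _ ij(2)] by (intro sum.mono_neutral_right) auto
      ultimately show ?thesis
        unfolding z_def lie_bracket_entry[OF cut_seaweedD(1)[OF Y] cut_seaweedD(1)[OF y] ij] by simp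
    qed
    have zero: "?\<xi> i j * z $$ (i, j) = 0" if ij: "i < 2 * n" "j < 2 * n" "\<not> (i \<in> middle \<and> j \<in> middle)" for i j
    proof (cases "z $$ (i, j) = 0")
      case False
      then have ord: "cut_order n P Q i j" using cut_seaweedD(3)[OF z ij(1,2)] by blast
      have "i \<in> middle \<or> j \<in> middle"
      proof (rule ccontr)
        assume "\<not> (i \<in> middle \<or> j \<in> middle)"
        then have "Y $$ (i, k) * y $$ (k, j) = 0" "y $$ (i, k) * Y $$ (k, j) = 0" if "k \<in> middle" for k
          using supp[of i k] supp[of k j] middle_less[OF that] ij by auto
        then show False using False ze[OF ij(1,2)] by simp
      qed
      then show ?thesis
        using middle_cut_orderD[OF _ ij(2) ord] cut_order_middleD[OF _ ij(1) ord] ij(3)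
          reduced[of i j] reduced'[OF ij(1), of j] by auto
    qed simp
    have "\<gamma> z = (\<Sum>i<2 * n. \<Sum>j<2 * n. ?\<xi> i j * z $$ (i, j))" by (rule form_expansion[OF lf PQ z])
    also have "\<dots> = (\<Sum>i\<in>middle. \<Sum>j<2 * n. ?\<xi> i j * z $$ (i, j))"
      using ms zero by (intro sum.mono_neutral_right) (auto intro!: sum.neutral)
    also have "\<dots> = (\<Sum>i\<in>middle. \<Sum>j\<in>middle. ?\<xi> i j * z $$ (i, j))"
      using ms zero by (intro sum.cong sum.mono_neutral_right) auto
    also have "\<dots> = (\<Sum>i\<in>middle. \<Sum>j\<in>middle. ?\<xi> i j *
        ((\<Sum>k\<in>middle. Y $$ (i, k) * y $$ (k, j)) - (\<Sum>k\<in>middle. y $$ (i, k) * Y $$ (k, j))))"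
      using middle_less by (intro sum.cong refl) (simp add: ze)
    also have "\<dots> = 0" by (rule van[OF y])
    finally show "\<gamma> (lie_bracket Y y) = 0" by (simp add: z_def)
  qed
  define X where "X = mat (2 * n) (2 * n) (\<lambda>(i, j). if i \<in> middle \<and> j \<in> middle then ?\<xi> j i else 0)"
  have Xe: "X $$ (i, j) = (if i \<in> middle \<and> j \<in> middle then ?\<xi> j i else 0)" if "i < 2 * n" "j < 2 * n" for i j
    using that by (simp add: X_def)
  have X: "X \<in> ?q"
  proof (rule cut_seaweedI)
    fix i j assume ij: "i < 2 * n" "j < 2 * n"
    show "X $$ (i, j) \<noteq> 0 \<Longrightarrow> cut_order n P Q i j"
      using ij by (auto simp: Xe intro: cut_order_middleI split: if_splits)
    have mm: "mir n k \<in> middle \<longleftrightarrow> k \<in> middle" if "k < 2 * n" for k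
      using mir_middle[of k] mir_middle[of "mir n k"] that by auto
    show "X $$ (mir n j, mir n i) = - (half_sign n i * half_sign n j * X $$ (i, j))"
    proof (cases "i \<in> middle \<and> j \<in> middle")
      case True
      then have "?\<xi> (mir n i) (mir n j) = - (half_sign n j * half_sign n i * ?\<xi> j i)"
        using ij by (intro form_coeff_mir[OF lf] PQ cut_order_middleI) auto
      then show ?thesis using ij True by (simp add: Xe mm scalar_simps)
    next
      case False
      then show ?thesis using ij by (auto simp: Xe mm)
    qed
  qed (simp add: X_def)
  have "X = 0\<^sub>m (2 * n) (2 * n)"
  proof (rule no_stab[OF X])
    show "i \<in> middle \<and> j \<in> middle" if "i < 2 * n" "j < 2 * n" "X $$ (i, j) \<noteq> 0" for i j
      using that by (auto simp: Xe split: if_splits)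
    fix y assume "y \<in> ?q"
    define f where "f a b c = ?\<xi> a b * ?\<xi> b c * y $$ (a, c)" for a b c
    have "(\<Sum>i\<in>middle. \<Sum>j\<in>middle. ?\<xi> i j *
        ((\<Sum>k\<in>middle. X $$ (i, k) * y $$ (k, j)) - (\<Sum>k\<in>middle. y $$ (i, k) * X $$ (k, j))))
      = (\<Sum>i\<in>middle. \<Sum>j\<in>middle. (\<Sum>k\<in>middle. f k i j) - (\<Sum>k\<in>middle. f i j k))"
    proof (intro sum.cong refl)
      fix i j assume ij: "i \<in> middle" "j \<in> middle"
      have "(\<Sum>k\<in>middle. X $$ (i, k) * y $$ (k, j)) = (\<Sum>k\<in>middle. ?\<xi> k i * y $$ (k, j))"
        "(\<Sum>k\<in>middle. y $$ (i, k) * X $$ (k, j)) = (\<Sum>k\<in>middle. y $$ (i, k) * ?\<xi> j k)"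
        using ij middle_less by (auto intro!: sum.cong simp: Xe)
      then show "?\<xi> i j * ((\<Sum>k\<in>middle. X $$ (i, k) * y $$ (k, j)) - (\<Sum>k\<in>middle. y $$ (i, k) * X $$ (k, j)))
          = (\<Sum>k\<in>middle. f k i j) - (\<Sum>k\<in>middle. f i j k)"
        by (simp add: f_def sum_distrib_left right_diff_distrib mult_ac)
    qed
    also have "\<dots> = (\<Sum>i\<in>middle. \<Sum>j\<in>middle. \<Sum>k\<in>middle. f k i j) - (\<Sum>i\<in>middle. \<Sum>j\<in>middle. \<Sum>k\<in>middle. f i j k)"
      by (simp add: sum_subtractf)
    also have "(\<Sum>i\<in>middle. \<Sum>j\<in>middle. \<Sum>k\<in>middle. f k i j) = (\<Sum>i\<in>middle. \<Sum>k\<in>middle. \<Sum>j\<in>middle. f k i j)"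
      by (intro sum.cong refl sum.swap)
    also have "\<dots> = (\<Sum>k\<in>middle. \<Sum>i\<in>middle. \<Sum>j\<in>middle. f k i j)" by (rule sum.swap)
    finally show "(\<Sum>i\<in>middle. \<Sum>j\<in>middle. ?\<xi> i j *
        ((\<Sum>k\<in>middle. X $$ (i, k) * y $$ (k, j)) - (\<Sum>k\<in>middle. y $$ (i, k) * X $$ (k, j)))) = 0" by simp
  qed
  then have \<xi>0: "?\<xi> i j = 0" if "i \<in> middle" "j \<in> middle" for i j
    using that middle_less Xe[of j i] by auto
  have nn: "n < 2 * n" by (rule middle_less[OF nm])
  have "(sp_unit n n n :: 'k mat) = 0\<^sub>m (2 * n) (2 * n)"
  proof (rule no_stab)
    show "sp_unit n n n \<in> ?q" using nn by (intro sp_unit_mem PQ) simp_all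
    fix i j assume ij: "i < 2 * n" "j < 2 * n" and nz: "(sp_unit n n n :: 'k mat) $$ (i, j) \<noteq> 0"
    have "i = n \<and> j = n \<or> i = mir n n \<and> j = mir n n"
      using nz unfolding sp_unit_entry[OF ij] by (auto split: if_splits)
    then show "i \<in> middle \<and> j \<in> middle" using nm mir_middle[OF nm] by auto
  qed (simp add: \<xi>0)
  then have "(sp_unit n n n :: 'k mat) $$ (n, n) = 0" using nn by simp
  then show False using nn unfolding sp_unit_entry[OF nn nn] by (auto simp: mir_def split: if_splits)
qed

text \<open>Completing the square: conjugation by \<open>exp u\<close>, with \<open>u\<close> in the mixed entries, changes the
coefficients of \<open>\<gamma>\<close> there by the image of \<open>u\<close> under the symmetric form
\<open>(v, w) \<mapsto> \<gamma> (sym_block n v w)\<close>. That form is nondegenerate, so \<open>u\<close> can be chosen such that all of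
these coefficients become zero.\<close>

lemma frobenius_form_reduce:
  fixes \<gamma> :: "'k::field_char_0 mat \<Rightarrow> 'k"
  assumes \<gamma>: "frobenius_form (2 * n) (cut_seaweed n P Q) \<gamma>"
  shows "\<exists>\<gamma>' :: 'k mat \<Rightarrow> 'k. frobenius_form (2 * n) (cut_seaweed n P Q) \<gamma>' \<and>
    (\<forall>i\<in>middle. \<forall>j\<in>outer. form_coeff n \<gamma>' i j = 0)"
proof -
  let ?q = "cut_seaweed n P Q :: 'k mat set"
  let ?\<xi> = "form_coeff n \<gamma>"
  have lf: "\<gamma> \<in> linear_forms ?q" using \<gamma> by (simp add: frobenius_form_def)
  have fo: "finite outer" by (rule finite_subset[of _ "{..<n}"]) (auto simp: extremal_indices_def)
  \<comment> \<open>Row \<open>i\<close> of \<open>u\<close> has to cancel the coefficients in the mirrored row \<open>mir n i\<close>.\<close>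
  have "\<exists>v. (\<forall>a. a \<notin> outer \<longrightarrow> v a = 0) \<and> (\<forall>j\<in>outer. (\<Sum>a\<in>outer. ?\<xi> (mir n a) j * v a) = half_sign n i * ?\<xi> (mir n i) j)" for i
  proof (rule linear_system_solvable[OF fo])
    fix v :: "nat \<Rightarrow> 'k" and a
    assume v: "\<And>j. j \<in> outer \<Longrightarrow> (\<Sum>a\<in>outer. ?\<xi> (mir n a) j * v a) = 0" and a: "a \<in> outer"
    define v' where "v' a = (if a \<in> outer then v a else 0)" for a
    have "v' a = 0"
    proof (rule sym_block_nondegenerate[OF \<gamma> PQ])
      fix w :: "nat \<Rightarrow> 'k" assume w: "\<And>i. i \<notin> outer \<Longrightarrow> w i = 0"
      have "(\<Sum>a\<in>outer. ?\<xi> (mir n a) j * v' a) = 0" if "j \<in> outer" for j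
        using v[OF that] by (simp add: v'_def cong: sum.cong)
      then show "\<gamma> (sym_block n v' w) = 0"
        by (subst form_sym_block[OF lf PQ]) (use w in \<open>simp_all add: v'_def\<close>)
    qed (simp add: v'_def)
    then show "v a = 0" using a by (simp add: v'_def)
  qed
  then obtain U where U0: "\<And>i a. a \<notin> outer \<Longrightarrow> U i a = 0"
    and U: "\<And>i j. j \<in> outer \<Longrightarrow> (\<Sum>a\<in>outer. ?\<xi> (mir n a) j * U i a) = half_sign n i * ?\<xi> (mir n i) j"
    by metis
  define u where "u = mat (2 * n) (2 * n) (\<lambda>(i, j). if i \<in> middle \<and> j \<in> outer then U i j
    else if mir n i \<in> outer \<and> j \<in> middle then half_sign n j * U (mir n j) (mir n i) else 0)"
  have uc: "u \<in> carrier_mat (2 * n) (2 * n)" by (simp add: u_def)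
  have ue: "u $$ (i, j) = (if i \<in> middle \<and> j \<in> outer then U i j
    else if mir n i \<in> outer \<and> j \<in> middle then half_sign n j * U (mir n j) (mir n i) else 0)"
    if "i < 2 * n" "j < 2 * n" for i j using that by (simp add: u_def)
  have us: "i \<in> middle \<and> j \<in> outer \<or> mir n i \<in> outer \<and> j \<in> middle"
    if "i < 2 * n" "j < 2 * n" "u $$ (i, j) \<noteq> 0" for i j
    using that by (auto simp: ue split: if_splits)
  have uus: "mir n i \<in> outer \<and> j \<in> outer" if ij: "i < 2 * n" "j < 2 * n" and nz: "(u * u) $$ (i, j) \<noteq> 0" for i j
  proof (rule ccontr)
    assume no: "\<not> (mir n i \<in> outer \<and> j \<in> outer)"
    have "u $$ (i, k) * u $$ (k, j) = 0" if k: "k < 2 * n" for k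
    proof (rule ccontr)
      assume "u $$ (i, k) * u $$ (k, j) \<noteq> 0"
      then have "i \<in> middle \<and> k \<in> outer \<or> mir n i \<in> outer \<and> k \<in> middle"
        "k \<in> middle \<and> j \<in> outer \<or> mir n k \<in> outer \<and> j \<in> middle"
        using us[OF ij(1) k] us[OF k ij(2)] by auto
      then show False using no outer_not_middle mir_outer_not_middle[OF _ k] outer_less[of k] outer_less[of "mir n k"]
          mir_less_half_iff[OF k] by auto
    qed
    then have "(\<Sum>k<2 * n. u $$ (i, k) * u $$ (k, j)) = 0" by (intro sum.neutral) auto
    then show False using nz unfolding mult_mat_entry[OF uc uc ij] by simp
  qed
  have cube: "u * u * u = 0\<^sub>m (2 * n) (2 * n)"
  proof (rule mult_zero_of_support)
    fix i k j assume ikj: "i < 2 * n" "k < 2 * n" "j < 2 * n" "(u * u) $$ (i, k) \<noteq> 0" "u $$ (k, j) \<noteq> 0"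
    then show False using uus[of i k] us[of k j] outer_not_middle outer_less[of k] outer_less[of "mir n k"]
        mir_less_half_iff[of k n] by auto
  qed (use uc in auto)
  have uadj: "symp_adjoint n u = (- 1) \<cdot>\<^sub>m u"
  proof (rule eq_matI)
    fix i j assume "i < dim_row ((- 1) \<cdot>\<^sub>m u)" "j < dim_col ((- 1) \<cdot>\<^sub>m u)"
    then have ij: "i < 2 * n" "j < 2 * n" using uc by auto
    have mm: "mir n k \<in> middle \<longleftrightarrow> k \<in> middle" if "k < 2 * n" for k
      using mir_middle[of k] mir_middle[of "mir n k"] that by auto
    have e: "u $$ (mir n j, mir n i) = (if j \<in> middle \<and> mir n i \<in> outer then U (mir n j) (mir n i)
        else if j \<in> outer \<and> i \<in> middle then - (half_sign n i * U i j) else 0)"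
      using ij by (simp add: ue mm)
    have "half_sign n i * half_sign n j * u $$ (mir n j, mir n i) = - u $$ (i, j)"
    proof -
      consider "i \<in> middle \<and> j \<in> outer" | "mir n i \<in> outer \<and> j \<in> middle"
        | "\<not> (i \<in> middle \<and> j \<in> outer)" "\<not> (mir n i \<in> outer \<and> j \<in> middle)" by blast
      then show ?thesis
      proof cases
        case 1
        then have "half_sign n j = (1 :: 'k)" using outer_less by (simp add: half_sign_def)
        then show ?thesis unfolding e ue[OF ij] using 1 outer_not_middle by auto
      next
        case 2
        then have "half_sign n i = (- 1 :: 'k)"
          using outer_less mir_less_half_iff[OF ij(1)] by (auto simp: half_sign_def)
        then show ?thesis unfolding e ue[OF ij] using 2 outer_not_middle by auto
      next
        case 3
        then show ?thesis unfolding e ue[OF ij] by auto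
      qed
    qed
    then show "symp_adjoint n u $$ (i, j) = ((- 1) \<cdot>\<^sub>m u) $$ (i, j)" using ij uc by simp
  qed (use uc in \<open>simp_all add: symp_adjoint_def\<close>)
  have ua: "u \<in> cut_algebra n P Q"
  proof -
    have "cut_order n P Q i j" if ij: "i < 2 * n" "j < 2 * n" "u $$ (i, j) \<noteq> 0" for i j
      using us[OF ij]
    proof
      assume "i \<in> middle \<and> j \<in> outer"
      then show ?thesis by (intro cut_order_middleI) auto
    next
      assume ij': "mir n i \<in> outer \<and> j \<in> middle"
      then have "cut_order n P Q (mir n (mir n i)) (mir n (mir n j))"
        using ij by (intro cut_order_mir PQ cut_order_middleI mir_middle) auto
      then show ?thesis using ij by simp
    qed
    then show ?thesis using uc by (auto simp: cut_algebra_def)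
  qed
  have ea: "exp_mat (2 * n) v \<in> cut_algebra n P Q" if "v \<in> cut_algebra n P Q" for v :: "'k mat"
    unfolding exp_mat_def using that by (intro cut_algebra_linear cut_algebra_mult)
  define g where "g = exp_mat (2 * n) u"
  define h where "h = exp_mat (2 * n) ((- 1) \<cdot>\<^sub>m u)"
  have u'a: "(- 1) \<cdot>\<^sub>m u \<in> cut_algebra n P Q" by (rule cut_algebra_linear(2)[OF ua ua])
  have u'c: "(- 1) \<cdot>\<^sub>m u \<in> carrier_mat (2 * n) (2 * n)" using uc by simp
  have uu: "(- 1) \<cdot>\<^sub>m ((- 1) \<cdot>\<^sub>m u) = u" using uc by (intro eq_matI) auto
  have sq: "(- 1) \<cdot>\<^sub>m u * ((- 1) \<cdot>\<^sub>m u) = u * u"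
    using uc by (simp add: mult_smult_distrib[of _ "2 * n" "2 * n" u "2 * n"]
        mult_smult_assoc_mat[of u "2 * n" "2 * n" _ "2 * n"] smult_smult_mat one_smult_mat)
  have cube': "(- 1) \<cdot>\<^sub>m u * ((- 1) \<cdot>\<^sub>m u) * ((- 1) \<cdot>\<^sub>m u) = 0\<^sub>m (2 * n) (2 * n)"
    unfolding sq using uc cube by (simp add: mult_smult_distrib[of _ "2 * n" "2 * n" u "2 * n"])
  have gh: "g * h = 1\<^sub>m (2 * n)" unfolding g_def h_def by (rule exp_mat_inverse[OF uc cube])
  have hg: "h * g = 1\<^sub>m (2 * n)" using exp_mat_inverse[OF u'c cube'] unfolding uu g_def h_def .
  have uadj': "symp_adjoint n ((- 1) \<cdot>\<^sub>m u) = u"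
  proof -
    have "symp_adjoint n ((- 1) \<cdot>\<^sub>m u) = (- 1) \<cdot>\<^sub>m symp_adjoint n u"
      using uc by (intro eq_matI) (auto simp: symp_adjoint_def)
    then show ?thesis unfolding uadj uu .
  qed
  have adj: "symp_adjoint n g = h" "symp_adjoint n h = g"
    unfolding g_def h_def symp_adjoint_exp_mat[OF uc] symp_adjoint_exp_mat[OF u'c] uadj uadj' by simp_all
  define \<gamma>' where "\<gamma>' = \<gamma> \<circ> (\<lambda>y. g * y * h)"
  have \<gamma>': "frobenius_form (2 * n) ?q \<gamma>'"
    unfolding \<gamma>'_def
    by (rule frobenius_form_conjugate[OF \<gamma> _ _ gh hg adj]) (simp_all add: g_def h_def ea ua u'a)
  have gc: "g \<in> carrier_mat (2 * n) (2 * n)" and hc: "h \<in> carrier_mat (2 * n) (2 * n)"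
    using uc by (auto simp: g_def h_def exp_mat_def)
  have ge: "g $$ (i, j) = (if i = j then 1 else 0) + (u $$ (i, j) + (u * u) $$ (i, j) / 2)"
    if "i < 2 * n" "j < 2 * n" for i j
    using that uc by (simp add: g_def exp_mat_def del: index_mult_mat(1))
  have he: "h $$ (i, j) = (if i = j then 1 else 0) + (- u $$ (i, j) + (u * u) $$ (i, j) / 2)"
    if "i < 2 * n" "j < 2 * n" for i j
    using that uc unfolding h_def exp_mat_def sq by (simp del: index_mult_mat(1))
  have "form_coeff n \<gamma>' k l = 0" if k: "k \<in> middle" and l: "l \<in> outer" for k l
  proof -
    have kl: "k < 2 * n" "l < 2 * n" "l < n" using middle_less[OF k] outer_less[OF l] by auto
    have mk: "mir n k \<in> middle" "mir n (mir n k) = k" using mir_middle[OF k] kl by auto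
    have hl: "half_sign n l = (1 :: 'k)" using kl by (simp add: half_sign_def)
    define \<delta> :: "nat \<Rightarrow> 'k" where "\<delta> j = (if j = l then 1 else 0)" for j
    have ml: "mir n (mir n l) = l" "mir n l < 2 * n" "\<not> mir n l < n" using kl by (auto simp: mir_def)
    have \<delta>0: "\<delta> j = 0" if "j \<notin> outer" for j using that l by (auto simp: \<delta>_def)
    have E: "(sp_unit n k l :: 'k mat) \<in> ?q" using kl k l by (intro sp_unit_mem PQ cut_order_middleI) auto
    have D: "sym_block n (U (mir n k)) \<delta> \<in> ?q" by (rule sym_block_mem[OF _ _ PQ]) (auto simp: U0 \<delta>0)
    \<comment> \<open>Products with three factors from the mixed entries vanish, so only the commutator with \<open>u\<close> remains.\<close>
    have "g * sp_unit n k l * h = sp_unit n k l + half_sign n k \<cdot>\<^sub>m sym_block n (U (mir n k)) \<delta>"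
    proof (rule eq_matI)
      fix i j assume "i < dim_row (sp_unit n k l + half_sign n k \<cdot>\<^sub>m sym_block n (U (mir n k)) \<delta>)"
        "j < dim_col (sp_unit n k l + half_sign n k \<cdot>\<^sub>m sym_block n (U (mir n k)) \<delta>)"
      then have ij: "i < 2 * n" "j < 2 * n" by auto
      have g1: "g $$ (i, k) = (if i = k then 1 else 0) + half_sign n k * U (mir n k) (mir n i)"
      proof -
        have "(u * u) $$ (i, k) = 0" using uus[OF ij(1) kl(1)] k outer_not_middle by blast
        moreover have "u $$ (i, k) = half_sign n k * U (mir n k) (mir n i)"
          unfolding ue[OF ij(1) kl(1)] using k U0 outer_not_middle by auto
        ultimately show ?thesis by (simp add: ge[OF ij(1) kl(1)])
      qed
      have h1: "h $$ (l, j) = \<delta> j"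
      proof -
        have nl: "mir n l \<notin> outer" using outer_less ml by blast
        have "(u * u) $$ (l, j) = 0" using uus[OF kl(2) ij(2)] nl by blast
        moreover have "u $$ (l, j) = 0" using us[OF kl(2) ij(2)] nl outer_not_middle[OF l] by blast
        ultimately show ?thesis by (auto simp: he[OF kl(2) ij(2)] \<delta>_def)
      qed
      have nl: "mir n l \<notin> outer" "mir n l \<notin> middle"
        using outer_less ml mir_middle[of "mir n l"] outer_not_middle[OF l] by auto
      have g2: "g $$ (i, mir n l) = \<delta> (mir n i)"
      proof -
        have "(u * u) $$ (i, mir n l) = 0" using uus[OF ij(1) ml(2)] nl by blast
        moreover have "u $$ (i, mir n l) = 0" using us[OF ij(1) ml(2)] nl by blast
        ultimately show ?thesis using mir_swap[OF ij(1) kl(2)] by (simp add: ge[OF ij(1) ml(2)] \<delta>_def)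
      qed
      have h2: "h $$ (mir n k, j) = (if j = mir n k then 1 else 0) - U (mir n k) j"
      proof -
        have mk2: "mir n k < 2 * n" using kl by simp
        have "(u * u) $$ (mir n k, j) = 0" using uus[OF mk2 ij(2)] mk k outer_not_middle by auto
        moreover have "u $$ (mir n k, j) = U (mir n k) j"
          unfolding ue[OF mk2 ij(2)] using mk k U0 outer_not_middle by auto
        ultimately show ?thesis by (auto simp: he[OF mk2 ij(2)])
      qed
      have "(sp_unit n k l :: 'k mat) $$ (i, j) = (if i = k then \<delta> j else 0) - (if j = mir n k then half_sign n k * \<delta> (mir n i) else 0)"
      proof -
        have split: "(if A \<and> B then 1 else 0) - (if C \<and> D then s else 0) =
            (if A then if B then 1 else 0 else 0) - (if D then s * (if C then 1 else 0) else 0)"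
          for A B C D and s :: 'k by (cases A; cases B; cases C; cases D) auto
        show ?thesis unfolding sp_unit_entry[OF ij] split \<delta>_def mir_swap[OF ij(1) kl(2)] hl mult_1_right by simp
      qed
      then show "(g * sp_unit n k l * h) $$ (i, j) = (sp_unit n k l + half_sign n k \<cdot>\<^sub>m sym_block n (U (mir n k)) \<delta>) $$ (i, j)"
        unfolding conjugate_sp_unit[OF gc hc kl(1,2) ij] g1 h1 g2 h2 hl using ij
        by (simp add: scalar_simps del: sp_unit_entry)
    qed (use gc hc in auto)
    then have "\<gamma>' (sp_unit n k l) = \<gamma> (sp_unit n k l + half_sign n k \<cdot>\<^sub>m sym_block n (U (mir n k)) \<delta>)"
      by (simp add: \<gamma>'_def)
    also have "\<dots> = \<gamma> (sp_unit n k l) + half_sign n k * \<gamma> (sym_block n (U (mir n k)) \<delta>)"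
      using cut_seaweed_lie_algebra[of n P Q, where 'k='k] E D
      by (simp add: linear_formsD[OF lf] mat_lie_algebra_def)
    also have "\<gamma> (sym_block n (U (mir n k)) \<delta>) = 2 * (\<Sum>j\<in>outer. (\<Sum>a\<in>outer. ?\<xi> (mir n a) j * U (mir n k) a) * \<delta> j)"
      by (rule form_sym_block[OF lf PQ]) (auto simp: U0 \<delta>0)
    also have "(\<Sum>j\<in>outer. (\<Sum>a\<in>outer. ?\<xi> (mir n a) j * U (mir n k) a) * \<delta> j)
        = (\<Sum>j\<in>outer. if j = l then half_sign n (mir n k) * ?\<xi> (mir n (mir n k)) j else 0)"
      by (intro sum.cong refl) (simp add: U \<delta>_def)
    also have "\<dots> = - (half_sign n k * ?\<xi> k l)"
      using fo l kl by simp
    finally show ?thesis by (simp add: form_coeff_def)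
  qed
  then show ?thesis using \<gamma>' by (intro exI[of _ \<gamma>'] conjI ballI)
qed

end

text \<open>Transposition allows to assume that the last cut in \<open>Q\<close> is not before the last cut in \<open>P\<close>.\<close>

lemma not_frobenius_if_neither_full:
  fixes P Q :: "nat set"
  assumes n: "n \<ge> 1" and PQ: "P \<subseteq> {..n}" "Q \<subseteq> {..n}" and nP: "n \<notin> P" and nQ: "n \<notin> Q"
  shows "\<not> frobenius (2 * n) (cut_seaweed n P Q :: 'k::field_char_0 mat set)"
proof -
  have main: "\<not> frobenius (2 * n) (cut_seaweed n A B :: 'k mat set)"
    if AB: "A \<subseteq> {..n}" "B \<subseteq> {..n}" "n \<notin> B" and below: "\<And>p. p \<in> A \<Longrightarrow> p = 0 \<or> (\<exists>r\<in>B. p \<le> r)" for A B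
  proof
    assume "frobenius (2 * n) (cut_seaweed n A B :: 'k mat set)"
    then obtain \<gamma> :: "'k mat \<Rightarrow> 'k" where "frobenius_form (2 * n) (cut_seaweed n A B) \<gamma>"
      unfolding frobenius_cut_seaweed_iff by blast
    from frobenius_form_reduce[OF AB(1,2) below this] obtain \<gamma>' :: "'k mat \<Rightarrow> 'k"
      where \<gamma>': "frobenius_form (2 * n) (cut_seaweed n A B) \<gamma>'"
        "\<forall>i\<in>middle n B. \<forall>j\<in>extremal_indices n A B. form_coeff n \<gamma>' i j = 0" by blast
    have "p < n" if "p \<in> B" for p using that AB(2,3) by (metis atMost_iff le_neq_implies_less subsetD)
    then have "n \<in> middle n B" using n by (fastforce simp: middle_def[OF AB(1,2) below])
    with \<gamma>' show False by (intro no_frobenius_form_if_reduced[OF AB(1,2) below \<gamma>'(1)]) auto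
  qed
  have fin: "finite P" "finite Q" using PQ finite_subset by auto
  show ?thesis
  proof (cases "Max (insert 0 P) \<le> Max (insert 0 Q)")
    case True
    have "p = 0 \<or> (\<exists>r\<in>Q. p \<le> r)" if "p \<in> P" for p
    proof -
      have "p \<le> Max (insert 0 Q)" using True that fin by (meson Max_ge finite_insert insertI2 le_trans)
      moreover have "Max (insert 0 Q) \<in> insert 0 Q" using fin by (intro Max_in) auto
      ultimately show ?thesis by auto
    qed
    then show ?thesis using main[OF PQ nQ] by blast
  next
    case False
    have "p = 0 \<or> (\<exists>r\<in>P. p \<le> r)" if "p \<in> Q" for p
    proof -
      have "p \<le> Max (insert 0 P)" using False that fin
        by (meson Max_ge finite_insert insertI2 le_trans nat_le_linear)
      moreover have "Max (insert 0 P) \<in> insert 0 P" using fin by (intro Max_in) auto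
      ultimately show ?thesis by auto
    qed
    then have "\<not> frobenius (2 * n) (cut_seaweed n Q P :: 'k mat set)" using main[OF PQ(2,1) nP] by blast
    then show ?thesis using frobenius_cut_seaweed_swap by blast
  qed
qed

section \<open>A Frobenius seaweed outside the image of the extension\<close>

lemma bracket_sp_unit_entry:
  fixes x :: "'k::field mat"
  assumes x: "x \<in> carrier_mat (2 * n) (2 * n)" and pq: "p < 2 * n" "q < 2 * n" and ij: "i < 2 * n" "j < 2 * n"
  shows "lie_bracket x (sp_unit n p q) $$ (i, j) =
    ((if j = q then x $$ (i, p) else 0) - (if j = mir n p then half_sign n p * half_sign n q * x $$ (i, mir n q) else 0))
    - ((if i = p then x $$ (q, j) else 0) - (if i = mir n q then half_sign n p * half_sign n q * x $$ (mir n p, j) else 0))"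
proof -
  have "lie_bracket x (sp_unit n p q) $$ (i, j) = (x * sp_unit n p q) $$ (i, j) - (sp_unit n p q * x) $$ (i, j)"
    using x ij by (simp add: lie_bracket_def del: index_mult_mat(1))
  then show ?thesis unfolding mult_sp_unit_right[OF x pq ij] mult_sp_unit_left[OF x pq ij] .
qed

text \<open>The lower half of the meander graph consists of arcs joining \<open>i\<close> with \<open>n - 1 - i\<close>. Above the line the
first \<open>m\<close> vertices have no arc and the others lie on central arcs, so that every component of the
graph is symmetric and contains one central arc. The form is the sum of one entry for
each pair of mirrored lower arcs and for each central arc. Writing an element as a block \<open>A\<close> in the upper left and a symmetric block \<open>S\<close> in the lower
left corner, the stabiliser equations say that the lower right part of \<open>A\<close> is skew and that
reflection of the indices maps it to the upper left part; the latter is upper triangular and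
therefore zero. What remains is a symmetric array with zeros on one side of its diagonal.\<close>

lemma frobenius_staircase:
  assumes m: "m = n div 2"
  shows "frobenius (2 * n) (cut_seaweed n {1..m} {n} :: 'k::field_char_0 mat set)"
proof -
  let ?q = "cut_seaweed n {1..m} {n} :: 'k mat set"
  define \<gamma> :: "'k mat \<Rightarrow> 'k" where
    "\<gamma> z = (\<Sum>i<m. z $$ (i, n - 1 - i)) + (\<Sum>k\<in>{m..<n}. z $$ (mir n k, k))" for z
  have mn: "2 * m \<le> n" "n \<le> 2 * m + 1" using m by auto
  have PQ: "{1..m} \<subseteq> {..n}" "{n} \<subseteq> {..n}" using mn by auto
  have lf: "\<gamma> \<in> linear_forms ?q"
    unfolding linear_forms_def
  proof (intro CollectI conjI ballI allI)
    fix x y :: "'k mat" and c :: 'k assume x: "x \<in> ?q"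
    note xc = cut_seaweedD(1)[OF x]
    have "(c \<cdot>\<^sub>m x) $$ (i, n - 1 - i) = c * x $$ (i, n - 1 - i)" if "i < m" for i
      using that xc mn by simp
    moreover have "(c \<cdot>\<^sub>m x) $$ (mir n k, k) = c * x $$ (mir n k, k)" if "k < n" for k
      using that xc by simp
    ultimately show "\<gamma> (c \<cdot>\<^sub>m x) = c * \<gamma> x"
      by (simp add: \<gamma>_def sum_distrib_left distrib_left)
    assume y: "y \<in> ?q"
    note yc = cut_seaweedD(1)[OF y]
    have "(x + y) $$ (i, n - 1 - i) = x $$ (i, n - 1 - i) + y $$ (i, n - 1 - i)" if "i < m" for i
      using that xc yc mn by simp
    moreover have "(x + y) $$ (mir n k, k) = x $$ (mir n k, k) + y $$ (mir n k, k)" if "k < n" for k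
      using that xc yc by simp
    ultimately show "\<gamma> (x + y) = \<gamma> x + \<gamma> y"
      by (simp add: \<gamma>_def sum.distrib)
  qed
  have "frobenius_form (2 * n) ?q \<gamma>"
  proof (rule frobenius_formI[OF cut_seaweed_lie_algebra lf])
    fix x assume x: "x \<in> ?q" and st: "\<And>y. y \<in> ?q \<Longrightarrow> \<gamma> (lie_bracket x y) = 0"
    note xc = cut_seaweedD(1)[OF x]
    define A where "A i j = x $$ (i, j)" for i j
    define S where "S i j = x $$ (mir n i, j)" for i j
    have mlt: "mir n i < 2 * n" "\<not> mir n i < n" "n \<le> mir n i" "mir n (mir n i) = i" "mir n i \<noteq> j" "j \<noteq> mir n i"
      if "i < n" "j < n" for i j
      using that by (auto simp: mir_def)
    have S_sym: "S q p = S p q" if "p < n" "q < n" for p q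
      using cut_seaweedD(2)[OF x, of "mir n q" p] that by (simp add: S_def half_sign_def mlt)
    have D: "x $$ (mir n q, mir n p) = - A p q" if "p < n" "q < n" for p q
      using cut_seaweedD(2)[OF x, of p q] that by (simp add: A_def half_sign_def)
    have B0: "x $$ (p, mir n q) = 0" if "p < n" "q < n" for p q
      using that mlt[OF that(2,1)] by (intro cut_seaweedD(3)[OF x]) (auto simp: cut_order_def)
    have A0: "A i j = 0" if "i < n" "j < n" "j < i" "j < m" for i j
    proof -
      have "\<not> cut_order n {1..m} {n} i j"
        using that by (auto simp: cut_order_def intro!: bexI[of _ "Suc j"])
      then show ?thesis unfolding A_def using that by (intro cut_seaweedD(3)[OF x]) auto
    qed
    have S0: "S p q = 0" if "p < n" "q < m" for p q
    proof -
      have "\<not> cut_order n {1..m} {n} (mir n p) q"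
        using that mn mlt(3)[OF that(1), of 0] by (auto simp: cut_order_def intro!: bexI[of _ "Suc q"])
      then show ?thesis unfolding S_def using that mn by (intro cut_seaweedD(3)[OF x]) auto
    qed
    have hs1: "half_sign n i = (1 :: 'k)" if "i < n" for i using that by (simp add: half_sign_def)
    \<comment> \<open>The equations from the lower left corner.\<close>
    have skew: "A p q + A q p = 0" if p: "m \<le> p" "p < n" and q: "m \<le> q" "q < n" for p q
    proof -
      define u :: "'k mat" where "u = sp_unit n (mir n p) q"
      have ord: "cut_order n {1..m} {n} (mir n p) q"
        using p q by (auto simp: cut_order_def mir_def)
      have "u \<in> ?q" unfolding u_def using p q by (intro sp_unit_mem[OF _ _ ord PQ]) auto
      then have "\<gamma> (lie_bracket x u) = 0" by (rule st)
      moreover have "lie_bracket x u $$ (i, n - 1 - i) = 0" if "i < m" for i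
      proof -
        have i: "i < n" "n - 1 - i < n" using that mn by auto
        have "mir n i \<noteq> i" using i by (auto simp: mir_def)
        then show ?thesis unfolding u_def using p q i
          by (subst bracket_sp_unit_entry[OF xc]) (simp_all add: B0 mlt)
      qed
      moreover have "lie_bracket x u $$ (mir n k, k) =
          ((if k = q then - A p q else 0) + (if k = p then - A q p else 0)) - ((if k = p then A q p else 0) + (if k = q then A p q else 0))"
        if k: "k < n" for k
        unfolding u_def using p q k
        by (subst bracket_sp_unit_entry[OF xc]) (simp_all add: hs1 mlt A_def D[unfolded A_def])
      ultimately have "(\<Sum>k\<in>{m..<n}. ((if k = q then - A p q else 0) + (if k = p then - A q p else 0))
          - ((if k = p then A q p else 0) + (if k = q then A p q else 0))) = 0"
        by (simp add: \<gamma>_def)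
      then have "- A p q - A q p - (A q p + A p q) = 0"
        using p q by (simp add: sum_subtractf sum.distrib)
      then have "- A q p = A p q" by simp
      then show ?thesis by (metis add.left_inverse)
    qed
    \<comment> \<open>The equations from the upper left corner.\<close>
    have eq: "(if n - 1 - q < m then A (n - 1 - q) p else 0) + (if m \<le> q then 2 * S p q else 0)
        = (if p < m then A q (n - 1 - p) else 0)"
      if p: "p < n" and q: "q < n" and pq: "p \<le> q \<or> m \<le> q" for p q
    proof -
      define u :: "'k mat" where "u = sp_unit n p q"
      have ord: "cut_order n {1..m} {n} p q"
        using p q pq by (auto simp: cut_order_def)
      have "u \<in> ?q" unfolding u_def using p q by (intro sp_unit_mem[OF _ _ ord PQ]) auto
      then have "\<gamma> (lie_bracket x u) = 0" by (rule st)
      moreover have "lie_bracket x u $$ (i, n - 1 - i) =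
          (if i = n - 1 - q then A (n - 1 - q) p else 0) - (if i = p then A q (n - 1 - p) else 0)" if "i < m" for i
      proof -
        have i: "i < n" "n - 1 - i < n" using that mn by auto
        have e: "n - 1 - i = q \<longleftrightarrow> i = n - 1 - q" using i q by auto
        show ?thesis unfolding u_def using p q i
          by (subst bracket_sp_unit_entry[OF xc]) (auto simp: e mlt A_def)
      qed
      moreover have "lie_bracket x u $$ (mir n k, k) =
          (if k = q then S q p else 0) + (if k = q then S p q else 0)"
        if k: "k < n" for k
      proof -
        show ?thesis unfolding u_def using p q k
          by (subst bracket_sp_unit_entry[OF xc]) (simp_all add: hs1 mlt S_def)
      qed
      ultimately have "(\<Sum>i<m. (if i = n - 1 - q then A (n - 1 - q) p else 0) - (if i = p then A q (n - 1 - p) else 0))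
          + (\<Sum>k\<in>{m..<n}. (if k = q then S q p else 0) + (if k = q then S p q else 0)) = 0"
        by (simp add: \<gamma>_def)
      then have "(if n - 1 - q < m then A (n - 1 - q) p else 0) - (if p < m then A q (n - 1 - p) else 0)
          + ((if m \<le> q then S q p else 0) + (if m \<le> q then S p q else 0)) = 0"
        using q by (simp add: sum_subtractf sum.distrib)
      then show ?thesis using S_sym[OF p q] by (auto simp: algebra_simps split: if_splits)
    qed
    have step1: "A q (n - 1 - p) = 0" if "p \<le> q" "q < m" for p q
    proof -
      have "\<not> n - 1 - q < m" "\<not> m \<le> q" "p < m" "p < n" "q < n" using that mn by auto
      then show ?thesis using eq[of p q] that by simp
    qed
    have step2: "A q (n - 1 - p) = (if n - 1 - q < m then A (n - 1 - q) p else 0)"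
      if "p < m" "m \<le> q" "q < n" for p q
    proof -
      have "S q p = 0" by (rule S0) (use that mn in auto)
      then have "S p q = 0" using S_sym[of p q] that mn by auto
      then show ?thesis using eq[of p q] that mn by simp
    qed
    have refl: "A (n - 1 - r) (n - 1 - p) = A r p" if "r < m" "p < m" for r p
      using step2[of p "n - 1 - r"] that mn by simp
    \<comment> \<open>Both skew and upper triangular.\<close>
    have A1: "A r p = 0" if "r < m" "p < m" for r p
    proof -
      have sk: "A r p + A p r = 0" if "r < m" "p < m" for r p
        using skew[of "n - 1 - r" "n - 1 - p"] refl[OF that] refl[OF that(2,1)] that mn by auto
      consider "p < r" | "r < p" | "r = p" by linarith
      then show ?thesis
      proof cases
        case 1 then show ?thesis using A0 that mn by auto
      next
        case 2 then show ?thesis using A0[of p r] sk[OF that] that mn by auto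
      next
        case 3 then show ?thesis using sk[OF that] by simp
      qed
    qed
    have A2: "A q (n - 1 - p) = 0" if "p < m" "m \<le> q" "q < n" for p q
      using step2[OF that] A1[of "n - 1 - q" p] that by auto
    have A3: "A p q = 0" if "m \<le> p" "p < n" "m \<le> q" "q < n" for p q
    proof (cases "n - 1 - q < m")
      case True
      then show ?thesis using A2[of "n - 1 - q" p] that by simp
    next
      case q: False
      show ?thesis
      proof (cases "n - 1 - p < m")
        case True
        then have "A q p = 0" using A2[of "n - 1 - p" q] that by simp
        then show ?thesis using skew[OF that] by simp
      next
        case False
        then have "p = q" using q that mn by linarith
        then show ?thesis using skew[OF that] by simp
      qed
    qed
    have S1: "S p q = 0" if "m \<le> p" "p < n" "m \<le> q" "q < n" "\<not> n - 1 - q < m" for p q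
      using eq[of p q] that by simp
    have AS: "A (n - 1 - q) p = - 2 * S p q" if "m \<le> p" "p < n" "m \<le> q" "q < n" "n - 1 - q < m" for p q
      using eq[of p q] that by (simp add: eq_neg_iff_add_eq_0)
    \<comment> \<open>By the symmetry of \<open>S\<close> these entries are symmetric under exchanging both indices with reflection, and half of them vanish by \<open>step1\<close>.\<close>
    have A4: "A i q = 0" if "i < m" "m \<le> q" "q < n" for i q
    proof (cases "n - 1 - q < m")
      case False
      have "S q (n - 1 - i) = S (n - 1 - i) q" using S_sym[of q "n - 1 - i"] that mn by auto
      also have "\<dots> = 0" using S1[of "n - 1 - i" q] that False mn by auto
      finally show ?thesis using AS[of q "n - 1 - i"] that mn by auto
    next
      case True
      have swap: "A i q = A (n - 1 - q) (n - 1 - i)"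
        using AS[of q "n - 1 - i"] AS[of "n - 1 - i" q] S_sym[of q "n - 1 - i"] that True mn by auto
      show ?thesis
      proof (cases "n - 1 - q \<le> i")
        case le: True
        then show ?thesis using step1[of "n - 1 - q" i] that by simp
      next
        case False
        then show ?thesis unfolding swap using step1[of i "n - 1 - q"] True by simp
      qed
    qed
    have A: "A i j = 0" if "i < n" "j < n" for i j
      using A0[of i j] A1[of i j] A3[of i j] A4[of i j] that by (cases "i < m"; cases "j < m") auto
    have S: "S i j = 0" if ij: "i < n" "j < n" for i j
    proof -
      have *: "S p q = 0" if "p < n" "q < n" "m \<le> p" "m \<le> q" for p q
        using S1[of p q] AS[of p q] A4[of "n - 1 - q" p] that by (cases "n - 1 - q < m") auto
      show ?thesis using *[of i j] S0[of i j] S0[of j i] S_sym[OF ij] ij by (cases "i < m"; cases "j < m") auto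
    qed
    show "x = 0\<^sub>m (2 * n) (2 * n)"
    proof (rule eq_matI)
      fix i j assume "i < dim_row (0\<^sub>m (2 * n) (2 * n) :: 'k mat)" "j < dim_col (0\<^sub>m (2 * n) (2 * n) :: 'k mat)"
      then have ij: "i < 2 * n" "j < 2 * n" by auto
      have low: "mir n k < n" "mir n (mir n k) = k" if "\<not> k < n" "k < 2 * n" for k
        using that by (auto simp: mir_def)
      have "x $$ (i, j) = 0"
      proof (cases "i < n"; cases "j < n")
        assume "i < n" "j < n" then show ?thesis using A by (simp add: A_def)
      next
        assume "i < n" "\<not> j < n" then show ?thesis using B0[of i "mir n j"] low[of j] ij by simp
      next
        assume "\<not> i < n" "j < n" then show ?thesis using S[of "mir n i" j] low[of i] ij by (simp add: S_def)
      next
        assume "\<not> i < n" "\<not> j < n"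
        then show ?thesis using D[of "mir n j" "mir n i"] A[of "mir n j" "mir n i"] low[of i] low[of j] ij by simp
      qed
      then show "x $$ (i, j) = 0\<^sub>m (2 * n) (2 * n) $$ (i, j)" using ij by simp
    qed (use xc in auto)
  qed
  then show ?thesis unfolding frobenius_cut_seaweed_iff by blast
qed

section \<open>Compositions and their partial sums\<close>

text \<open>The partial sum \<open>0\<close> is left out because a cut there imposes no condition.\<close>

definition cuts :: "nat list \<Rightarrow> nat set" where
  "cuts a = (\<lambda>r. sum_list (take r a)) ` {1..length a}"

lemma cuts_Nil [simp]: "cuts [] = {}"
  by (simp add: cuts_def)

lemma cuts_snoc: "cuts (a @ [x]) = insert (sum_list a + x) (cuts a)"
proof -
  have "cuts (a @ [x]) = (\<lambda>r. sum_list (take r (a @ [x]))) ` insert (Suc (length a)) {1..length a}"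
    by (simp add: cuts_def atLeastAtMostSuc_conv)
  also have "\<dots> = insert (sum_list a + x) ((\<lambda>r. sum_list (take r (a @ [x]))) ` {1..length a})" by simp
  also have "(\<lambda>r. sum_list (take r (a @ [x]))) ` {1..length a} = cuts a"
    unfolding cuts_def by (intro image_cong) auto
  finally show ?thesis .
qed

lemma cuts_subset: "comp_le n a \<Longrightarrow> cuts a \<subseteq> {1..n}"
proof (induction a rule: rev_induct)
  case (snoc x a)
  then have "comp_le n a" "0 < x" "sum_list a + x \<le> n" by (auto simp: comp_le_def)
  then show ?case using snoc.IH by (auto simp: cuts_snoc)
qed simp

lemma full_cuts_iff:
  assumes "comp_le n a" "n \<ge> 1"
  shows "n \<in> cuts a \<longleftrightarrow> sum_list a = n"
proof (cases a rule: rev_cases)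
  case (snoc b x)
  have b: "comp_le (n - 1) b" using assms snoc by (auto simp: comp_le_def)
  have "n \<notin> cuts b" using cuts_subset[OF b] assms(2) by auto
  then show ?thesis using snoc by (auto simp: cuts_snoc)
qed (use assms in auto)

lemma ex_composition_with_cuts:
  assumes "P \<subseteq> {1..n}"
  shows "\<exists>a. comp_le n a \<and> cuts a = P"
  using assms
proof (induction n arbitrary: P)
  case 0
  then show ?case by (intro exI[of _ "[]"]) (auto simp: comp_le_def)
next
  case (Suc n)
  have "P - {Suc n} \<subseteq> {1..n}" using Suc.prems by auto
  then obtain a where a: "comp_le n a" "cuts a = P - {Suc n}" using Suc.IH by blast
  show ?case
  proof (cases "Suc n \<in> P")
    case True
    then show ?thesis using a
      by (intro exI[of _ "a @ [Suc n - sum_list a]"]) (auto simp: comp_le_def cuts_snoc)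
  next
    case False
    then show ?thesis using a by (intro exI[of _ a]) (auto simp: comp_le_def)
  qed
qed

lemma sum_list_take_mono: "r \<le> s \<Longrightarrow> sum_list (take r c) \<le> (sum_list (take s c) :: nat)"
proof (rule lift_Suc_mono_le[of "\<lambda>r. sum_list (take r c)"])
  show "sum_list (take r c) \<le> sum_list (take (Suc r) c)" for r
    by (cases "r < length c") (simp_all add: take_Suc_conv_app_nth)
qed

lemma ex_block:
  assumes "i < sum_list c"
  obtains r where "r < length c" "i \<in> block c r"
proof -
  define t where "t = (LEAST t. i < sum_list (take t c))"
  have ex: "i < sum_list (take (length c) c)" using assms by simp
  have t: "i < sum_list (take t c)" unfolding t_def by (rule LeastI[of _ "length c"]) (rule ex)
  have tl: "t \<le> length c" unfolding t_def by (rule Least_le) (rule ex)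
  have "t \<noteq> 0" using t by (intro notI) simp
  then obtain r where r: "t = Suc r" by (cases t) auto
  have "\<not> i < sum_list (take r c)" using not_less_Least[of r "\<lambda>t. i < sum_list (take t c)"] r
    by (simp add: t_def)
  then show thesis using t tl r by (intro that[of r]) (auto simp: block_def)
qed

text \<open>Two indices lie in blocks in decreasing order exactly if a partial sum separates them; this
translates block triangularity into cuts.\<close>

lemma block_order_iff:
  assumes i: "i < sum_list c" and j: "j < sum_list c"
  shows "(\<exists>r<length c. \<exists>s<length c. s < r \<and> i \<in> block c r \<and> j \<in> block c s) \<longleftrightarrow>
    (\<exists>t\<le>length c. j < sum_list (take t c) \<and> sum_list (take t c) \<le> i)"
proof
  assume "\<exists>r<length c. \<exists>s<length c. s < r \<and> i \<in> block c r \<and> j \<in> block c s"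
  then obtain r s where "r < length c" "s < r" "i \<in> block c r" "j \<in> block c s" by blast
  then show "\<exists>t\<le>length c. j < sum_list (take t c) \<and> sum_list (take t c) \<le> i"
    using sum_list_take_mono[of "Suc s" r c] by (intro exI[of _ "Suc s"]) (auto simp: block_def)
next
  assume "\<exists>t\<le>length c. j < sum_list (take t c) \<and> sum_list (take t c) \<le> i"
  then obtain t where t: "j < sum_list (take t c)" "sum_list (take t c) \<le> i" by blast
  obtain r where r: "r < length c" "i \<in> block c r" using ex_block[OF i] .
  obtain s where s: "s < length c" "j \<in> block c s" using ex_block[OF j] .
  have "s < t"
  proof (rule ccontr)
    assume "\<not> s < t"
    then show False using sum_list_take_mono[of t s c] s t by (auto simp: block_def)
  qed
  moreover have "t \<le> r"
  proof (rule ccontr)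
    assume "\<not> t \<le> r"
    then show False using sum_list_take_mono[of "Suc r" t c] r t by (auto simp: block_def)
  qed
  ultimately show "\<exists>r<length c. \<exists>s<length c. s < r \<and> i \<in> block c r \<and> j \<in> block c s"
    using r s by (intro exI[of _ r] conjI exI[of _ s]) auto
qed

lemma sum_list_sym_comp: "comp_le n a \<Longrightarrow> sum_list (sym_comp n a) = 2 * n"
  by (auto simp: sym_comp_def comp_le_def)

text \<open>Between the parts of \<open>a\<close> and their mirror images there is at most one part, so no other partial
sums arise.\<close>

lemma partial_sums_sym_comp:
  assumes "comp_le n a"
  shows "(\<lambda>t. sum_list (take t (sym_comp n a))) ` {..length (sym_comp n a)}
    = insert 0 (cuts a) \<union> (\<lambda>p. 2 * n - p) ` insert 0 (cuts a)"
proof -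
  define m where "m = (if sum_list a = n then [] else [2 * (n - sum_list a)])"
  define c where "c = sym_comp n a"
  have c: "c = a @ m @ rev a" by (simp add: c_def m_def sym_comp_def)
  have lm: "length m \<le> 1" by (simp add: m_def)
  have S0: "insert 0 (cuts a) = (\<lambda>t. sum_list (take t a)) ` {..length a}"
  proof -
    have "{..length a} = insert 0 {1..length a}" by auto
    then show ?thesis by (simp add: cuts_def)
  qed
  have left: "sum_list (take t c) = sum_list (take t a)" if "t \<le> length a" for t
    using that by (simp add: c)
  have right: "sum_list (take (length c - t) c) = 2 * n - sum_list (take t a)" if "t \<le> length a" for t
  proof -
    have "sum_list (take (length c - t) c) + sum_list (drop (length c - t) c) = 2 * n"
      using sum_list_sym_comp[OF assms] by (simp only: sum_list_append[symmetric] append_take_drop_id c_def)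
    moreover have "drop (length c - t) c = rev (take t a)"
      using that by (simp add: c rev_take)
    ultimately show ?thesis by (simp add: sum_list_rev)
  qed
  have cover: "{..length c} = {..length a} \<union> (\<lambda>t. length c - t) ` {..length a}"
  proof -
    have "r \<in> {..length a} \<union> (\<lambda>t. length c - t) ` {..length a}" if "r \<le> length c" for r
    proof (cases "r \<le> length a")
      case False
      then have "length c - r \<le> length a" "r = length c - (length c - r)"
        using that lm by (auto simp: c)
      then show ?thesis by blast
    qed simp
    then show ?thesis by (auto simp: c)
  qed
  have "(\<lambda>t. sum_list (take t c)) ` {..length c}
      = (\<lambda>t. sum_list (take t c)) ` {..length a} \<union> (\<lambda>t. sum_list (take (length c - t) c)) ` {..length a}"
    by (subst cover) (simp add: image_Un image_image)
  also have "(\<lambda>t. sum_list (take t c)) ` {..length a} = insert 0 (cuts a)"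
    unfolding S0 using left by (intro image_cong) auto
  also have "(\<lambda>t. sum_list (take (length c - t) c)) ` {..length a} = (\<lambda>p. 2 * n - p) ` insert 0 (cuts a)"
    unfolding S0 image_image using right by (intro image_cong) auto
  finally show ?thesis by (simp only: c_def)
qed

lemma sp_entrywise:
  "(sp n :: 'k::field mat set) = {M \<in> carrier_mat (2 * n) (2 * n).
     \<forall>i<2 * n. \<forall>j<2 * n. M $$ (mir n j, mir n i) = - (half_sign n i * half_sign n j * M $$ (i, j))}"
  (is "_ = ?R")
proof
  show "sp n \<subseteq> ?R"
  proof
    fix M :: "'k mat" assume "M \<in> sp n"
    then obtain A B C where M: "M = four_block_mat A B C (- anti_transpose A)"
      and c: "A \<in> carrier_mat n n" "B \<in> carrier_mat n n" "C \<in> carrier_mat n n"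
      and s: "B = anti_transpose B" "C = anti_transpose C"
      by (auto simp: sp_def)
    have at: "anti_transpose X $$ (i, j) = X $$ (n - 1 - j, n - 1 - i)"
      if "X \<in> carrier_mat n n" "i < n" "j < n" for X :: "'k mat" and i j
      using that by (auto simp: anti_transpose_def)
    have atc: "anti_transpose A \<in> carrier_mat n n" using c by (simp add: anti_transpose_def)
    have e: "M $$ (i, j) = (if i < n then if j < n then A $$ (i, j) else B $$ (i, j - n)
        else if j < n then C $$ (i - n, j) else - A $$ (n - 1 - (j - n), n - 1 - (i - n)))"
      if "i < 2 * n" "j < 2 * n" for i j
      using that c atc at[OF c(1)] unfolding M by auto
    have Bs: "B $$ (i, j) = B $$ (n - 1 - j, n - 1 - i)" if "i < n" "j < n" for i j
      using at[OF c(2) that] s(1) by simp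
    have Cs: "C $$ (i, j) = C $$ (n - 1 - j, n - 1 - i)" if "i < n" "j < n" for i j
      using at[OF c(3) that] s(2) by simp
    have "M $$ (mir n j, mir n i) = - (half_sign n i * half_sign n j * M $$ (i, j))"
      if ij: "i < 2 * n" "j < 2 * n" for i j
    proof -
      have m: "mir n k < n \<longleftrightarrow> \<not> k < n" "k < n \<Longrightarrow> mir n k - n = n - 1 - k" "\<not> k < n \<Longrightarrow> mir n k = n - 1 - (k - n)"
        "k < n \<Longrightarrow> n - 1 - (n - 1 - k) = k"
        if "k < 2 * n" for k using that by (auto simp: mir_def)
      have em: "M $$ (mir n j, mir n i) = (if j < n then if i < n then - A $$ (i, j) else C $$ (n - 1 - j, n - 1 - (i - n))
          else if i < n then B $$ (n - 1 - (j - n), n - 1 - i) else A $$ (n - 1 - (j - n), n - 1 - (i - n)))"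
        using ij by (simp add: e m(1) m(2) m(4)) (simp add: m(3))
      show ?thesis unfolding em e[OF ij]
        using ij Bs[of i "j - n"] Cs[of "i - n" j] by (auto simp: half_sign_def)
    qed
    moreover have "M \<in> carrier_mat (2 * n) (2 * n)"
      unfolding M mult_2 using c(1) atc by (intro four_block_carrier_mat uminus_carrier_mat)
    ultimately show "M \<in> ?R" by blast
  qed
  show "?R \<subseteq> sp n"
  proof
    fix M :: "'k mat" assume "M \<in> ?R"
    then have Mc: "M \<in> carrier_mat (2 * n) (2 * n)"
      and sym: "\<And>i j. i < 2 * n \<Longrightarrow> j < 2 * n \<Longrightarrow> M $$ (mir n j, mir n i) = - (half_sign n i * half_sign n j * M $$ (i, j))"
      by auto
    define A where "A = mat n n (\<lambda>(i, j). M $$ (i, j))"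
    define B where "B = mat n n (\<lambda>(i, j). M $$ (i, j + n))"
    define C where "C = mat n n (\<lambda>(i, j). M $$ (i + n, j))"
    have c: "A \<in> carrier_mat n n" "B \<in> carrier_mat n n" "C \<in> carrier_mat n n"
      by (auto simp: A_def B_def C_def)
    have m: "mir n (k + n) = n - 1 - k" "mir n k = n - 1 - k + n" if "k < n" for k
      using that by (auto simp: mir_def)
    have "B = anti_transpose B"
    proof (rule eq_matI)
      fix i j assume "i < dim_row (anti_transpose B)" "j < dim_col (anti_transpose B)"
      then have ij: "i < n" "j < n" by (auto simp: anti_transpose_def B_def)
      then show "B $$ (i, j) = anti_transpose B $$ (i, j)"
        using sym[of i "j + n"] by (simp add: anti_transpose_def B_def m half_sign_def)
    qed (auto simp: anti_transpose_def B_def)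
    moreover have "C = anti_transpose C"
    proof (rule eq_matI)
      fix i j assume "i < dim_row (anti_transpose C)" "j < dim_col (anti_transpose C)"
      then have ij: "i < n" "j < n" by (auto simp: anti_transpose_def C_def)
      then show "C $$ (i, j) = anti_transpose C $$ (i, j)"
        using sym[of "i + n" j] by (simp add: anti_transpose_def C_def m half_sign_def)
    qed (auto simp: anti_transpose_def C_def)
    moreover have "M = four_block_mat A B C (- anti_transpose A)"
    proof (rule eq_matI)
      have d: "dim_row (four_block_mat A B C (- anti_transpose A)) = 2 * n"
        "dim_col (four_block_mat A B C (- anti_transpose A)) = 2 * n"
        by (auto simp: A_def anti_transpose_def)
      then show "dim_row M = dim_row (four_block_mat A B C (- anti_transpose A))"
        "dim_col M = dim_col (four_block_mat A B C (- anti_transpose A))" using Mc by auto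
      fix i j assume "i < dim_row (four_block_mat A B C (- anti_transpose A))"
        "j < dim_col (four_block_mat A B C (- anti_transpose A))"
      then have ij: "i < 2 * n" "j < 2 * n" unfolding d .
      have D: "M $$ (i, j) = - M $$ (n - 1 - (j - n), n - 1 - (i - n))" if "\<not> i < n" "\<not> j < n"
      proof -
        have "mir n i = n - 1 - (i - n)" "mir n j = n - 1 - (j - n)" using that ij by (auto simp: mir_def)
        then show ?thesis using sym[OF ij] that by (simp add: half_sign_def)
      qed
      have "i - n < n" if "\<not> i < n" using ij that by auto
      moreover have "j - n < n" if "\<not> j < n" using ij that by auto
      ultimately show "M $$ (i, j) = four_block_mat A B C (- anti_transpose A) $$ (i, j)"
        using ij D by (cases "i < n"; cases "j < n") (simp_all add: A_def B_def C_def anti_transpose_def)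
    qed
    ultimately show "M \<in> sp n" using c unfolding sp_def by blast
  qed
qed

lemma seaweed_eq_cut_seaweed:
  assumes a: "comp_le n a" and b: "comp_le n b"
  shows "seaweed n a b = (cut_seaweed n (cuts a) (cuts b) :: 'k::field mat set)"
proof -
  define U where "U c = (\<lambda>t. sum_list (take t c)) ` {..length c}" for c :: "nat list"
  define before where "before c i j \<longleftrightarrow> (\<exists>r<length c. \<exists>s<length c. s < r \<and> i \<in> block c r \<and> j \<in> block c s)"
    for c :: "nat list" and i j
  have before: "\<not> before c i j \<longleftrightarrow> (\<forall>p\<in>U c. p \<le> i \<longrightarrow> p \<le> j)" if "i < sum_list c" "j < sum_list c" for c i j
  proof -
    have "\<not> before c i j \<longleftrightarrow> \<not> (\<exists>t\<le>length c. j < sum_list (take t c) \<and> sum_list (take t c) \<le> i)"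
      unfolding before_def block_order_iff[OF that] ..
    also have "\<dots> \<longleftrightarrow> (\<forall>t\<le>length c. sum_list (take t c) \<le> i \<longrightarrow> sum_list (take t c) \<le> j)"
      by (meson not_le)
    also have "\<dots> \<longleftrightarrow> (\<forall>p\<in>U c. p \<le> i \<longrightarrow> p \<le> j)" unfolding U_def by auto
    finally show ?thesis .
  qed
  have in_range: "i < sum_list c" if "r < length c" "i \<in> block c r" for r i and c :: "nat list"
    using that sum_list_take_mono[of "Suc r" "length c" c] by (auto simp: block_def)
  have zero_iff: "(\<forall>r<length c. \<forall>s<length c. s < r \<longrightarrow> (\<forall>i\<in>block c r. \<forall>j\<in>block c s. Z i j)) \<longleftrightarrow>
      (\<forall>i<sum_list c. \<forall>j<sum_list c. \<not> Z i j \<longrightarrow> (\<forall>p\<in>U c. p \<le> i \<longrightarrow> p \<le> j))" (is "?l \<longleftrightarrow> ?r")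
    for c and Z :: "nat \<Rightarrow> nat \<Rightarrow> bool"
  proof -
    have "?l \<longleftrightarrow> (\<forall>i<sum_list c. \<forall>j<sum_list c. \<not> Z i j \<longrightarrow> \<not> before c i j)" (is "_ \<longleftrightarrow> ?m")
    proof
      assume l: ?l
      show ?m
      proof (intro allI impI notI)
        fix i j assume "\<not> Z i j" "before c i j"
        then show False using l unfolding before_def by blast
      qed
    next
      assume m: ?m
      show ?l
      proof (intro allI impI ballI, rule ccontr)
        fix r s i j assume rs: "r < length c" "s < length c" "s < r" "i \<in> block c r" "j \<in> block c s" "\<not> Z i j"
        then have "before c i j" "i < sum_list c" "j < sum_list c" using in_range unfolding before_def by blast+
        then show False using m rs(6) by blast
      qed
    qed
    then show ?thesis by (simp add: before)
  qed
  have upper: "M \<in> block_upper c \<longleftrightarrow> M \<in> carrier_mat (sum_list c) (sum_list c) \<and>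
      (\<forall>i<sum_list c. \<forall>j<sum_list c. M $$ (i, j) \<noteq> 0 \<longrightarrow> (\<forall>p\<in>U c. p \<le> i \<longrightarrow> p \<le> j))" for M :: "'k mat" and c
    unfolding block_upper_def using zero_iff[of c "\<lambda>i j. M $$ (i, j) = 0"] by blast
  have lower: "M \<in> block_lower c \<longleftrightarrow> M \<in> carrier_mat (sum_list c) (sum_list c) \<and>
      (\<forall>i<sum_list c. \<forall>j<sum_list c. M $$ (i, j) \<noteq> 0 \<longrightarrow> (\<forall>p\<in>U c. p \<le> j \<longrightarrow> p \<le> i))" for M :: "'k mat" and c
  proof -
    have "(\<forall>r<length c. \<forall>s<length c. r < s \<longrightarrow> (\<forall>i\<in>block c r. \<forall>j\<in>block c s. M $$ (i, j) = 0)) \<longleftrightarrow>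
        (\<forall>s<length c. \<forall>r<length c. r < s \<longrightarrow> (\<forall>j\<in>block c s. \<forall>i\<in>block c r. M $$ (i, j) = 0))" by blast
    also have "\<dots> \<longleftrightarrow> (\<forall>j<sum_list c. \<forall>i<sum_list c. M $$ (i, j) \<noteq> 0 \<longrightarrow> (\<forall>p\<in>U c. p \<le> j \<longrightarrow> p \<le> i))"
      by (rule zero_iff)
    finally show ?thesis unfolding block_lower_def by blast
  qed
  have order: "cut_order n (cuts a) (cuts b) i j \<longleftrightarrow>
      (\<forall>p\<in>U (sym_comp n a). p \<le> i \<longrightarrow> p \<le> j) \<and> (\<forall>p\<in>U (sym_comp n b). p \<le> j \<longrightarrow> p \<le> i)"
    if "i < 2 * n" "j < 2 * n" for i j
    using that unfolding U_def partial_sums_sym_comp[OF a] partial_sums_sym_comp[OF b] cut_order_def by auto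
  show ?thesis
    unfolding seaweed_def cut_seaweed_def sp_entrywise
    using upper[of _ "sym_comp n a"] lower[of _ "sym_comp n b"] order
    unfolding sum_list_sym_comp[OF a] sum_list_sym_comp[OF b] by (auto simp: set_eq_iff)
qed

text \<open>Only the middle block reaches across the centre, and it is symmetric.\<close>

lemma central_nested_arcs:
  assumes a: "comp_le n a"
  shows "{(u, v) \<in> nested_arcs (sym_comp n a). u < n \<and> n \<le> v} = (\<lambda>u. (u, 2 * n - 1 - u)) ` {sum_list a..<n}"
proof -
  define c where "c = sym_comp n a"
  define l where "l = length a"
  have al: "sum_list a \<le> n" using a by (simp add: comp_le_def)
  have Sl: "sum_list (take l c) = sum_list a" by (simp add: c_def sym_comp_def l_def)
  have mid: "l < length c" "sum_list (take (Suc l) c) = 2 * n - sum_list a" if "sum_list a < n"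
    using that by (auto simp: c_def sym_comp_def l_def)
  show ?thesis unfolding c_def[symmetric]
  proof (rule equalityI; rule subsetI)
    fix e assume "e \<in> {(u, v) \<in> nested_arcs c. u < n \<and> n \<le> v}"
    then obtain u v r where e: "e = (u, v)" "u < n" "n \<le> v" and r: "r < length c" "u \<in> block c r" "v \<in> block c r"
      and uv: "u + v + 1 = sum_list (take r c) + sum_list (take (Suc r) c)"
      by (auto simp: nested_arcs_def)
    have bu: "sum_list (take r c) \<le> u" "v < sum_list (take (Suc r) c)" using r by (auto simp: block_def)
    have "l \<le> r"
    proof (rule ccontr)
      assume "\<not> l \<le> r"
      then have "sum_list (take (Suc r) c) \<le> sum_list a" using sum_list_take_mono[of "Suc r" l c] Sl by simp
      then show False using bu e al by linarith
    qed
    then have lt: "sum_list a < n" using sum_list_take_mono[of l r c] Sl bu e by linarith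
    have "r = l"
    proof (rule ccontr)
      assume "r \<noteq> l"
      then have "2 * n - sum_list a \<le> sum_list (take r c)"
        using \<open>l \<le> r\<close> sum_list_take_mono[of "Suc l" r c] mid(2)[OF lt] by simp
      then show False using bu e lt by linarith
    qed
    then have "v = 2 * n - 1 - u" "sum_list a \<le> u" using uv bu Sl mid(2)[OF lt] lt by auto
    then show "e \<in> (\<lambda>u. (u, 2 * n - 1 - u)) ` {sum_list a..<n}" using e by auto
  next
    fix e assume "e \<in> (\<lambda>u. (u, 2 * n - 1 - u)) ` {sum_list a..<n}"
    then obtain u where u: "e = (u, 2 * n - 1 - u)" "sum_list a \<le> u" "u < n" by auto
    then have lt: "sum_list a < n" by simp
    have "u \<in> block c l" "2 * n - 1 - u \<in> block c l"
      unfolding block_def Sl mid(2)[OF lt] using u by auto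
    moreover have "u + (2 * n - 1 - u) + 1 = sum_list (take l c) + sum_list (take (Suc l) c)"
      unfolding Sl mid(2)[OF lt] using u lt by auto
    ultimately show "e \<in> {(u, v) \<in> nested_arcs c. u < n \<and> n \<le> v}"
      using u mid(1)[OF lt] by (auto simp: nested_arcs_def)
  qed
qed

lemma card_central_arcs:
  assumes a: "comp_le n a" and b: "comp_le n b"
  shows "card (central_arcs n a b) = (n - sum_list a) + (n - sum_list b)"
proof -
  let ?A = "{(u, v) \<in> nested_arcs (sym_comp n a). u < n \<and> n \<le> v}"
  let ?B = "{(u, v) \<in> nested_arcs (sym_comp n b). u < n \<and> n \<le> v}"
  have c: "card ((\<lambda>u. (u, 2 * n - 1 - u)) ` {s..<n}) = n - s" for s
  proof -
    have "inj_on (\<lambda>u. (u, 2 * n - 1 - u)) {s..<n}" by (rule inj_on_inverseI[of _ fst]) simp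
    then show ?thesis by (simp add: card_image)
  qed
  have "central_arcs n a b = {Above} \<times> ?A \<union> {Below} \<times> ?B"
    by (auto simp: central_arcs_def meander_arcs_def)
  then have "card (central_arcs n a b) = card ({Above} \<times> ?A \<union> {Below} \<times> ?B)" by (rule arg_cong)
  also have "\<dots> = card ({Above} \<times> ?A) + card ({Below} \<times> ?B)"
    unfolding central_nested_arcs[OF a] central_nested_arcs[OF b] by (intro card_Un_disjoint) auto
  also have "\<dots> = (n - sum_list a) + (n - sum_list b)"
    unfolding card_cartesian_product central_nested_arcs[OF a] central_nested_arcs[OF b] c by simp
  finally show ?thesis .
qed


section \<open>Counting Frobenius seaweeds\<close>

text \<open>A cut at \<open>p\<close> is visible in the seaweed as the absence of the root vector just below or just above the
diagonal, so the seaweed determines its two sets of cuts.\<close>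

definition lower_cuts :: "nat \<Rightarrow> 'k::field mat set \<Rightarrow> nat set" where
  "lower_cuts n q = {p \<in> {1..n}. sp_unit n p (p - 1) \<notin> q}"

definition upper_cuts :: "nat \<Rightarrow> 'k::field mat set \<Rightarrow> nat set" where
  "upper_cuts n q = {p \<in> {1..n}. sp_unit n (p - 1) p \<notin> q}"

lemma sp_unit_mem_iff:
  assumes "p < 2 * n" "q < 2 * n" "p \<noteq> q" "P \<subseteq> {..n}" "Q \<subseteq> {..n}"
  shows "(sp_unit n p q :: 'k::field_char_0 mat) \<in> cut_seaweed n P Q \<longleftrightarrow> cut_order n P Q p q"
proof
  assume u: "(sp_unit n p q :: 'k mat) \<in> cut_seaweed n P Q"
  have ne: "(1 - (if C then c else 0) :: 'k) \<noteq> 0" if "C \<Longrightarrow> c = - 1" for C c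
    using that by (cases C) simp_all
  have "half_sign n (mir n q) * half_sign n q = (- 1 :: 'k)" using assms(2) by simp
  then have "p = mir n q \<and> q = mir n p \<Longrightarrow> half_sign n p * half_sign n q = (- 1 :: 'k)" by metis
  then have "(sp_unit n p q :: 'k mat) $$ (p, q) \<noteq> 0"
    unfolding sp_unit_entry[OF assms(1,2)] simp_thms if_True by (rule ne)
  then show "cut_order n P Q p q" using cut_seaweedD(3)[OF u assms(1,2)] by blast
qed (rule sp_unit_mem[OF assms(1,2) _ assms(4,5)])

lemma cuts_of_cut_seaweed:
  assumes PQ: "P \<subseteq> {1..n}" "Q \<subseteq> {1..n}"
  shows "lower_cuts n (cut_seaweed n P Q :: 'k::field_char_0 mat set) = P"
    "upper_cuts n (cut_seaweed n P Q :: 'k::field_char_0 mat set) = Q"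
proof -
  have PQ': "P \<subseteq> {..n}" "Q \<subseteq> {..n}" using PQ by auto
  have "cut_order n P Q p (p - 1) \<longleftrightarrow> p \<notin> P" if "p \<in> {1..n}" for p
  proof
    assume "cut_order n P Q p (p - 1)"
    then show "p \<notin> P" using that by (auto simp: cut_order_def)
  next
    assume np: "p \<notin> P"
    have "r \<le> p \<longrightarrow> r \<le> p - 1" "2 * n - r \<le> p \<longrightarrow> 2 * n - r \<le> p - 1" if r: "r \<in> P" for r
    proof -
      have "r \<noteq> p" using r np by blast
      moreover have "r \<le> n" "p \<le> n" using r PQ \<open>p \<in> {1..n}\<close> by auto
      ultimately show "r \<le> p \<longrightarrow> r \<le> p - 1" "2 * n - r \<le> p \<longrightarrow> 2 * n - r \<le> p - 1" by linarith+
    qed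
    then show "cut_order n P Q p (p - 1)" unfolding cut_order_def by auto
  qed
  moreover have "(sp_unit n (p) (p - 1) :: 'k mat) \<in> cut_seaweed n P Q \<longleftrightarrow> cut_order n P Q (p) (p - 1)" if "p \<in> {1..n}" for p
    using that by (intro sp_unit_mem_iff PQ') auto
  ultimately have "(sp_unit n (p) (p - 1) :: 'k mat) \<notin> cut_seaweed n P Q \<longleftrightarrow> p \<in> P" if "p \<in> {1..n}" for p
    using that by blast
  then show "lower_cuts n (cut_seaweed n P Q :: 'k mat set) = P"
    using PQ unfolding lower_cuts_def by blast
  have "cut_order n P Q (p - 1) p \<longleftrightarrow> p \<notin> Q" if "p \<in> {1..n}" for p
  proof
    assume "cut_order n P Q (p - 1) p"
    then show "p \<notin> Q" using that by (auto simp: cut_order_def)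
  next
    assume np: "p \<notin> Q"
    have "r \<le> p \<longrightarrow> r \<le> p - 1" "2 * n - r \<le> p \<longrightarrow> 2 * n - r \<le> p - 1" if r: "r \<in> Q" for r
    proof -
      have "r \<noteq> p" using r np by blast
      moreover have "r \<le> n" "p \<le> n" using r PQ \<open>p \<in> {1..n}\<close> by auto
      ultimately show "r \<le> p \<longrightarrow> r \<le> p - 1" "2 * n - r \<le> p \<longrightarrow> 2 * n - r \<le> p - 1" by linarith+
    qed
    then show "cut_order n P Q (p - 1) p" unfolding cut_order_def by auto
  qed
  moreover have "(sp_unit n (p - 1) (p) :: 'k mat) \<in> cut_seaweed n P Q \<longleftrightarrow> cut_order n P Q (p - 1) (p)" if "p \<in> {1..n}" for p
    using that by (intro sp_unit_mem_iff PQ') auto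
  ultimately have "(sp_unit n (p - 1) (p) :: 'k mat) \<notin> cut_seaweed n P Q \<longleftrightarrow> p \<in> Q" if "p \<in> {1..n}" for p
    using that by blast
  then show "upper_cuts n (cut_seaweed n P Q :: 'k mat set) = Q"
    using PQ unfolding upper_cuts_def by blast
qed

lemma cut_seaweed_inject:
  assumes "P \<subseteq> {1..n}" "Q \<subseteq> {1..n}" "P' \<subseteq> {1..n}" "Q' \<subseteq> {1..n}"
  shows "(cut_seaweed n P Q :: 'k::field_char_0 mat set) = cut_seaweed n P' Q' \<longleftrightarrow> P = P' \<and> Q = Q'"
proof
  assume eq: "(cut_seaweed n P Q :: 'k mat set) = cut_seaweed n P' Q'"
  show "P = P' \<and> Q = Q'"
    using cuts_of_cut_seaweed[OF assms(1,2), where 'k='k] cuts_of_cut_seaweed[OF assms(3,4), where 'k='k]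
    unfolding eq by simp
qed simp

text \<open>For a Frobenius seaweed exactly one of the two sets of cuts contains \<open>n\<close>, and that set receives the
new cut. In the meander graph this inserts two vertices in the middle that are joined by a new
central arc on one side of the line and have no arc on the other side.\<close>

definition extend_seaweed :: "nat \<Rightarrow> 'k::field mat set \<Rightarrow> 'k mat set" where
  "extend_seaweed n q = (if n \<in> upper_cuts n q
     then cut_seaweed (Suc n) (lower_cuts n q) (insert (Suc n) (upper_cuts n q))
     else cut_seaweed (Suc n) (insert (Suc n) (lower_cuts n q)) (upper_cuts n q))"

lemma extend_cut_seaweed:
  assumes "P \<subseteq> {1..n}" "Q \<subseteq> {1..n}"
  shows "extend_seaweed n (cut_seaweed n P Q :: 'k::field_char_0 mat set) =
    (if n \<in> Q then cut_seaweed (Suc n) P (insert (Suc n) Q) else cut_seaweed (Suc n) (insert (Suc n) P) Q)"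
  unfolding extend_seaweed_def cuts_of_cut_seaweed[OF assms] ..

lemma frobenius_cut_seaweed_full:
  assumes "frobenius (2 * n) (cut_seaweed n P Q :: 'k::field_char_0 mat set)" "n \<ge> 1" "P \<subseteq> {1..n}" "Q \<subseteq> {1..n}"
  shows "n \<in> P \<longleftrightarrow> n \<notin> Q"
proof -
  have "P \<subseteq> {..n}" "Q \<subseteq> {..n}" using assms by auto
  then show ?thesis
    using assms not_frobenius_if_both_full[of n P Q, where 'k='k] not_frobenius_if_neither_full[of n P Q, where 'k='k] by blast
qed

lemma frobenius_extend:
  assumes f: "frobenius (2 * n) (cut_seaweed n P Q :: 'k::field_char_0 mat set)"
    and n: "n \<ge> 1" and PQ: "P \<subseteq> {1..n}" "Q \<subseteq> {1..n}"
  shows "frobenius (2 * Suc n) (extend_seaweed n (cut_seaweed n P Q :: 'k mat set))"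
proof -
  have PQ': "P \<subseteq> {..n}" "Q \<subseteq> {..n}" using PQ by auto
  show ?thesis
  proof (cases "n \<in> Q")
    case True
    then show ?thesis unfolding extend_cut_seaweed[OF PQ]
      using frobenius_add_vertex[OF PQ' True f] by simp
  next
    case False
    then have nP: "n \<in> P" using frobenius_cut_seaweed_full[OF f n PQ] by blast
    have sw: "frobenius (2 * Suc n) (cut_seaweed (Suc n) Q (insert (Suc n) P) :: 'k mat set)"
      by (rule frobenius_add_vertex[OF PQ'(2,1) nP frobenius_cut_seaweed_swap[OF f]])
    then show ?thesis unfolding extend_cut_seaweed[OF PQ]
      using False frobenius_cut_seaweed_swap[OF sw] by simp
  qed
qed

lemma frobenius_seaweeds_eq:
  "(frobenius_seaweeds n :: 'k::field mat set set) = {cut_seaweed n P Q | P Q.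
     P \<subseteq> {1..n} \<and> Q \<subseteq> {1..n} \<and> frobenius (2 * n) (cut_seaweed n P Q :: 'k mat set)}"
proof (rule equalityI; rule subsetI)
  fix q :: "'k mat set" assume "q \<in> frobenius_seaweeds n"
  then obtain a b where "q = seaweed n a b" "comp_le n a" "comp_le n b" "frobenius (2 * n) q"
    by (auto simp: frobenius_seaweeds_def)
  moreover from this have "q = cut_seaweed n (cuts a) (cuts b)" by (simp only: seaweed_eq_cut_seaweed)
  ultimately show "q \<in> {cut_seaweed n P Q | P Q.
     P \<subseteq> {1..n} \<and> Q \<subseteq> {1..n} \<and> frobenius (2 * n) (cut_seaweed n P Q :: 'k mat set)}"
    using cuts_subset[of n a] cuts_subset[of n b]
    by (intro CollectI exI[of _ "cuts a"] exI[of _ "cuts b"]) simp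
next
  fix q :: "'k mat set" assume "q \<in> {cut_seaweed n P Q | P Q.
     P \<subseteq> {1..n} \<and> Q \<subseteq> {1..n} \<and> frobenius (2 * n) (cut_seaweed n P Q :: 'k mat set)}"
  then obtain P Q where q: "q = cut_seaweed n P Q" "P \<subseteq> {1..n}" "Q \<subseteq> {1..n}" "frobenius (2 * n) q" by auto
  obtain a where a: "comp_le n a" "cuts a = P" using ex_composition_with_cuts[OF q(2)] by blast
  obtain b where b: "comp_le n b" "cuts b = Q" using ex_composition_with_cuts[OF q(3)] by blast
  have "q = seaweed n a b" unfolding q(1) seaweed_eq_cut_seaweed[OF a(1) b(1)] a(2) b(2) ..
  then show "q \<in> frobenius_seaweeds n" using a b q(4) unfolding frobenius_seaweeds_def by blast
qed

lemma frobenius_seaweedsI: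
  assumes "P \<subseteq> {1..n}" "Q \<subseteq> {1..n}" "frobenius (2 * n) (cut_seaweed n P Q :: 'k::field mat set)"
  shows "cut_seaweed n P Q \<in> (frobenius_seaweeds n :: 'k mat set set)"
  unfolding frobenius_seaweeds_eq using assms by (intro CollectI exI conjI) (rule refl)

lemma extend_seaweed_frobenius:
  assumes n: "n \<ge> 1" and q: "q \<in> frobenius_seaweeds n"
  shows "extend_seaweed n q \<in> (frobenius_seaweeds (Suc n) :: 'k::field_char_0 mat set set)"
proof -
  obtain P Q where PQ: "P \<subseteq> {1..n}" "Q \<subseteq> {1..n}" and fr: "frobenius (2 * n) (cut_seaweed n P Q :: 'k mat set)"
    and qP: "q = cut_seaweed n P Q" using q by (auto simp: frobenius_seaweeds_eq)
  have s: "insert (Suc n) P \<subseteq> {1..Suc n}" "insert (Suc n) Q \<subseteq> {1..Suc n}" "P \<subseteq> {1..Suc n}" "Q \<subseteq> {1..Suc n}"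
    using PQ by auto
  have "frobenius (2 * Suc n) (extend_seaweed n (cut_seaweed n P Q :: 'k mat set))"
    by (rule frobenius_extend[OF fr n PQ])
  then show ?thesis
    unfolding qP extend_cut_seaweed[OF PQ]
    by (cases "n \<in> Q") (simp_all only: if_True if_False frobenius_seaweedsI[OF s(3,2)] frobenius_seaweedsI[OF s(1,4)])
qed

lemma swap_rel_iff:
  "(q, q') \<in> swap_rel n \<longleftrightarrow> q \<in> frobenius_seaweeds n \<and> q' \<in> (frobenius_seaweeds n :: 'k::field mat set set) \<and>
     (\<exists>P Q. P \<subseteq> {1..n} \<and> Q \<subseteq> {1..n} \<and> q = cut_seaweed n P Q \<and> (q' = cut_seaweed n P Q \<or> q' = cut_seaweed n Q P))"
  (is "_ \<longleftrightarrow> ?r")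
proof
  assume "(q, q') \<in> swap_rel n"
  then have *: "q \<in> frobenius_seaweeds n" "q' \<in> frobenius_seaweeds n"
    "\<exists>a b. comp_le n a \<and> comp_le n b \<and> q = seaweed n a b \<and> (q' = seaweed n a b \<or> q' = seaweed n b a)"
    by (simp_all add: swap_rel_def)
  then obtain a b where ab: "comp_le n a" "comp_le n b" and q: "q = seaweed n a b" "q' = seaweed n a b \<or> q' = seaweed n b a"
    by (elim exE conjE)
  show ?r
    using *(1,2) q cuts_subset[OF ab(1)] cuts_subset[OF ab(2)]
    unfolding seaweed_eq_cut_seaweed[OF ab] seaweed_eq_cut_seaweed[OF ab(2,1)]
    by (intro conjI exI[of _ "cuts a"] exI[of _ "cuts b"])
next
  assume r: ?r
  then obtain P Q where PQ: "P \<subseteq> {1..n}" "Q \<subseteq> {1..n}" "q = cut_seaweed n P Q" "q' = cut_seaweed n P Q \<or> q' = cut_seaweed n Q P"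
    by (elim conjE exE)
  obtain a where a: "comp_le n a" "cuts a = P" using ex_composition_with_cuts[OF PQ(1)] by blast
  obtain b where b: "comp_le n b" "cuts b = Q" using ex_composition_with_cuts[OF PQ(2)] by blast
  have "q = seaweed n a b" "q' = seaweed n a b \<or> q' = seaweed n b a"
    using PQ(3,4) unfolding seaweed_eq_cut_seaweed[OF a(1) b(1)] seaweed_eq_cut_seaweed[OF b(1) a(1)] a(2) b(2) .
  then have "\<exists>a b. comp_le n a \<and> comp_le n b \<and> q = seaweed n a b \<and> (q' = seaweed n a b \<or> q' = seaweed n b a)"
    using a(1) b(1) by (intro exI conjI)
  then show "(q, q') \<in> swap_rel n" using r by (simp add: swap_rel_def)
qed

lemma swap_rel_cut_seaweed:
  assumes "P \<subseteq> {1..n}" "Q \<subseteq> {1..n}" "P' \<subseteq> {1..n}" "Q' \<subseteq> {1..n}"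
    and "cut_seaweed n P Q \<in> (frobenius_seaweeds n :: 'k::field_char_0 mat set set)"
      "cut_seaweed n P' Q' \<in> (frobenius_seaweeds n :: 'k mat set set)"
  shows "(cut_seaweed n P Q, cut_seaweed n P' Q' :: 'k mat set) \<in> swap_rel n \<longleftrightarrow>
    P = P' \<and> Q = Q' \<or> P = Q' \<and> Q = P'"
proof
  assume "(cut_seaweed n P Q, cut_seaweed n P' Q' :: 'k mat set) \<in> swap_rel n"
  then obtain A B where "A \<subseteq> {1..n}" "B \<subseteq> {1..n}" "(cut_seaweed n P Q :: 'k mat set) = cut_seaweed n A B"
    "(cut_seaweed n P' Q' :: 'k mat set) = cut_seaweed n A B \<or> (cut_seaweed n P' Q' :: 'k mat set) = cut_seaweed n B A"
    unfolding swap_rel_iff by blast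
  then show "P = P' \<and> Q = Q' \<or> P = Q' \<and> Q = P'" using assms by (auto simp: cut_seaweed_inject)
next
  assume "P = P' \<and> Q = Q' \<or> P = Q' \<and> Q = P'"
  then show "(cut_seaweed n P Q, cut_seaweed n P' Q' :: 'k mat set) \<in> swap_rel n"
    unfolding swap_rel_iff using assms by blast
qed

lemma equiv_swap_rel: "equiv (frobenius_seaweeds n) (swap_rel n :: ('k::field_char_0 mat set \<times> 'k mat set) set)"
proof (rule equivI)
  let ?F = "frobenius_seaweeds n :: 'k mat set set"
  have rep: "\<exists>P Q. P \<subseteq> {1..n} \<and> Q \<subseteq> {1..n} \<and> q = cut_seaweed n P Q" if "q \<in> ?F" for q
    using that by (auto simp: frobenius_seaweeds_eq)
  show "swap_rel n \<subseteq> ?F \<times> ?F" by (auto simp: swap_rel_def)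
  show "refl_on ?F (swap_rel n)"
  proof (rule refl_onI)
    show "(q, q) \<in> swap_rel n" if "q \<in> ?F" for q using rep[OF that] that unfolding swap_rel_iff by blast
  qed
  show "sym (swap_rel n :: ('k mat set \<times> 'k mat set) set)"
    unfolding sym_def swap_rel_iff by blast
  show "trans (swap_rel n :: ('k mat set \<times> 'k mat set) set)"
  proof (rule transI)
    fix x y z :: "'k mat set" assume xy: "(x, y) \<in> swap_rel n" and yz: "(y, z) \<in> swap_rel n"
    then have F: "x \<in> ?F" "y \<in> ?F" "z \<in> ?F" by (auto simp: swap_rel_def)
    obtain P Q where x: "x = cut_seaweed n P Q" "P \<subseteq> {1..n}" "Q \<subseteq> {1..n}" using rep[OF F(1)] by blast
    obtain P' Q' where y: "y = cut_seaweed n P' Q'" "P' \<subseteq> {1..n}" "Q' \<subseteq> {1..n}" using rep[OF F(2)] by blast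
    obtain P'' Q'' where z: "z = cut_seaweed n P'' Q''" "P'' \<subseteq> {1..n}" "Q'' \<subseteq> {1..n}" using rep[OF F(3)] by blast
    have "P = P' \<and> Q = Q' \<or> P = Q' \<and> Q = P'"
      using swap_rel_cut_seaweed[OF x(2,3) y(2,3), where 'k='k] xy F unfolding x(1) y(1) by blast
    moreover have "P' = P'' \<and> Q' = Q'' \<or> P' = Q'' \<and> Q' = P''"
      using swap_rel_cut_seaweed[OF y(2,3) z(2,3), where 'k='k] yz F unfolding y(1) z(1) by blast
    ultimately have "P = P'' \<and> Q = Q'' \<or> P = Q'' \<and> Q = P''" by auto
    then show "(x, z) \<in> swap_rel n"
      using swap_rel_cut_seaweed[OF x(2,3) z(2,3), where 'k='k] F unfolding x(1) z(1) by blast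
  qed
qed

lemma finite_frobenius_seaweeds: "finite (frobenius_seaweeds n :: 'k::field mat set set)"
proof (rule finite_subset)
  show "(frobenius_seaweeds n :: 'k mat set set) \<subseteq> (\<lambda>(P, Q). cut_seaweed n P Q) ` (Pow {1..n} \<times> Pow {1..n})"
    by (auto simp: frobenius_seaweeds_eq)
qed simp

lemma card_quotient_less:
  assumes R: "equiv X R" and S: "equiv Y S" and fin: "finite Y" and f: "f ` X \<subseteq> Y"
    and iff: "\<And>x y. x \<in> X \<Longrightarrow> y \<in> X \<Longrightarrow> (f x, f y) \<in> S \<longleftrightarrow> (x, y) \<in> R"
    and z: "z \<in> Y" "\<And>x. x \<in> X \<Longrightarrow> (f x, z) \<notin> S"
  shows "card (X // R) < card (Y // S)"
proof -
  define H where "H C = S `` (f ` C)" for C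
  have H: "H (R `` {x}) = S `` {f x}" if x: "x \<in> X" for x
  proof -
    have "S `` {f y} = S `` {f x}" if "(x, y) \<in> R" for y
    proof -
      have "y \<in> X" using R that by (auto simp: equiv_def)
      then have "(f x, f y) \<in> S" using iff[OF x] that by blast
      then show ?thesis using equiv_class_eq[OF S] by blast
    qed
    moreover have "(x, x) \<in> R" using R x by (auto simp: equiv_def refl_on_def)
    ultimately show ?thesis unfolding H_def by blast
  qed
  have "inj_on H (X // R)"
  proof (rule inj_onI)
    fix C D assume "C \<in> X // R" "D \<in> X // R" and eq: "H C = H D"
    then obtain x y where xy: "x \<in> X" "y \<in> X" "C = R `` {x}" "D = R `` {y}" by (auto elim!: quotientE)
    then have "S `` {f x} = S `` {f y}" using eq H by simp
    then have "(f x, f y) \<in> S" using eq_equiv_class[OF _ S] f xy by blast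
    then have "(x, y) \<in> R" using iff xy by blast
    then show "C = D" using equiv_class_eq[OF R] xy by blast
  qed
  then have "card (X // R) = card (H ` (X // R))" by (simp add: card_image)
  also have "\<dots> < card (Y // S)"
  proof (rule psubset_card_mono)
    have "S \<subseteq> Y \<times> Y" using S by (auto simp: equiv_def)
    then show "finite (Y // S)" using finite_quotient[OF fin] by blast
    have "H ` (X // R) \<subseteq> Y // S"
      using H f by (auto elim!: quotientE intro!: quotientI)
    moreover have "S `` {z} \<in> Y // S" using z by (auto intro: quotientI)
    moreover have "S `` {z} \<notin> H ` (X // R)"
    proof
      assume "S `` {z} \<in> H ` (X // R)"
      then obtain x where "x \<in> X" "S `` {z} = S `` {f x}" using H by (auto elim!: quotientE)
      then have "(f x, z) \<in> S" using eq_equiv_class[OF _ S z(1), of "f x"] by simp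
      then show False using z \<open>x \<in> X\<close> by blast
    qed
    ultimately show "H ` (X // R) \<subset> Y // S" by blast
  qed
  finally show ?thesis .
qed

lemma extend_seaweed_inj_on:
  assumes n: "n \<ge> 1"
  shows "inj_on (extend_seaweed n) (frobenius_seaweeds n :: 'k::field_char_0 mat set set)"
proof (rule inj_onI)
  fix q q' :: "'k mat set" assume "q \<in> frobenius_seaweeds n" "q' \<in> frobenius_seaweeds n"
    and eq: "extend_seaweed n q = extend_seaweed n q'"
  then obtain P Q P' Q' where q: "q = cut_seaweed n P Q" "q' = cut_seaweed n P' Q'"
    and PQ: "P \<subseteq> {1..n}" "Q \<subseteq> {1..n}" "P' \<subseteq> {1..n}" "Q' \<subseteq> {1..n}"
    by (auto simp: frobenius_seaweeds_eq)
  have s: "A \<subseteq> {1..Suc n}" "insert (Suc n) A \<subseteq> {1..Suc n}" "Suc n \<notin> A" if "A \<subseteq> {1..n}" for A using that by auto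
  show "q = q'"
    using eq PQ s[OF PQ(1)] s[OF PQ(2)] s[OF PQ(3)] s[OF PQ(4)] unfolding q
    by (auto simp: extend_cut_seaweed cut_seaweed_inject insert_ident split: if_splits)
qed

text \<open>Exchanging \<open>P\<close> and \<open>Q\<close> also exchanges which of them contains \<open>n\<close>, hence commutes with the extension.\<close>

lemma extend_seaweed_swap_rel_iff:
  fixes q q' :: "'k::field_char_0 mat set"
  assumes n: "n \<ge> 1" and q: "q \<in> frobenius_seaweeds n" and q': "q' \<in> frobenius_seaweeds n"
    and e: "extend_seaweed n q \<in> frobenius_seaweeds (Suc n)" "extend_seaweed n q' \<in> frobenius_seaweeds (Suc n)"
  shows "(extend_seaweed n q, extend_seaweed n q') \<in> swap_rel (Suc n) \<longleftrightarrow> (q, q') \<in> swap_rel n"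
proof -
  obtain P Q where qP: "q = cut_seaweed n P Q" "P \<subseteq> {1..n}" "Q \<subseteq> {1..n}" and fq: "n \<in> P \<longleftrightarrow> n \<notin> Q"
    using q frobenius_cut_seaweed_full[OF _ n] by (auto simp: frobenius_seaweeds_eq)
  obtain P' Q' where qP': "q' = cut_seaweed n P' Q'" "P' \<subseteq> {1..n}" "Q' \<subseteq> {1..n}" and fq': "n \<in> P' \<longleftrightarrow> n \<notin> Q'"
    using q' frobenius_cut_seaweed_full[OF _ n] by (auto simp: frobenius_seaweeds_eq)
  have s: "A \<subseteq> {1..Suc n}" "insert (Suc n) A \<subseteq> {1..Suc n}" "Suc n \<notin> A" if "A \<subseteq> {1..n}" for A using that by auto
  note ss = s[OF qP(2)] s[OF qP(3)] s[OF qP'(2)] s[OF qP'(3)]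
  have "(q, q') \<in> swap_rel n \<longleftrightarrow> P = P' \<and> Q = Q' \<or> P = Q' \<and> Q = P'"
    using swap_rel_cut_seaweed[OF qP(2,3) qP'(2,3), where 'k='k] q q' unfolding qP(1) qP'(1) by blast
  moreover have "(extend_seaweed n q, extend_seaweed n q') \<in> swap_rel (Suc n) \<longleftrightarrow> P = P' \<and> Q = Q' \<or> P = Q' \<and> Q = P'"
    using e ss fq fq' unfolding qP(1) qP'(1) extend_cut_seaweed[OF qP(2,3)] extend_cut_seaweed[OF qP'(2,3)]
    by (cases "n \<in> Q"; cases "n \<in> Q'") (auto simp: swap_rel_cut_seaweed insert_ident)
  ultimately show ?thesis by blast
qed

theorem lemma4p4:
  fixes n :: nat
  assumes "n \<ge> 1"
  shows "(\<forall>k\<ge>1. \<exists>f :: 'k::{alg_closed_field, field_char_0} mat set \<Rightarrow> 'k mat set.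
            f \<in> frobenius_seaweeds_central n k \<rightarrow> frobenius_seaweeds_central (n + 1) (k + 1) \<and>
            inj_on f (frobenius_seaweeds_central n k)) \<and>
         num_frobenius TYPE('k) (n + 1) > num_frobenius TYPE('k) n"
proof (intro conjI allI impI)
  let ?F = "frobenius_seaweeds n :: 'k mat set set"
  let ?e = "extend_seaweed n :: 'k mat set \<Rightarrow> 'k mat set"
  fix k :: nat assume "k \<ge> 1"
  have sub: "frobenius_seaweeds_central n k \<subseteq> ?F"
    by (auto simp: frobenius_seaweeds_central_def frobenius_seaweeds_def)
  have "?e q \<in> frobenius_seaweeds_central (Suc n) (Suc k)" if q: "q \<in> frobenius_seaweeds_central n k" for q
  proof -
    obtain a b where a: "comp_le n a" and b: "comp_le n b" and qs: "q = seaweed n a b"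
      and fr: "frobenius (2 * n) (seaweed n a b :: 'k mat set)" and k: "card (central_arcs n a b) = k"
      using q by (auto simp: frobenius_seaweeds_central_def)
    note PQ = cuts_subset[OF a] cuts_subset[OF b]
    have fr': "frobenius (2 * n) (cut_seaweed n (cuts a) (cuts b) :: 'k mat set)"
      using fr a b by (simp add: seaweed_eq_cut_seaweed)
    have a1: "comp_le (Suc n) a" and b1: "comp_le (Suc n) b" using a b by (auto simp: comp_le_def)
    have ext: "?e q = (if n \<in> cuts b then cut_seaweed (Suc n) (cuts a) (insert (Suc n) (cuts b))
        else cut_seaweed (Suc n) (insert (Suc n) (cuts a)) (cuts b))"
      unfolding qs seaweed_eq_cut_seaweed[OF a b] by (rule extend_cut_seaweed[OF PQ])
    have fe: "frobenius (2 * Suc n) (?e q)"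
      unfolding qs seaweed_eq_cut_seaweed[OF a b] by (rule frobenius_extend[OF fr' assms PQ])
    obtain a' b' where "comp_le (Suc n) a'" "comp_le (Suc n) b'" "?e q = seaweed (Suc n) a' b'"
      "card (central_arcs (Suc n) a' b') = Suc k"
    proof (cases "n \<in> cuts b")
      case True
      then have sb: "sum_list b = n" using full_cuts_iff[OF b assms] by simp
      have b2: "comp_le (Suc n) (b @ [1])" using b sb by (auto simp: comp_le_def)
      have "?e q = seaweed (Suc n) a (b @ [1])"
        unfolding seaweed_eq_cut_seaweed[OF a1 b2] cuts_snoc sb ext using True by simp
      moreover have "card (central_arcs (Suc n) a (b @ [1])) = Suc k"
        using k a unfolding card_central_arcs[OF a1 b2] card_central_arcs[OF a b] by (simp add: sb comp_le_def Suc_diff_le)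
      ultimately show thesis using that a1 b2 by blast
    next
      case False
      then have sa: "sum_list a = n"
        using full_cuts_iff[OF a assms] frobenius_cut_seaweed_full[OF fr' assms PQ] by simp
      have a2: "comp_le (Suc n) (a @ [1])" using a sa by (auto simp: comp_le_def)
      have "?e q = seaweed (Suc n) (a @ [1]) b"
        unfolding seaweed_eq_cut_seaweed[OF a2 b1] cuts_snoc sa ext using False by simp
      moreover have "card (central_arcs (Suc n) (a @ [1]) b) = Suc k"
        using k b unfolding card_central_arcs[OF a2 b1] card_central_arcs[OF a b] by (simp add: sa comp_le_def Suc_diff_le)
      ultimately show thesis using that a2 b1 by blast
    qed
    then show ?thesis using fe unfolding frobenius_seaweeds_central_def by auto
  qed
  then show "\<exists>f :: 'k mat set \<Rightarrow> 'k mat set.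
      f \<in> frobenius_seaweeds_central n k \<rightarrow> frobenius_seaweeds_central (n + 1) (k + 1) \<and>
      inj_on f (frobenius_seaweeds_central n k)"
    using inj_on_subset[OF extend_seaweed_inj_on[OF assms] sub] by (intro exI[of _ ?e]) auto
next
  let ?F = "frobenius_seaweeds n :: 'k mat set set"
  let ?e = "extend_seaweed n :: 'k mat set \<Rightarrow> 'k mat set"
  have eF: "?e q \<in> frobenius_seaweeds (Suc n)" if "q \<in> ?F" for q
    by (rule extend_seaweed_frobenius[OF assms that])
  \<comment> \<open>A seaweed in the image has a set of cuts that contains both \<open>n\<close> and \<open>Suc n\<close>; neither set of \<open>z\<close> does.\<close>
  define m where "m = Suc n div 2"
  define z where "z = (cut_seaweed (Suc n) {1..m} {Suc n} :: 'k mat set)"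
  have m: "m < Suc n" "m \<le> n" using assms by (auto simp: m_def)
  have zs: "{1..m} \<subseteq> {1..Suc n}" "{Suc n} \<subseteq> {1..Suc n}" using m by auto
  have z: "z \<in> frobenius_seaweeds (Suc n)"
    unfolding z_def by (intro frobenius_seaweedsI zs frobenius_staircase[OF m_def])
  have "card (?F // swap_rel n) < card ((frobenius_seaweeds (Suc n) :: 'k mat set set) // swap_rel (Suc n))"
  proof (rule card_quotient_less[OF equiv_swap_rel equiv_swap_rel finite_frobenius_seaweeds _ _ z])
    show "?e ` ?F \<subseteq> frobenius_seaweeds (Suc n)" using eF by blast
    show "(?e x, ?e y) \<in> swap_rel (Suc n) \<longleftrightarrow> (x, y) \<in> swap_rel n" if "x \<in> ?F" "y \<in> ?F" for x y
      by (rule extend_seaweed_swap_rel_iff[OF assms that eF[OF that(1)] eF[OF that(2)]])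
    show "(?e x, z) \<notin> swap_rel (Suc n)" if x: "x \<in> ?F" for x
    proof
      assume r: "(?e x, z) \<in> swap_rel (Suc n)"
      obtain P Q where PQ: "P \<subseteq> {1..n}" "Q \<subseteq> {1..n}" and fr: "frobenius (2 * n) (cut_seaweed n P Q :: 'k mat set)"
        and xP: "x = cut_seaweed n P Q" using x by (auto simp: frobenius_seaweeds_eq)
      have fq: "n \<in> P \<longleftrightarrow> n \<notin> Q" by (rule frobenius_cut_seaweed_full[OF fr assms PQ])
      have s: "insert (Suc n) P \<subseteq> {1..Suc n}" "insert (Suc n) Q \<subseteq> {1..Suc n}" "P \<subseteq> {1..Suc n}" "Q \<subseteq> {1..Suc n}"
        using PQ by auto
      have nm: "Suc n \<notin> {1..m}" "n \<notin> {Suc n}" using m by auto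
      show False
      proof (cases "n \<in> Q")
        case True
        then have "?e x = cut_seaweed (Suc n) P (insert (Suc n) Q)" unfolding xP extend_cut_seaweed[OF PQ] by simp
        then have "P = {1..m} \<and> insert (Suc n) Q = {Suc n} \<or> P = {Suc n} \<and> insert (Suc n) Q = {1..m}"
          using swap_rel_cut_seaweed[OF s(3,2) zs, where 'k='k] r eF[OF x] z unfolding z_def by simp
        then show False using True nm by blast
      next
        case False
        then have "?e x = cut_seaweed (Suc n) (insert (Suc n) P) Q" unfolding xP extend_cut_seaweed[OF PQ] by simp
        then have "insert (Suc n) P = {1..m} \<and> Q = {Suc n} \<or> insert (Suc n) P = {Suc n} \<and> Q = {1..m}"
          using swap_rel_cut_seaweed[OF s(1,4) zs, where 'k='k] r eF[OF x] z unfolding z_def by simp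
        then show False using False fq nm by blast
      qed
    qed
  qed
  then show "num_frobenius TYPE('k) (n + 1) > num_frobenius TYPE('k) n"
    by (simp add: num_frobenius_def)
qed

end
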